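(* Let $X$ be a Banach space with the Radon–Nikodým property and let $\Gamma:[0,1]\to cwk(X)$ be a variationally Henstock integrable multifunction. Then every strongly measurable selection of $\Gamma$ is variationally Henstock integrable.
   Context: $[0,1]$ carries Lebesgue measure $\lambda$; $\mathcal{I}$ is the family of all closed subintervals of $[0,1]$ and $|I|$ is the length of $I\in\mathcal{I}$. $cwk(X)$ is the family of all non-empty convex weakly compact subsets of $X$, with Minkowski addition, multiplication by scalars, and the Hausdorff distance $d_H$ (coming from the norm). A function $f:[0,1]\to X$ is a selection of $\Gamma$ if $f(t)\in\Gamma(t)$ for every $t\in[0,1]$. A function $f:[0,1]\to X$ is strongly (Bochner) measurable if it is the $\lambda$-a.e. norm limit of a sequence of simple measurable functions. A gauge is a function $\delta:[0,1]\to(0,\infty)$. A partition of $[0,1]$ is a finite collection $\{(I_1,t_1),\dots,(I_p,t_p)\}$ of non-overlapping closed subintervals $I_i$ with union $[0,1]$ and points $t_i\in[0,1]$; it is a Perron partition if $t_i\in I_i$ for all $i$; it is $\delta$-fine if $I_i\subset(t_i-\delta(t_i),t_i+\delta(t_i))$ for all $i$. $\Gamma:[0,1]\to cwk(X)$ is variationally Henstock integrable if there is a finitely additive $\Phi_\Gamma:\mathcal{I}\to cwk(X)$ such that for every $\varepsilon>0$ there is a gauge $\delta$ on $[0,1]$ with $\sum_{j=1}^p d_H(\Phi_\Gamma(I_j),\Gamma(t_j)|I_j|)<\varepsilon$ for every $\delta$-fine Perron partition $\{(I_1,t_1),\dots,(I_p,t_p)\}$ of $[0,1]$. For functions $f:[0,1]\to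 X$ the same definition is used with $f$ identified with $t\mapsto\{f(t)\}$ and the primitive taking values in $X$. *)

theory Defs
  imports "HOL-Analysis.Analysis"
begin

definition weak_topology :: "'a::real_normed_vector topology" where
  "weak_topology =
     topology_generated_by {g -` U | (g :: 'a \<Rightarrow> real) U. bounded_linear g \<and> open U}"

definition cwk :: "'a::real_normed_vector set set" where
  "cwk = {K. K \<noteq> {} \<and> convex K \<and> compactin weak_topology K}"

(* The suprema are suprema of bounded sets of reals when A and B are nonempty and bounded,
   in particular for members of cwk. *)
definition hausdorff_dist :: "'a::metric_space set \<Rightarrow> 'a set \<Rightarrow> real" where
  "hausdorff_dist A B = max (SUP x\<in>A. infdist x B) (SUP y\<in>B. infdist y A)"

(* Degenerate intervals are included, in accordance with tagged_division_of, which admits them;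
   additivity forces an interval function with values in cwk to be {0} on them. *)
definition subintervals :: "real set set" where
  "subintervals = {{a..b} | a b. 0 \<le> a \<and> a \<le> b \<and> b \<le> 1}"

(* The sum on the right-hand side is the Minkowski sum of Set_Algebras. *)
definition additive_interval_fun :: "(real set \<Rightarrow> 'a::real_normed_vector set) \<Rightarrow> bool" where
  "additive_interval_fun \<Phi> \<longleftrightarrow>
     (\<forall>I\<in>subintervals. \<forall>J\<in>subintervals.
        interior I \<inter> interior J = {} \<and> I \<union> J \<in> subintervals \<longrightarrow> \<Phi> (I \<union> J) = \<Phi> I + \<Phi> J)"

(* A tagged_division_of is a Perron partition (the tags lie in their intervals); being fine for
   the balls of radius d t is being d-fine. *)
definition vH_primitive ::
    "(real \<Rightarrow> 'a::real_normed_vector set) \<Rightarrow> (real set \<Rightarrow> 'a set) \<Rightarrow> bool" where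
  "vH_primitive \<Gamma> \<Phi> \<longleftrightarrow>
     (\<forall>I\<in>subintervals. \<Phi> I \<in> cwk) \<and>
     additive_interval_fun \<Phi> \<and>
     (\<forall>\<epsilon>>0. \<exists>d :: real \<Rightarrow> real. (\<forall>t\<in>{0..1}. d t > 0) \<and>
        (\<forall>p. p tagged_division_of {0..1} \<and> (\<lambda>t. ball t (d t)) fine p \<longrightarrow>
           (\<Sum>(t, I)\<in>p. hausdorff_dist (\<Phi> I) ((\<lambda>x. measure lborel I *\<^sub>R x) ` \<Gamma> t)) < \<epsilon>))"

definition vH_integrable_multi :: "(real \<Rightarrow> 'a::real_normed_vector set) \<Rightarrow> bool" where
  "vH_integrable_multi \<Gamma> \<longleftrightarrow> (\<exists>\<Phi>. vH_primitive \<Gamma> \<Phi>)"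

definition vH_integrable_fun :: "(real \<Rightarrow> 'a::real_normed_vector) \<Rightarrow> bool" where
  "vH_integrable_fun f \<longleftrightarrow>
     (\<exists>\<phi> :: real set \<Rightarrow> 'a. vH_primitive (\<lambda>t. {f t}) (\<lambda>I. {\<phi> I}))"

definition strongly_measurable :: "'b measure \<Rightarrow> ('b \<Rightarrow> 'a::real_normed_vector) \<Rightarrow> bool" where
  "strongly_measurable M f \<longleftrightarrow>
     (\<exists>s. (\<forall>n. simple_function M (s n)) \<and> (AE x in M. (\<lambda>n. s n x) \<longlonglongrightarrow> f x))"

(* The Bochner integral without the second countability of the value space which
   has_bochner_integral demands. *)
definition has_strong_bochner_integral ::
    "'b measure \<Rightarrow> ('b \<Rightarrow> 'a::real_normed_vector) \<Rightarrow> 'a \<Rightarrow> bool" where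
  "has_strong_bochner_integral M f v \<longleftrightarrow>
     strongly_measurable M f \<and>
     (\<exists>s. (\<forall>n. Bochner_Integration.simple_bochner_integrable M (s n)) \<and>
          (\<lambda>n. \<integral>\<^sup>+x. norm (f x - s n x) \<partial>M) \<longlonglongrightarrow> 0 \<and>
          (\<lambda>n. Bochner_Integration.simple_bochner_integral M (s n)) \<longlonglongrightarrow> v)"

definition vector_measure :: "'b measure \<Rightarrow> ('b set \<Rightarrow> 'a::real_normed_vector) \<Rightarrow> bool" where
  "vector_measure M \<nu> \<longleftrightarrow>
     (\<forall>A :: nat \<Rightarrow> 'b set. range A \<subseteq> sets M \<and> disjoint_family A \<longrightarrow>
        (\<lambda>n. \<nu> (A n)) sums \<nu> (\<Union>n. A n))"

definition bounded_variation_measure ::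
    "'b measure \<Rightarrow> ('b set \<Rightarrow> 'a::real_normed_vector) \<Rightarrow> bool" where
  "bounded_variation_measure M \<nu> \<longleftrightarrow>
     (\<exists>C. \<forall>P. finite P \<and> P \<subseteq> sets M \<and> partition_on (space M) P \<longrightarrow>
        (\<Sum>E\<in>P. norm (\<nu> E)) \<le> C)"

definition continuous_wrt_measure ::
    "'b measure \<Rightarrow> ('b set \<Rightarrow> 'a::real_normed_vector) \<Rightarrow> bool" where
  "continuous_wrt_measure M \<nu> \<longleftrightarrow>
     (\<forall>\<epsilon>>0. \<exists>\<delta>>0. \<forall>E\<in>sets M. measure M E < \<delta> \<longrightarrow> norm (\<nu> E) < \<epsilon>)"

definition RNP_wrt :: "'a::real_normed_vector itself \<Rightarrow> 'b measure \<Rightarrow> bool" where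
  "RNP_wrt _ M \<longleftrightarrow>
     (\<forall>\<nu> :: 'b set \<Rightarrow> 'a.
        vector_measure M \<nu> \<and> bounded_variation_measure M \<nu> \<and> continuous_wrt_measure M \<nu> \<longrightarrow>
        (\<exists>g. \<forall>E\<in>sets M. has_strong_bochner_integral M (\<lambda>x. indicator E x *\<^sub>R g x) (\<nu> E)))"

(* HOL cannot quantify over all types of underlying points inside a formula, so the finite measure
   spaces range over those whose points are real numbers. This is no restriction: the
   Radon-Nikodym property with respect to Lebesgue measure on [0,1] already implies it for every
   finite measure space. *)
definition radon_nikodym_property :: "'a::real_normed_vector itself \<Rightarrow> bool" where
  "radon_nikodym_property X \<longleftrightarrow> (\<forall>M :: real measure. finite_measure M \<longrightarrow> RNP_wrt X M)"

end

theory Submission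
  imports Defs
begin

text \<open>
  Let \<open>\<Phi>\<close> be the primitive of \<open>\<Gamma>\<close> and let \<open>N u v\<close> be the supremum of the norms in
  \<open>\<Phi> {u..v}\<close>; it is finite because weakly compact sets are bounded. Every primitive \<open>F\<close> of the
  selection \<open>f\<close> on a subinterval must satisfy \<open>norm (F v - F u) \<le> N u v\<close>, since by the
  integrability of \<open>\<Gamma>\<close> the increment \<open>F v - F u\<close> has distance zero from \<open>\<Phi> {u..v}\<close>. This bound
  is what makes a primitive of \<open>f\<close> constructible in the norm topology, by the transfinite method
  of Denjoy in the form that Romanovski gave it: let \<open>P\<close> be the set of points without a
  neighbourhood on which \<open>f\<close> is integrable, suppose that \<open>P\<close> is not empty, and produce an interval
  around a point of \<open>P\<close> on which \<open>f\<close> is integrable after all.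

  Near a tag \<open>t\<close> the number \<open>N u v\<close> is at most \<open>(v - u) * C t\<close> with \<open>C t\<close> the supremum of the
  norms in \<open>\<Gamma> t\<close>, up to an error that is controlled in sum. By the Baire category theorem there are an
  interval \<open>(c, d)\<close> meeting \<open>P\<close> and a monotone function \<open>V\<close> with \<open>N u v \<le> V v - V u\<close> for all
  intervals in \<open>(c, d)\<close> that contain a point of \<open>P\<close>. There are two consequences. First, \<open>f\<close> is
  Bochner integrable on the part of \<open>P\<close> in \<open>(c, d)\<close>, because \<open>norm (f t) * (v - u)\<close> is bounded by
  \<open>N u v\<close> up to a small error, and \<open>f\<close> is strongly measurable. Second, \<open>f\<close> has a primitive \<open>\<kappa>\<close> on
  each gap of \<open>P\<close>, with continuous extension to the end points of the gap because \<open>N\<close> is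
  continuous, and the oscillations of these primitives have a finite sum because the increments of
  \<open>V\<close> over the gaps do. The indefinite Bochner integral plus the sum of all \<open>\<kappa>\<close> is then a
  primitive of \<open>f\<close> on the interval, in analogy to Harnack's extension of the integral.

  Throughout, sums over fine partitions are replaced by monotone functions: a
  nonnegative error \<open>D t u v\<close> has arbitrarily small sums over all sufficiently fine Perron
  partitions iff there are monotone functions \<open>W\<close> of arbitrarily small total increase with \<open>D t u v \<le> W v - W u\<close> whenever \<open>{u..v}\<close> is a short interval with tag \<open>t\<close>
  (\<open>variationally_null_of_gauge\<close>, \<open>gauge_of_variationally_null\<close>). This turns statements about
  partitions into local inequalities, for which countable unions of exceptional sets are harmless
  (\<open>variationally_null_UN\<close>), and which Cousin's lemma turns into global ones
  (\<open>subadditive_le_of_variationally_null\<close>). The Baire argument is \<open>portion_with_monotone_bound\<close>,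
  the Harnack extension is \<open>variationally_integrable_on_portion\<close>, and
  \<open>variationally_integrable_unit_interval\<close> puts the two together.
\<close>

section \<open>Weakly compact sets are bounded\<close>

text \<open>
  This is the Hahn-Banach theorem for a line. Partial functionals are represented by their graphs,
  linear subspaces of the product with the reals on which \<open>r \<le> norm x\<close>. This inequality at
  \<open>x = 0\<close> makes such a subspace single valued, and unions of chains stay in the class, so
  Zorn's lemma yields a maximal graph.
\<close>

lemma norming_functional:
  fixes x0 :: "'a::real_normed_vector"
  obtains g :: "'a \<Rightarrow>\<^sub>L real" where "\<And>x. g x \<le> norm x" "g x0 = norm x0"
proof -
  define dom where "dom G = (\<forall>x r. (x, r) \<in> G \<longrightarrow> r \<le> norm x)" for G :: "('a \<times> real) set"
  define \<A> where "\<A> = {G :: ('a \<times> real) set. subspace G \<and> (x0, norm x0) \<in> G \<and> dom G}"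
  have "\<exists>M\<in>\<A>. \<forall>X\<in>\<A>. M \<subseteq> X \<longrightarrow> X = M"
  proof (rule subset_Zorn_nonempty)
    have "r \<le> norm x" if "(x, r) \<in> span {(x0, norm x0)}" for x and r :: real
    proof -
      obtain c where "x = c *\<^sub>R x0" "r = c * norm x0"
        using \<open>(x, r) \<in> span {(x0, norm x0)}\<close> by (auto simp: span_singleton)
      then show ?thesis by (simp add: mult_right_mono)
    qed
    then have "span {(x0, norm x0)} \<in> \<A>"
      by (auto simp: \<A>_def dom_def span_base)
    then show "\<A> \<noteq> {}" by blast
  next
    fix \<C> assume "\<C> \<noteq> {}" and ch: "subset.chain \<A> \<C>"
    have sub: "\<C> \<subseteq> \<A>" and tot: "\<And>G H. G \<in> \<C> \<Longrightarrow> H \<in> \<C> \<Longrightarrow> G \<subseteq> H \<or> H \<subseteq> G"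
      using ch by (auto simp: subset_chain_def)
    have "subspace (\<Union>\<C>)"
    proof (rule subspaceI)
      show "0 \<in> \<Union>\<C>" using \<open>\<C> \<noteq> {}\<close> sub by (auto simp: \<A>_def dest: subspace_0)
      show "x + y \<in> \<Union>\<C>" if xy: "x \<in> \<Union>\<C>" "y \<in> \<Union>\<C>" for x y
      proof -
        obtain G where G: "G \<in> \<C>" "x \<in> G" using xy(1) by blast
        obtain H where H: "H \<in> \<C>" "y \<in> H" using xy(2) by blast
        from tot[OF G(1) H(1)] obtain K where "K \<in> \<C>" "x \<in> K" "y \<in> K"
          using G H by (elim disjE) (auto dest: subsetD)
        moreover from this sub have "subspace K" by (auto simp: \<A>_def)
        ultimately show ?thesis using subspace_add by blast
      qed
      show "c *\<^sub>R x \<in> \<Union>\<C>" if "x \<in> \<Union>\<C>" for c x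
        using that sub by (auto simp: \<A>_def intro: subspace_mul)
    qed
    then show "\<Union>\<C> \<in> \<A>"
      using \<open>\<C> \<noteq> {}\<close> sub by (auto simp: \<A>_def dom_def)
  qed
  then obtain G where G: "G \<in> \<A>" and max: "\<And>H. H \<in> \<A> \<Longrightarrow> G \<subseteq> H \<Longrightarrow> H = G"
    by blast
  have sG: "subspace G" and x0G: "(x0, norm x0) \<in> G" and dG: "\<And>x r. (x, r) \<in> G \<Longrightarrow> r \<le> norm x"
    using G by (auto simp: \<A>_def dom_def)
  have uniq: "r = s" if "(x, r) \<in> G" "(x, s) \<in> G" for x r s
  proof -
    have "(0, r - s) \<in> G" "(0, s - r) \<in> G"
      using subspace_diff[OF sG that] subspace_diff[OF sG that(2,1)] by auto
    then show ?thesis using dG[of 0 "r - s"] dG[of 0 "s - r"] by simp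
  qed
  have total: "\<exists>r. (y, r) \<in> G" for y
  proof -
    \<comment> \<open>The graph extends to \<open>y\<close> by any value between the following supremum and the
      corresponding infimum.\<close>
    define \<xi> where "\<xi> = (SUP (x, r)\<in>G. r - norm (x - y))"
    have cmp: "r - norm (x - y) \<le> norm (x' + y) - r'" if "(x, r) \<in> G" "(x', r') \<in> G" for x r x' r'
    proof -
      have "(x + x', r + r') \<in> G" using subspace_add[OF sG that] by simp
      then have "r + r' \<le> norm (x + x')" by (rule dG)
      also have "x + x' = (x - y) + (x' + y)" by simp
      also have "norm \<dots> \<le> norm (x - y) + norm (x' + y)" by (rule norm_triangle_ineq)
      finally show ?thesis by simp
    qed
    have bdd: "bdd_above ((\<lambda>(x, r). r - norm (x - y)) ` G)"
      using cmp[OF _ x0G] by (intro bdd_aboveI2[where M = "norm (x0 + y) - norm x0"]) auto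
    have lo: "r - norm (x - y) \<le> \<xi>" if "(x, r) \<in> G" for x r
      unfolding \<xi>_def using cSUP_upper[OF that bdd] by simp
    have hi: "\<xi> \<le> norm (x + y) - r" if "(x, r) \<in> G" for x r
      unfolding \<xi>_def using x0G cmp[OF _ that] by (intro cSUP_least) auto
    have "r + c * \<xi> \<le> norm (x + c *\<^sub>R y)" if "(x, r) \<in> G" for x r c
    proof (cases c "0 :: real" rule: linorder_cases)
      case equal
      then show ?thesis using dG[OF that] by simp
    next
      case greater
      have "((1/c) *\<^sub>R x, (1/c) * r) \<in> G"
        using subspace_mul[OF sG that, of "1/c"] by simp
      from hi[OF this] have "r / c + \<xi> \<le> norm ((1/c) *\<^sub>R x + y)" by simp
      then have "c * (r / c + \<xi>) \<le> norm (c *\<^sub>R ((1/c) *\<^sub>R x + y))"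
        using greater by (simp add: mult_left_mono)
      then show ?thesis using greater by (simp add: scaleR_add_right distrib_left)
    next
      case less
      have "((1/-c) *\<^sub>R x, (1/-c) * r) \<in> G"
        using subspace_mul[OF sG that, of "1/-c"] by simp
      from lo[OF this] have "r / -c - \<xi> \<le> norm ((1/-c) *\<^sub>R x - y)" by simp
      then have "(-c) * (r / -c - \<xi>) \<le> norm ((-c) *\<^sub>R ((1/-c) *\<^sub>R x - y))"
        using less by (simp add: mult_left_mono_neg)
      then show ?thesis using less by (simp add: scaleR_diff_right right_diff_distrib)
    qed
    moreover define H where "H = {u + v |u v. u \<in> G \<and> v \<in> span {(y, \<xi>)}}"
    ultimately have "\<forall>x r. (x, r) \<in> H \<longrightarrow> r \<le> norm x"
      by (auto simp: H_def span_singleton)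
    moreover have sup: "G \<subseteq> H"
    proof
      fix z assume "z \<in> G"
      moreover have "z = z + 0" "0 \<in> span {(y, \<xi>)}" by (auto simp: span_zero)
      ultimately show "z \<in> H" unfolding H_def by blast
    qed
    ultimately have "H \<in> \<A>"
      using subspace_sums[OF sG subspace_span, of "{(y, \<xi>)}", folded H_def] x0G
      by (auto simp: \<A>_def dom_def)
    from max[OF this sup] have "H = G" .
    moreover have "(y, \<xi>) \<in> H"
    proof -
      have "(y, \<xi>) = 0 + (y, \<xi>)" "0 \<in> G" "(y, \<xi>) \<in> span {(y, \<xi>)}"
        using sG by (auto simp: subspace_0 span_base)
      then show ?thesis unfolding H_def by blast
    qed
    ultimately show ?thesis by auto
  qed
  define g where "g y = (THE r. (y, r) \<in> G)" for y
  have g: "(y, r) \<in> G \<longleftrightarrow> g y = r" for y r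
    using total[of y] uniq unfolding g_def by (metis the_equality)
  have le: "g y \<le> norm y" for y using dG g by blast
  have "bounded_linear g"
  proof (rule bounded_linear_intro[where K = 1])
    show "g (x + y) = g x + g y" for x y
      using subspace_add[OF sG, of "(x, g x)" "(y, g y)"] g by auto
    show scale: "g (c *\<^sub>R x) = c *\<^sub>R g x" for c x
      using subspace_mul[OF sG, of "(x, g x)" c] g by auto
    show "norm (g x) \<le> norm x * 1" for x
      using le[of x] le[of "-x"] scale[of "-1" x] by auto
  qed
  then have app: "blinfun_apply (Blinfun g) = g"
    by (rule bounded_linear_Blinfun_apply)
  show thesis
  proof (rule that[of "Blinfun g"])
    show "blinfun_apply (Blinfun g) x \<le> norm x" for x using le app by simp
    show "blinfun_apply (Blinfun g) x0 = norm x0" using app x0G g by simp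
  qed
qed

text \<open>
  The points of \<open>K\<close> act on the dual space as functionals, pointwise bounded because continuous
  images of compact sets are bounded. The Banach-Steinhaus argument in the complete dual space makes
  them uniformly bounded, and \<open>norming_functional\<close> transfers this to the norms of the points.
\<close>

lemma compactin_weak_topology_imp_bounded:
  fixes K :: "'a::real_normed_vector set"
  assumes "compactin weak_topology K"
  shows "bounded K"
proof -
  have bd: "bounded ((\<lambda>x. blinfun_apply g x) ` K)" for g :: "'a \<Rightarrow>\<^sub>L real"
  proof -
    have "continuous_map weak_topology euclidean (blinfun_apply g)"
    proof -
      have "openin weak_topology (blinfun_apply g -` U)" if "open U" for U
      proof -
        have "blinfun_apply g -` U \<in> {h -` U |(h :: 'a \<Rightarrow> real) U. bounded_linear h \<and> open U}"
          using that blinfun.bounded_linear_right[of g] by blast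
        then show ?thesis unfolding weak_topology_def by (rule topology_generated_by_Basis)
      qed
      moreover from this[of UNIV] have "topspace weak_topology = (UNIV :: 'a set)"
        using openin_subset by fastforce
      ultimately show ?thesis by (simp add: continuous_map_def vimage_def)
    qed
    then show ?thesis
      using image_compactin[OF assms] compact_imp_bounded by (metis compactin_euclidean_iff)
  qed
  define C where "C n = (\<Inter>x\<in>K. {g :: 'a \<Rightarrow>\<^sub>L real. \<bar>g x\<bar> \<le> real n})" for n :: nat
  have closed: "closed (C n)" for n
    unfolding C_def by (intro closed_INT ballI closed_Collect_le continuous_intros)
  have cover: "(\<Union>n. C n) = UNIV"
  proof -
    have "\<exists>n. g \<in> C n" for g
    proof -
      obtain B where "\<And>x. x \<in> K \<Longrightarrow> \<bar>g x\<bar> \<le> B" using bd[of g] by (auto simp: bounded_iff)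
      moreover obtain n where "B \<le> real n" using real_arch_simple by blast
      ultimately have "g \<in> C n" unfolding C_def by (auto intro: order_trans)
      then show ?thesis ..
    qed
    then show ?thesis by blast
  qed
  have "\<exists>n. interior (C n) \<noteq> {}"
  proof (rule ccontr)
    assume "\<not> ?thesis"
    then have "(euclidean :: ('a \<Rightarrow>\<^sub>L real) topology) interior_of \<Union>(range C) = {}"
      by (intro Baire_category_alt) (auto simp: closed completely_metrizable_space_euclidean)
    then show False using cover by simp
  qed
  then obtain n g0 e where e: "e > 0" "cball g0 e \<subseteq> C n"
    by (meson ex_in_conv mem_interior_cball)
  have "norm x \<le> 2 * real n / e" if "x \<in> K" for x
  proof -
    obtain g where g: "\<And>y. blinfun_apply g y \<le> norm y" "blinfun_apply g x = norm x"
      using norming_functional[of x] by blast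
    have "norm g \<le> 1"
    proof (rule norm_blinfun_bound)
      show "norm (g y) \<le> 1 * norm y" for y
        using g(1)[of y] g(1)[of "-y"] by (simp add: blinfun.minus_right)
    qed simp
    then have "g0 + e *\<^sub>R g \<in> cball g0 e" "g0 \<in> cball g0 e"
      using \<open>e > 0\<close> by (auto simp: dist_norm)
    then have "\<bar>(g0 + e *\<^sub>R g) x\<bar> \<le> n" "\<bar>g0 x\<bar> \<le> n"
      using e \<open>x \<in> K\<close> unfolding C_def by blast+
    then have "e * norm x \<le> 2 * real n"
      by (simp add: blinfun.add_left blinfun.scaleR_left g(2))
    then show ?thesis using \<open>e > 0\<close> by (simp add: field_simps)
  qed
  then show ?thesis by (auto simp: bounded_iff)
qed

section \<open>Variationally null interval functions\<close>

abbreviation near_tag :: "real \<Rightarrow> real \<Rightarrow> real \<Rightarrow> (real \<Rightarrow> real \<Rightarrow> bool) \<Rightarrow> bool" where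
  "near_tag t a b Q \<equiv>
     \<exists>\<delta>>0. \<forall>u v. a \<le> u \<and> u \<le> t \<and> t \<le> v \<and> v \<le> b \<and> v - u < \<delta> \<longrightarrow> Q u v"

abbreviation small_majorant ::
    "(real \<Rightarrow> real \<Rightarrow> real \<Rightarrow> real) \<Rightarrow> real set \<Rightarrow> real \<Rightarrow> real \<Rightarrow> real \<Rightarrow> bool" where
  "small_majorant D P a b \<epsilon> \<equiv> \<exists>W. mono W \<and> (\<forall>x. 0 \<le> W x \<and> W x \<le> \<epsilon>) \<and>
     (\<forall>t\<in>P. near_tag t a b (\<lambda>u v. D t u v \<le> W v - W u))"

lemma near_tag_mp:
  assumes "near_tag t a b P" "near_tag t a b Q"
    and "\<And>u v. a \<le> u \<Longrightarrow> u \<le> t \<Longrightarrow> t \<le> v \<Longrightarrow> v \<le> b \<Longrightarrow> P u v \<Longrightarrow> Q u v \<Longrightarrow> R u v"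
  shows "near_tag t a b R"
proof -
  obtain d where "d > 0" and d: "\<And>u v. a \<le> u \<and> u \<le> t \<and> t \<le> v \<and> v \<le> b \<and> v - u < d \<Longrightarrow> P u v"
    using assms(1) by blast
  obtain e where "e > 0" and e: "\<And>u v. a \<le> u \<and> u \<le> t \<and> t \<le> v \<and> v \<le> b \<and> v - u < e \<Longrightarrow> Q u v"
    using assms(2) by blast
  show ?thesis
    using \<open>d > 0\<close> \<open>e > 0\<close> d e assms(3) by (intro exI[of _ "min d e"]) auto
qed

lemma near_tag_length:
  fixes c :: real
  assumes "\<epsilon> > 0" "c \<ge> 0"
  shows "near_tag t a b (\<lambda>u v. (v - u) * c \<le> \<epsilon>)"
proof (intro exI[of _ "\<epsilon> / (c + 1)"] conjI allI impI)
  show "\<epsilon> / (c + 1) > 0" using assms by simp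
  fix u v assume "a \<le> u \<and> u \<le> t \<and> t \<le> v \<and> v \<le> b \<and> v - u < \<epsilon> / (c + 1)"
  then have "(v - u) * c \<le> \<epsilon> / (c + 1) * (c + 1)" using assms by (intro mult_mono) auto
  then show "(v - u) * c \<le> \<epsilon>" using assms by simp
qed

text \<open>
  This says that the variational measure generated by \<open>D\<close> vanishes on \<open>P\<close>, where \<open>D t u v\<close> is the
  contribution of the interval \<open>{u..v}\<close> with tag \<open>t\<close>. The majorant \<open>W\<close> lives on the whole line even
  if only intervals in \<open>{a..b}\<close> matter: this way the majorants for different intervals can be
  added.
\<close>

definition variationally_null ::
    "(real \<Rightarrow> real \<Rightarrow> real \<Rightarrow> real) \<Rightarrow> real set \<Rightarrow> real \<Rightarrow> real \<Rightarrow> bool" where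
  "variationally_null D P a b \<longleftrightarrow>
     (\<forall>\<epsilon>>0. small_majorant D P a b \<epsilon>)"

lemma variationally_nullI:
  assumes "\<And>\<epsilon>. \<epsilon> > 0 \<Longrightarrow> small_majorant D P a b \<epsilon>"
  shows "variationally_null D P a b"
  using assms unfolding variationally_null_def by blast

lemma variationally_nullE:
  assumes "variationally_null D P a b" "\<epsilon> > 0"
  obtains W where "mono W" "\<And>x. 0 \<le> W x" "\<And>x. W x \<le> \<epsilon>"
    and "\<And>t. t \<in> P \<Longrightarrow> near_tag t a b (\<lambda>u v. D t u v \<le> W v - W u)"
  using assms unfolding variationally_null_def by metis

text \<open>
  The hypothesis is local at each tag, so it allows the comparison of different error terms and of
  different surrounding intervals.
\<close>

lemma variationally_null_le:
  assumes "variationally_null D P a b" and Q: "Q \<subseteq> P"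
    and le: "\<And>t. t \<in> Q \<Longrightarrow> near_tag t a' b' (\<lambda>u v. a \<le> u \<and> v \<le> b \<and> E t u v \<le> D t u v)"
  shows "variationally_null E Q a' b'"
proof (rule variationally_nullI)
  fix \<epsilon> :: real assume "\<epsilon> > 0"
  from variationally_nullE[OF assms(1) this] obtain W
    where W: "mono W" "\<And>x. 0 \<le> W x" "\<And>x. W x \<le> \<epsilon>"
      and *: "\<And>t. t \<in> P \<Longrightarrow> near_tag t a b (\<lambda>u v. D t u v \<le> W v - W u)" by blast
  have "near_tag t a' b' (\<lambda>u v. E t u v \<le> W v - W u)"
    if t: "t \<in> Q" for t
  proof -
    obtain d1 where "d1 > 0" and d1: "\<And>u v. a' \<le> u \<Longrightarrow> u \<le> t \<Longrightarrow> t \<le> v \<Longrightarrow> v \<le> b' \<Longrightarrow> v - u < d1 \<Longrightarrow>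
        a \<le> u \<and> v \<le> b \<and> E t u v \<le> D t u v" using le[OF t] by blast
    obtain d2 where "d2 > 0" and d2: "\<And>u v. a \<le> u \<Longrightarrow> u \<le> t \<Longrightarrow> t \<le> v \<Longrightarrow> v \<le> b \<Longrightarrow> v - u < d2 \<Longrightarrow>
        D t u v \<le> W v - W u" using *[of t] t Q by blast
    show ?thesis
    proof (intro exI[of _ "min d1 d2"] conjI allI impI)
      show "min d1 d2 > 0" using \<open>d1 > 0\<close> \<open>d2 > 0\<close> by simp
      fix u v assume h: "a' \<le> u \<and> u \<le> t \<and> t \<le> v \<and> v \<le> b' \<and> v - u < min d1 d2"
      then have "a \<le> u \<and> v \<le> b \<and> E t u v \<le> D t u v" by (intro d1) auto
      moreover from this h have "D t u v \<le> W v - W u" by (intro d2) auto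
      ultimately show "E t u v \<le> W v - W u" by linarith
    qed
  qed
  then show "small_majorant E Q a' b' \<epsilon>"
    using W by blast
qed

lemma variationally_null_mono:
  assumes "variationally_null D P a b" "Q \<subseteq> P" "a \<le> a'" "b' \<le> b"
    and "\<And>t u v. t \<in> Q \<Longrightarrow> a' \<le> u \<Longrightarrow> u \<le> t \<Longrightarrow> t \<le> v \<Longrightarrow> v \<le> b' \<Longrightarrow> E t u v \<le> D t u v"
  shows "variationally_null E Q a' b'"
  by (rule variationally_null_le[OF assms(1,2)]) (use assms(3-) in \<open>force intro: exI[of _ 1]\<close>)

lemma variationally_null_localize:
  assumes "variationally_null D P c d" "Q \<subseteq> P" "Q \<subseteq> {c<..<d}"
    and "\<And>t u v. t \<in> Q \<Longrightarrow> c \<le> u \<Longrightarrow> u \<le> t \<Longrightarrow> t \<le> v \<Longrightarrow> v \<le> d \<Longrightarrow> E t u v \<le> D t u v"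
  shows "variationally_null E Q a b"
proof (rule variationally_null_le[OF assms(1,2)])
  fix t assume "t \<in> Q"
  then have "c < t" "t < d" using assms(3) by auto
  then show "near_tag t a b (\<lambda>u v. c \<le> u \<and> v \<le> d \<and> E t u v \<le> D t u v)"
    using assms(4)[OF \<open>t \<in> Q\<close>] by (intro exI[of _ "min (t - c) (d - t)"]) auto
qed

lemma variationally_null_zero: "(\<And>t u v. t \<in> P \<Longrightarrow> a \<le> u \<Longrightarrow> u \<le> t \<Longrightarrow> t \<le> v \<Longrightarrow> v \<le> b \<Longrightarrow> D t u v \<le> 0) \<Longrightarrow> variationally_null D P a b"
  by (rule variationally_nullI, rule exI[of _ "\<lambda>_. 0"]) (auto simp: mono_def intro: exI[of _ 1])

lemma variationally_null_add:
  assumes "variationally_null D P a b" "variationally_null E P a b"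
  shows "variationally_null (\<lambda>t u v. D t u v + E t u v) P a b"
proof (rule variationally_nullI)
  fix \<epsilon> :: real assume "\<epsilon> > 0"
  then have "\<epsilon>/2 > 0" by simp
  from variationally_nullE[OF assms(1) this] obtain W1
    where W1: "mono W1" "\<And>x. 0 \<le> W1 x" "\<And>x. W1 x \<le> \<epsilon>/2"
      and 1: "\<And>t. t \<in> P \<Longrightarrow> near_tag t a b (\<lambda>u v. D t u v \<le> W1 v - W1 u)" by blast
  from variationally_nullE[OF assms(2) \<open>\<epsilon>/2 > 0\<close>] obtain W2
    where W2: "mono W2" "\<And>x. 0 \<le> W2 x" "\<And>x. W2 x \<le> \<epsilon>/2"
      and 2: "\<And>t. t \<in> P \<Longrightarrow> near_tag t a b (\<lambda>u v. E t u v \<le> W2 v - W2 u)" by blast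
  have "near_tag t a b (\<lambda>u v. D t u v + E t u v \<le> (W1 v + W2 v) - (W1 u + W2 u))" if t: "t \<in> P" for t
    using 1[OF t] 2[OF t] by (rule near_tag_mp) linarith
  moreover have "mono (\<lambda>x. W1 x + W2 x)" using W1(1) W2(1) by (auto simp: mono_def intro: add_mono)
  moreover have "0 \<le> W1 x + W2 x \<and> W1 x + W2 x \<le> \<epsilon>" for x
    using W1(2,3)[of x] W2(2,3)[of x] by linarith
  ultimately show "small_majorant (\<lambda>t u v. D t u v + E t u v) P a b \<epsilon>"
    by (intro exI[of _ "\<lambda>x. W1 x + W2 x"]) blast
qed

lemma variationally_null_sum:
  assumes "finite I" "\<And>i. i \<in> I \<Longrightarrow> variationally_null (D i) P a b"
  shows "variationally_null (\<lambda>t u v. \<Sum>i\<in>I. D i t u v) P a b"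
  using assms
proof (induction I)
  case empty
  then show ?case by (simp add: variationally_null_zero)
next
  case (insert i I)
  then show ?case using variationally_null_add[of "D i" P a b "\<lambda>t u v. \<Sum>i\<in>I. D i t u v"] by simp
qed

lemma variationally_null_cmult:
  assumes "variationally_null D P a b" "c \<ge> 0"
  shows "variationally_null (\<lambda>t u v. c * D t u v) P a b"
proof (rule variationally_nullI)
  fix \<epsilon> :: real assume "\<epsilon> > 0"
  then have "\<epsilon>/(c+1) > 0" using \<open>c \<ge> 0\<close> by simp
  from variationally_nullE[OF assms(1) this] obtain W
    where W: "mono W" "\<And>x. 0 \<le> W x" "\<And>x. W x \<le> \<epsilon>/(c+1)"
      and 1: "\<And>t. t \<in> P \<Longrightarrow> near_tag t a b (\<lambda>u v. D t u v \<le> W v - W u)" by blast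
  have "near_tag t a b (\<lambda>u v. c * D t u v \<le> c * W v - c * W u)" if "t \<in> P" for t
    using 1[OF that] \<open>c \<ge> 0\<close> by (metis mult_left_mono right_diff_distrib)
  moreover have "mono (\<lambda>x. c * W x)" using W(1) \<open>c \<ge> 0\<close> by (auto simp: mono_def mult_left_mono)
  moreover have "0 \<le> c * W x \<and> c * W x \<le> \<epsilon>" for x
  proof -
    have "c * W x \<le> (c + 1) * W x" using W(2)[of x] by (simp add: distrib_right)
    also have "\<dots> \<le> \<epsilon>" using W(3)[of x] \<open>c \<ge> 0\<close> by (simp add: field_simps)
    finally show ?thesis using W(2)[of x] \<open>c \<ge> 0\<close> by simp
  qed
  ultimately show "small_majorant (\<lambda>t u v. c * D t u v) P a b \<epsilon>"
    by (intro exI[of _ "\<lambda>x. c * W x"]) blast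
qed

text \<open>
  Countable subadditivity of the variational measure: give the \<open>n\<close>-th set a majorant
  bounded by \<open>\<epsilon> / 2 ^ (n + 1)\<close> and add the majorants.
\<close>

lemma variationally_null_UN:
  fixes P :: "nat \<Rightarrow> real set"
  assumes "\<And>n. variationally_null D (P n) a b"
  shows "variationally_null D (\<Union>n. P n) a b"
proof (rule variationally_nullI)
  fix \<epsilon> :: real assume "\<epsilon> > 0"
  have "small_majorant D (P n) a b (\<epsilon> * (1/2) ^ Suc n)" for n
  proof -
    have "\<epsilon> * (1/2) ^ Suc n > 0" using \<open>\<epsilon> > 0\<close> by simp
    then show ?thesis using assms[of n] unfolding variationally_null_def by blast
  qed
  then obtain W where W: "\<And>n. mono (W n)" "\<And>n x. 0 \<le> W n x" "\<And>n x. W n x \<le> \<epsilon> * (1/2) ^ Suc n"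
    and 1: "\<And>n t. t \<in> P n \<Longrightarrow> near_tag t a b (\<lambda>u v. D t u v \<le> W n v - W n u)" by metis
  have geo: "(\<lambda>n. \<epsilon> * (1/2) ^ Suc n) sums (\<epsilon> * 1)"
    by (intro sums_mult power_half_series)
  have sm: "summable (\<lambda>n. W n x)" for x
    by (rule summable_comparison_test'[OF sums_summable[OF geo], of 0]) (use W in auto)
  define V where "V x = (\<Sum>n. W n x)" for x
  have "mono V" unfolding V_def mono_def using W(1) sm by (auto intro!: suminf_le dest: monoD)
  moreover have "0 \<le> V x \<and> V x \<le> \<epsilon>" for x
    unfolding V_def using suminf_nonneg[OF sm W(2)] suminf_le[OF W(3) sm sums_summable[OF geo]]
      sums_unique[OF geo] by simp
  moreover have "W n v - W n u \<le> V v - V u" if "u \<le> v" for n u v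
  proof -
    have "W n v - W n u = (\<Sum>k\<in>{n}. W k v - W k u)" by simp
    also have "\<dots> \<le> (\<Sum>k. W k v - W k u)"
      using monoD[OF W(1) that] by (intro sum_le_suminf summable_diff sm) auto
    also have "\<dots> = V v - V u" unfolding V_def by (intro suminf_diff[symmetric] sm)
    finally show ?thesis .
  qed
  then have "near_tag t a b (\<lambda>u v. D t u v \<le> V v - V u)" if "t \<in> P n" for n t
    using 1[OF that] by (meson order_trans)
  ultimately show "small_majorant D (\<Union>n. P n) a b \<epsilon>"
    by (intro exI[of _ V]) blast
qed

lemma variationally_null_countable_UN:
  assumes "countable I" "\<And>i. i \<in> I \<Longrightarrow> variationally_null D (P i) a b"
  shows "variationally_null D (\<Union>i\<in>I. P i) a b"
proof (cases "I = {}")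
  case True
  then show ?thesis by (auto intro: variationally_null_zero)
next
  case False
  have "variationally_null D (\<Union>n. P (from_nat_into I n)) a b"
    using assms(2) from_nat_into[OF False] by (intro variationally_null_UN) auto
  moreover have "(\<Union>n. P (from_nat_into I n)) = (\<Union>i\<in>I. P i)"
  proof -
    have "(\<Union>n. P (from_nat_into I n)) = (\<Union>i\<in>range (from_nat_into I). P i)" by blast
    then show ?thesis using range_from_nat_into[OF False assms(1)] by (simp only:)
  qed
  ultimately show ?thesis by simp
qed

lemma variationally_null_Un:
  assumes "variationally_null D P a b" "variationally_null D Q a b"
  shows "variationally_null D (P \<union> Q) a b"
proof -
  have "variationally_null D (\<Union>n::nat. if n = 0 then P else Q) a b"
    by (rule variationally_null_UN) (simp add: assms)
  moreover have "(\<Union>n::nat. if n = 0 then P else Q) = P \<union> Q"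
    by (auto split: if_splits intro: exI[of _ 0] exI[of _ 1])
  ultimately show ?thesis by simp
qed

text \<open>
  An error that tends to zero at a single tag is paid for by a jump of \<open>W\<close> at that tag. The
  jump is split into two halves, one on each side, since the tag may be an end point of the interval;
  for the degenerate interval no increase is left, which is the second hypothesis.
\<close>

lemma variationally_null_point:
  assumes "\<And>\<epsilon>. \<epsilon> > 0 \<Longrightarrow> near_tag t a b (\<lambda>u v. D t u v \<le> \<epsilon>)"
    and "D t t t \<le> 0"
  shows "variationally_null D {t} a b"
proof (rule variationally_nullI)
  fix \<epsilon> :: real assume "\<epsilon> > 0"
  then obtain \<delta> where "\<delta> > 0"
    and \<delta>: "\<And>u v. a \<le> u \<Longrightarrow> u \<le> t \<Longrightarrow> t \<le> v \<Longrightarrow> v \<le> b \<Longrightarrow> v - u < \<delta> \<Longrightarrow> D t u v \<le> \<epsilon>/2"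
    using assms(1)[of "\<epsilon>/2"] by auto
  define W where "W x = (if x < t then 0 else if x = t then \<epsilon>/2 else \<epsilon>)" for x
  have "mono W" using \<open>\<epsilon> > 0\<close> by (auto simp: W_def mono_def)
  moreover have "0 \<le> W x \<and> W x \<le> \<epsilon>" for x using \<open>\<epsilon> > 0\<close> by (auto simp: W_def)
  moreover have "D t u v \<le> W v - W u" if "a \<le> u \<and> u \<le> t \<and> t \<le> v \<and> v \<le> b \<and> v - u < \<delta>" for u v
  proof (cases "u = t \<and> v = t")
    case True
    then show ?thesis using assms(2) by simp
  next
    case False
    then show ?thesis using that \<delta>[of u v] \<open>\<epsilon> > 0\<close> by (auto simp: W_def)
  qed
  ultimately show "small_majorant D {t} a b \<epsilon>"
    using \<open>\<delta> > 0\<close> by (intro exI[of _ W]) blast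
qed

text \<open>
  Cousin's lemma: a local inequality between a subadditive and an additive interval function is
  global. The errors \<open>D\<close> are absorbed by the additive functions \<open>W v - W u\<close>.
\<close>

lemma subadditive_le_of_variationally_null:
  fixes E :: "real \<Rightarrow> real \<Rightarrow> real"
  assumes "a \<le> b"
    and D: "variationally_null D {a..b} a b"
    and sub: "\<And>u v w. a \<le> u \<Longrightarrow> u \<le> v \<Longrightarrow> v \<le> w \<Longrightarrow> w \<le> b \<Longrightarrow> E u w \<le> E u v + E v w"
    and le: "\<And>t. a \<le> t \<Longrightarrow> t \<le> b \<Longrightarrow> near_tag t a b (\<lambda>u v. E u v \<le> D t u v + (Y v - Y u))"
  shows "E a b \<le> Y b - Y a"
proof (rule field_le_epsilon)
  fix \<epsilon> :: real assume "\<epsilon> > 0"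
  from variationally_nullE[OF D this] obtain W
    where W: "mono W" "\<And>x. 0 \<le> W x" "\<And>x. W x \<le> \<epsilon>"
      and *: "\<And>t. t \<in> {a..b} \<Longrightarrow> near_tag t a b (\<lambda>u v. D t u v \<le> W v - W u)" by blast
  have "a \<le> a \<and> a \<le> b \<and> b \<le> b \<longrightarrow> E a b \<le> (Y b + W b) - (Y a + W a)"
  proof (rule Bolzano[OF \<open>a \<le> b\<close>, where P = "\<lambda>u v. a \<le> u \<and> u \<le> v \<and> v \<le> b \<longrightarrow> E u v \<le> (Y v + W v) - (Y u + W u)"])
    fix u v w assume "a \<le> u \<and> u \<le> v \<and> v \<le> b \<longrightarrow> E u v \<le> (Y v + W v) - (Y u + W u)"
      "a \<le> v \<and> v \<le> w \<and> w \<le> b \<longrightarrow> E v w \<le> (Y w + W w) - (Y v + W v)" "u \<le> v" "v \<le> w"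
    then show "a \<le> u \<and> u \<le> w \<and> w \<le> b \<longrightarrow> E u w \<le> (Y w + W w) - (Y u + W u)"
      using sub[of u v w] by auto
  next
    fix t assume local: "a \<le> t" "t \<le> b"
    have "t \<in> {a..b}" using local by simp
    from *[OF this] le[OF local] have "near_tag t a b (\<lambda>u v. E u v \<le> (Y v + W v) - (Y u + W u))"
      by (rule near_tag_mp) linarith
    then show "\<exists>d>0. \<forall>u v. u \<le> t \<and> t \<le> v \<and> v - u < d \<longrightarrow>
        a \<le> u \<and> u \<le> v \<and> v \<le> b \<longrightarrow> E u v \<le> (Y v + W v) - (Y u + W u)"
      by blast
  qed
  then show "E a b \<le> Y b - Y a + \<epsilon>"
    using \<open>a \<le> b\<close> W(2)[of a] W(3)[of b] by linarith
qed

section \<open>Gauges and monotone functions\<close>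

text \<open>
  The majorant at \<open>x\<close> is the supremum of the sums over all fine divisions of \<open>{a..x}\<close>. Appending
  the tagged interval \<open>(t, {u..v})\<close> to a fine division of \<open>{a..u}\<close> gives a fine division of
  \<open>{a..v}\<close>, which is the required inequality for the increments.
\<close>

lemma variationally_null_of_gauge:
  fixes D :: "real \<Rightarrow> real set \<Rightarrow> real"
  assumes "a \<le> b"
    and D: "\<And>t u v. a \<le> u \<Longrightarrow> u \<le> t \<Longrightarrow> t \<le> v \<Longrightarrow> v \<le> b \<Longrightarrow> 0 \<le> D t {u..v}"
    and D0: "\<And>t. a \<le> t \<Longrightarrow> t \<le> b \<Longrightarrow> D t {t} \<le> 0"
    and gauge: "\<And>\<epsilon>. \<epsilon> > 0 \<Longrightarrow> \<exists>\<gamma>. gauge \<gamma> \<and>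
      (\<forall>p. p tagged_division_of {a..b} \<and> \<gamma> fine p \<longrightarrow> (\<Sum>(t, I)\<in>p. D t I) \<le> \<epsilon>)"
  shows "variationally_null (\<lambda>t u v. D t {u..v}) {a..b} a b"
proof (rule variationally_nullI)
  fix \<epsilon> :: real assume "\<epsilon> > 0"
  from gauge[OF this] obtain \<gamma> where g: "gauge \<gamma> \<and>
      (\<forall>p. p tagged_division_of {a..b} \<and> \<gamma> fine p \<longrightarrow> (\<Sum>(t, I)\<in>p. D t I) \<le> \<epsilon>)" ..
  then have "gauge \<gamma>" by (rule conjunct1)
  have \<gamma>: "(\<Sum>(t, I)\<in>p. D t I) \<le> \<epsilon>" if "p tagged_division_of {a..b}" "\<gamma> fine p" for p
    using conjunct2[OF g, rule_format, OF conjI[OF that]] .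
  have pos: "0 \<le> D t I" if h: "p tagged_division_of {x..y}" "(t, I) \<in> p" "a \<le> x" "y \<le> b" for p x y t I
  proof -
    obtain u v where "I = {u..v}" "t \<in> I" "I \<subseteq> {x..y}"
      using tagged_division_ofD[OF h(1)] h(2) by (metis box_real(2))
    then show ?thesis using D[of u t v] h(3,4) by auto
  qed
  have join: "p \<union> q tagged_division_of {x..z}"
    if "p tagged_division_of {x..y}" "q tagged_division_of {y..z}" "x \<le> y" "y \<le> z" for p q and x y z :: real
  proof -
    have "p \<union> q tagged_division_of {x..y} \<union> {y..z}"
      using that by (intro tagged_division_Un) auto
    then show ?thesis using that(3,4) by (simp add: ivl_disj_un_two_touch)
  qed
  define S where "S x = {(\<Sum>(t, I)\<in>p. D t I) |p. p tagged_division_of {a..x} \<and> \<gamma> fine p}" for x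
  have grow: "\<exists>s'\<in>S y. s \<le> s'" if h: "s \<in> S x" "a \<le> x" "x \<le> y" "y \<le> b" for s x y
  proof -
    obtain p where p: "s = (\<Sum>(t, I)\<in>p. D t I)" "p tagged_division_of {a..x}" "\<gamma> fine p"
      using h(1) S_def by blast
    obtain q where q: "q tagged_division_of {x..y}" "\<gamma> fine q"
      using fine_division_exists_real[OF \<open>gauge \<gamma>\<close>] by blast
    have pq: "p \<union> q tagged_division_of {a..y}" by (rule join[OF p(2) q(1) h(2,3)])
    have "s \<le> (\<Sum>(t, I)\<in>p \<union> q. D t I)"
      unfolding p(1) using pos[OF pq] \<open>y \<le> b\<close> by (intro sum_mono2 tagged_division_ofD(1)[OF pq]) auto
    moreover have "(\<Sum>(t, I)\<in>p \<union> q. D t I) \<in> S y"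
      unfolding S_def using pq fine_Un[OF p(3) q(2)] by blast
    ultimately show ?thesis by blast
  qed
  have ne: "S x \<noteq> {}" for x
  proof -
    obtain q where "q tagged_division_of {a..x}" "\<gamma> fine q"
      using fine_division_exists_real[OF \<open>gauge \<gamma>\<close>] by blast
    then show ?thesis unfolding S_def by blast
  qed
  have le: "s \<le> \<epsilon>" if "s \<in> S x" "a \<le> x" "x \<le> b" for s x
    using grow[OF that(1,2,3)] \<gamma> unfolding S_def by fastforce
  have nonneg: "0 \<le> s" if "s \<in> S x" "a \<le> x" "x \<le> b" for s x
    using that pos unfolding S_def by (auto intro!: sum_nonneg)
  have bdd: "bdd_above (S x)" if "a \<le> x" "x \<le> b" for x
    using le that by (intro bdd_aboveI) auto
  define W where "W x = Sup (S (max a (min b x)))" for x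
  have W_eq: "W x = Sup (S x)" if "a \<le> x" "x \<le> b" for x
    using that by (simp add: W_def)
  have "mono W"
  proof (rule monoI)
    fix x y :: real assume "x \<le> y"
    then show "W x \<le> W y"
      unfolding W_def using \<open>a \<le> b\<close> ne grow bdd
      by (intro cSup_mono) (auto simp: max_def min_def)
  qed
  moreover have "0 \<le> W x \<and> W x \<le> \<epsilon>" for x
  proof -
    define y where "y = max a (min b x)"
    have y: "a \<le> y" "y \<le> b" using \<open>a \<le> b\<close> by (auto simp: y_def)
    obtain s where "s \<in> S y" using ne by blast
    then have "0 \<le> Sup (S y)"
      using nonneg[OF _ y] bdd[OF y] by (meson cSup_upper order_trans)
    moreover have "Sup (S y) \<le> \<epsilon>" using ne le[OF _ y] by (intro cSup_least) auto
    ultimately show ?thesis by (simp add: W_def y_def)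
  qed
  moreover have "near_tag t a b (\<lambda>u v. D t {u..v} \<le> W v - W u)"
    if "t \<in> {a..b}" for t
  proof -
    obtain \<delta> where "\<delta> > 0" and \<delta>: "ball t \<delta> \<subseteq> \<gamma> t"
      using \<open>gauge \<gamma>\<close> by (metis gauge_def open_contains_ball)
    have "D t {u..v} \<le> W v - W u" if h: "a \<le> u" "u \<le> t" "t \<le> v" "v \<le> b" "v - u < \<delta>" for u v
    proof (cases "u = v")
      case True
      then show ?thesis using h D0[of u] by auto
    next
      case False
      have "s \<le> W v - D t {u..v}" if s: "s \<in> S u" for s
      proof -
        obtain p where p: "s = (\<Sum>(t, I)\<in>p. D t I)" "p tagged_division_of {a..u}" "\<gamma> fine p"
          using s S_def by blast
        have "{u..v} \<subseteq> ball t \<delta>" using h by (auto simp: dist_real_def)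
        then have fine: "\<gamma> fine {(t, {u..v})}" using \<delta> by (auto simp: fine_def)
        have "p \<union> {(t, {u..v})} tagged_division_of {a..v}"
          using h by (intro join[OF p(2)] tagged_division_of_self_real) auto
        then have "(\<Sum>(t, I)\<in>p \<union> {(t, {u..v})}. D t I) \<in> S v"
          unfolding S_def using fine_Un[OF p(3) fine] by blast
        moreover have "(t, {u..v}) \<notin> p"
          using tagged_division_ofD(3)[OF p(2), of t "{u..v}"] h False by auto
        then have "(\<Sum>(t, I)\<in>p \<union> {(t, {u..v})}. D t I) = s + D t {u..v}"
          using p(1) tagged_division_ofD(1)[OF p(2)] by simp
        ultimately have "s + D t {u..v} \<le> Sup (S v)"
          using bdd[of v] h by (metis cSup_upper order_trans)
        then show ?thesis using W_eq[of v] h by simp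
      qed
      then have "Sup (S u) \<le> W v - D t {u..v}" by (rule cSup_least[OF ne])
      then show ?thesis using W_eq[of u] h by simp
    qed
    then show ?thesis using \<open>\<delta> > 0\<close> by blast
  qed
  ultimately show "\<exists>W. mono W \<and> (\<forall>x. 0 \<le> W x \<and> W x \<le> \<epsilon>) \<and>
        (\<forall>t\<in>{a..b}. near_tag t a b (\<lambda>u v. D t {u..v} \<le> W v - W u))"
    by (intro exI[of _ W]) blast
qed

text \<open>
  Over a tagged division the increments of the majorant telescope.
\<close>

lemma gauge_of_variationally_null:
  fixes D :: "real \<Rightarrow> real set \<Rightarrow> real"
  assumes "a \<le> b" and null: "variationally_null (\<lambda>t u v. D t {u..v}) {a..b} a b" and "\<epsilon> > 0"
  shows "\<exists>d. (\<forall>t. d t > (0::real)) \<and> (\<forall>p. p tagged_division_of {a..b} \<and> (\<lambda>t. ball t (d t)) fine p \<longrightarrow>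
           (\<Sum>(t, I)\<in>p. D t I) < \<epsilon>)"
proof -
  have "\<epsilon>/2 > 0" using \<open>\<epsilon> > 0\<close> by simp
  from variationally_nullE[OF null this] obtain W
    where W: "mono W" "\<And>x. 0 \<le> W x" "\<And>x. W x \<le> \<epsilon>/2"
      and *: "\<And>t. t \<in> {a..b} \<Longrightarrow> near_tag t a b (\<lambda>u v. D t {u..v} \<le> W v - W u)" by blast
  have "\<exists>\<delta>>0. t \<in> {a..b} \<longrightarrow> (\<forall>u v. a \<le> u \<and> u \<le> t \<and> t \<le> v \<and> v \<le> b \<and> v - u < \<delta> \<longrightarrow>
           D t {u..v} \<le> W v - W u)" for t
    using *[of t] zero_less_one by blast
  then obtain \<delta> where \<delta>0: "\<And>t. \<delta> t > 0"
    and \<delta>: "\<And>t u v. t \<in> {a..b} \<Longrightarrow> a \<le> u \<Longrightarrow> u \<le> t \<Longrightarrow> t \<le> v \<Longrightarrow> v \<le> b \<Longrightarrow> v - u < \<delta> t \<Longrightarrow>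
           D t {u..v} \<le> W v - W u" by metis
  show ?thesis
  proof (intro exI[of _ "\<lambda>t. \<delta> t / 2"] conjI allI impI)
    show "\<delta> t / 2 > 0" for t using \<delta>0[of t] by simp
    fix p assume p: "p tagged_division_of {a..b} \<and> (\<lambda>t. ball t (\<delta> t / 2)) fine p"
    have "(\<Sum>(t, I)\<in>p. D t I) \<le> (\<Sum>(t, I)\<in>p. W (Sup I) - W (Inf I))"
    proof (rule sum_mono, clarify)
      fix t I assume tI: "(t, I) \<in> p"
      obtain u v where I: "I = {u..v}" "t \<in> I" "I \<subseteq> {a..b}"
        using tagged_division_ofD[OF conjunct1[OF p]] tI by (metis box_real(2))
      have "I \<subseteq> ball t (\<delta> t / 2)" using p tI by (auto simp: fine_def)
      moreover have "u \<in> I" "v \<in> I" using I by auto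
      ultimately have "dist t u < \<delta> t / 2" "dist t v < \<delta> t / 2" by (meson mem_ball subsetD)+
      then have "v - u < \<delta> t" using I by (auto simp: dist_real_def)
      then show "D t I \<le> W (Sup I) - W (Inf I)" using \<delta>[of t u v] I by auto
    qed
    also have "\<dots> = W b - W a"
      using additive_tagged_division_1[OF \<open>a \<le> b\<close>] p by blast
    also have "\<dots> < \<epsilon>" using W(2)[of a] W(3)[of b] \<open>\<epsilon> > 0\<close> by linarith
    finally show "(\<Sum>(t, I)\<in>p. D t I) < \<epsilon>" .
  qed
qed

abbreviation increment_error ::
    "(real \<Rightarrow> 'a::real_normed_vector) \<Rightarrow> (real \<Rightarrow> 'a) \<Rightarrow> real \<Rightarrow> real \<Rightarrow> real \<Rightarrow> real" where
  "increment_error f F t u v \<equiv> norm (F v - F u - (v - u) *\<^sub>R f t)"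

section \<open>Variational primitives\<close>

definition variational_primitive ::
    "(real \<Rightarrow> 'a::real_normed_vector) \<Rightarrow> (real \<Rightarrow> 'a) \<Rightarrow> real \<Rightarrow> real \<Rightarrow> bool" where
  "variational_primitive f F a b \<longleftrightarrow>
     variationally_null (increment_error f F) {a..b} a b"

lemma variational_primitive_subset:
  assumes "variational_primitive f F a b" "a \<le> a'" "b' \<le> b"
  shows "variational_primitive f F a' b'"
  using assms unfolding variational_primitive_def
  by (elim variationally_null_mono) auto

lemma variational_primitive_cong:
  assumes "variational_primitive f F a b"
    and "\<And>u v. a \<le> u \<Longrightarrow> u \<le> v \<Longrightarrow> v \<le> b \<Longrightarrow> F' v - F' u = F v - F u"
    and "\<And>t. a \<le> t \<Longrightarrow> t \<le> b \<Longrightarrow> f' t = f t"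
  shows "variational_primitive f' F' a b"
  using assms(1) unfolding variational_primitive_def
  by (rule variationally_null_mono) (use assms(2,3) in auto)

text \<open>
  The norm of the difference of the two increments is subadditive and dominated by the sum of the
  two errors.
\<close>

lemma variational_primitive_unique:
  assumes F: "variational_primitive f F a b" and G: "variational_primitive f G a b" and "a \<le> b"
  shows "F b - F a = G b - G a"
proof -
  have "norm ((F b - F a) - (G b - G a)) \<le> 0 - 0"
  proof (rule subadditive_le_of_variationally_null[OF \<open>a \<le> b\<close>, where Y = "\<lambda>_. 0"])
    show "variationally_null (\<lambda>t u v. increment_error f F t u v + increment_error f G t u v) {a..b} a b"
      using F G unfolding variational_primitive_def by (rule variationally_null_add)
    show "norm ((F w - F u) - (G w - G u)) \<le> norm ((F v - F u) - (G v - G u)) + norm ((F w - F v) - (G w - G v))"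
      for u v w
    proof -
      have "(F w - F u) - (G w - G u) = ((F v - F u) - (G v - G u)) + ((F w - F v) - (G w - G v))" by simp
      then show ?thesis by (metis norm_triangle_ineq)
    qed
    have "norm ((F v - F u) - (G v - G u)) \<le> increment_error f F t u v + increment_error f G t u v + (0 - 0)"
      for t u v
    proof -
      have "(F v - F u) - (G v - G u) = (F v - F u - (v - u) *\<^sub>R f t) - (G v - G u - (v - u) *\<^sub>R f t)" by simp
      then show ?thesis by (metis norm_triangle_ineq4 add.right_neutral diff_zero)
    qed
    then show "near_tag t a b (\<lambda>u v. norm ((F v - F u) - (G v - G u)) \<le> increment_error f F t u v + increment_error f G t u v + (0 - 0))"
      for t by (intro exI[of _ 1]) auto
  qed
  then show ?thesis by simp
qed

lemma variational_primitive_continuous: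
  assumes "variational_primitive f F a b" "a \<le> t" "t \<le> b" "\<epsilon> > 0"
  shows "near_tag t a b (\<lambda>u v. norm (F v - F u) \<le> \<epsilon>)"
proof -
  have "\<epsilon>/2 > 0" using \<open>\<epsilon> > 0\<close> by simp
  from variationally_nullE[OF assms(1)[unfolded variational_primitive_def] this] obtain W
    where W: "mono W" "\<And>x. 0 \<le> W x" "\<And>x. W x \<le> \<epsilon>/2"
      and *: "\<And>t. t \<in> {a..b} \<Longrightarrow> near_tag t a b (\<lambda>u v. increment_error f F t u v \<le> W v - W u)" by blast
  have "t \<in> {a..b}" using assms(2,3) by simp
  from *[OF this] near_tag_length[OF \<open>\<epsilon>/2 > 0\<close> norm_ge_zero[of "f t"]] show ?thesis
  proof (rule near_tag_mp)
    fix u v assume uv: "u \<le> t" "t \<le> v" and le: "increment_error f F t u v \<le> W v - W u"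
      "(v - u) * norm (f t) \<le> \<epsilon>/2"
    have "norm (F v - F u) \<le> increment_error f F t u v + norm ((v - u) *\<^sub>R f t)"
      using norm_triangle_ineq[of "F v - F u - (v - u) *\<^sub>R f t" "(v - u) *\<^sub>R f t"] by simp
    then show "norm (F v - F u) \<le> \<epsilon>" using le uv W(2)[of u] W(3)[of v] by simp
  qed
qed

lemma variationally_null_point_of_continuous:
  assumes "\<And>\<epsilon>. \<epsilon> > 0 \<Longrightarrow> near_tag t a b (\<lambda>u v. norm (F v - F u) \<le> \<epsilon>)"
  shows "variationally_null (increment_error f F) {t} a b"
proof (rule variationally_null_point)
  fix \<epsilon> :: real assume "\<epsilon> > 0"
  then have "\<epsilon>/2 > 0" by simp
  from assms[OF this] near_tag_length[OF this norm_ge_zero[of "f t"]]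
  show "near_tag t a b (\<lambda>u v. increment_error f F t u v \<le> \<epsilon>)"
  proof (rule near_tag_mp)
    fix u v assume "u \<le> t" "t \<le> v" "norm (F v - F u) \<le> \<epsilon>/2" "(v - u) * norm (f t) \<le> \<epsilon>/2"
    then show "increment_error f F t u v \<le> \<epsilon>"
      using norm_triangle_ineq4[of "F v - F u" "(v - u) *\<^sub>R f t"] by simp
  qed
qed simp

text \<open>
  Primitives are continuous, so a single tag never contributes, whatever the value of the integrand.
\<close>

lemma variational_primitive_change:
  assumes F: "variational_primitive f F a b" and "finite S"
    and eq: "\<And>t. t \<in> {a..b} - S \<Longrightarrow> g t = f t"
  shows "variational_primitive g F a b"
proof -
  have "variationally_null (increment_error g F) ({a..b} - S) a b"
    using F unfolding variational_primitive_def
    by (rule variationally_null_mono) (use eq in auto)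
  moreover have "variationally_null (increment_error g F) (\<Union>t\<in>S \<inter> {a..b}. {t}) a b"
    using \<open>finite S\<close> variational_primitive_continuous[OF F]
    by (intro variationally_null_countable_UN variationally_null_point_of_continuous)
       (auto intro: countable_finite)
  ultimately have "variationally_null (increment_error g F)
      (({a..b} - S) \<union> (\<Union>t\<in>S \<inter> {a..b}. {t})) a b"
    by (rule variationally_null_Un)
  moreover have "({a..b} - S) \<union> (\<Union>t\<in>S \<inter> {a..b}. {t}) = {a..b}" by auto
  ultimately show ?thesis unfolding variational_primitive_def by simp
qed

lemma variational_primitive_join:
  assumes F: "variational_primitive f F a b" and G: "variational_primitive f G b c"
    and "a \<le> b" "b \<le> c"
  obtains H where "variational_primitive f H a c"
proof
  define H where "H x = (if x \<le> b then F x - F b else G x - G b)" for x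
  let ?D = "\<lambda>t u v. increment_error f H t u v"
  have "variationally_null ?D {a..<b} a c"
    using F unfolding variational_primitive_def
    by (rule variationally_null_le) (auto simp: H_def intro!: exI[of _ "b - t" for t])
  moreover have "variationally_null ?D {b<..c} a c"
    using G unfolding variational_primitive_def
    by (rule variationally_null_le) (auto simp: H_def intro!: exI[of _ "t - b" for t])
  moreover have "variationally_null ?D {b} a c"
  proof (rule variationally_null_point_of_continuous)
    fix \<epsilon> :: real assume "\<epsilon> > 0"
    then have "\<epsilon>/2 > 0" by simp
    obtain d1 where d1: "d1 > 0" "\<And>u v. a \<le> u \<Longrightarrow> u \<le> b \<Longrightarrow> b \<le> v \<Longrightarrow> v \<le> b \<Longrightarrow> v - u < d1 \<Longrightarrow> norm (F v - F u) \<le> \<epsilon>/2"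
      using variational_primitive_continuous[OF F \<open>a \<le> b\<close> order_refl \<open>\<epsilon>/2 > 0\<close>] by blast
    obtain d2 where d2: "d2 > 0" "\<And>u v. b \<le> u \<Longrightarrow> u \<le> b \<Longrightarrow> b \<le> v \<Longrightarrow> v \<le> c \<Longrightarrow> v - u < d2 \<Longrightarrow> norm (G v - G u) \<le> \<epsilon>/2"
      using variational_primitive_continuous[OF G order_refl \<open>b \<le> c\<close> \<open>\<epsilon>/2 > 0\<close>] by blast
    show "near_tag b a c (\<lambda>u v. norm (H v - H u) \<le> \<epsilon>)"
    proof (intro exI[of _ "min d1 d2"] conjI allI impI)
      show "min d1 d2 > 0" using d1 d2 by simp
      fix u v assume h: "a \<le> u \<and> u \<le> b \<and> b \<le> v \<and> v \<le> c \<and> v - u < min d1 d2"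
      have "H v - H u = (F b - F u) + (G v - G b)" using h by (auto simp: H_def)
      also have "norm \<dots> \<le> norm (F b - F u) + norm (G v - G b)" by (rule norm_triangle_ineq)
      also have "\<dots> \<le> \<epsilon>/2 + \<epsilon>/2" using h by (intro add_mono d1(2) d2(2)) auto
      finally show "norm (H v - H u) \<le> \<epsilon>" by simp
    qed
  qed
  ultimately have "variationally_null ?D (({a..<b} \<union> {b<..c}) \<union> {b}) a c"
    by (intro variationally_null_Un)
  moreover have "({a..<b} \<union> {b<..c}) \<union> {b} = {a..c}" using \<open>a \<le> b\<close> \<open>b \<le> c\<close> by auto
  ultimately show "variational_primitive f H a c" unfolding variational_primitive_def by simp
qed

section \<open>Primitives of Lebesgue and Bochner integrable functions\<close>

text \<open>
  Henstock's lemma supplies gauges for which the sums of the errors, not just the errors of the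
  sums, are small.
\<close>

lemma integrable_imp_variational_primitive:
  fixes f :: "real \<Rightarrow> real"
  assumes f: "f integrable_on {a..b}" and "a \<le> b"
  shows "variational_primitive f (\<lambda>x. integral {a..x} f) a b"
proof -
  define D where "D t I = norm (measure lborel I *\<^sub>R f t - integral I f)" for t I
  have "variationally_null (\<lambda>t u v. D t {u..v}) {a..b} a b"
  proof (rule variationally_null_of_gauge[OF \<open>a \<le> b\<close>])
    fix \<epsilon> :: real assume "\<epsilon> > 0"
    show "\<exists>\<gamma>. gauge \<gamma> \<and>
        (\<forall>p. p tagged_division_of {a..b} \<and> \<gamma> fine p \<longrightarrow> (\<Sum>(t, I)\<in>p. D t I) \<le> \<epsilon>)"
    proof (rule Henstock_lemma[OF f[folded box_real(2)] \<open>\<epsilon> > 0\<close>])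
      fix \<gamma> :: "real \<Rightarrow> real set"
      assume \<gamma>: "\<And>p. \<lbrakk>p tagged_partial_division_of (cbox a b); \<gamma> fine p\<rbrakk> \<Longrightarrow>
        sum (\<lambda>(x,k). norm (measure lborel k *\<^sub>R f x - integral k f)) p < \<epsilon>" and "gauge \<gamma>"
      show ?thesis
      proof (intro exI[of _ \<gamma>] conjI \<open>gauge \<gamma>\<close> allI impI)
        fix p assume "p tagged_division_of {a..b} \<and> \<gamma> fine p"
        then have "p tagged_partial_division_of (cbox a b)" "\<gamma> fine p"
          by (auto simp: tagged_division_of_def box_real)
        from less_imp_le[OF \<gamma>[OF this]] show "(\<Sum>(t, I)\<in>p. D t I) \<le> \<epsilon>" by (simp add: D_def)
      qed
    qed
  qed (auto simp: D_def)
  then show ?thesis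
    unfolding variational_primitive_def
  proof (rule variationally_null_mono)
    fix t u v assume h: "a \<le> u" "u \<le> t" "t \<le> v" "v \<le> b"
    have "integral {a..u} f + integral {u..v} f = integral {a..v} f"
      using h integrable_on_subinterval[OF f, of a v] by (intro Henstock_Kurzweil_Integration.integral_combine) auto
    then have "integral {a..v} f - integral {a..u} f = integral {u..v} f" by simp
    then show "norm (integral {a..v} f - integral {a..u} f - (v - u) *\<^sub>R f t) \<le> D t {u..v}"
      using h by (simp add: D_def abs_minus_commute)
  qed auto
qed

lemma variational_primitive_scaleR:
  assumes "variational_primitive g G a b"
  shows "variational_primitive (\<lambda>t. g t *\<^sub>R y) (\<lambda>x. G x *\<^sub>R y) a b"
  unfolding variational_primitive_def
proof (rule variationally_null_mono[OF variationally_null_cmult[OF assms[unfolded variational_primitive_def] norm_ge_zero[of y]]])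
  fix t u v :: real
  have "G v *\<^sub>R y - G u *\<^sub>R y - (v - u) *\<^sub>R g t *\<^sub>R y = (G v - G u - (v - u) *\<^sub>R g t) *\<^sub>R y"
    by (simp add: scaleR_diff_left)
  then show "norm (G v *\<^sub>R y - G u *\<^sub>R y - (v - u) *\<^sub>R g t *\<^sub>R y) \<le> norm y * increment_error g G t u v"
    by (metis norm_scaleR mult.commute real_norm_def order_refl)
qed auto

lemma variational_primitive_sum:
  assumes "finite I" "\<And>i. i \<in> I \<Longrightarrow> variational_primitive (f i) (F i) a b"
  shows "variational_primitive (\<lambda>t. \<Sum>i\<in>I. f i t) (\<lambda>x. \<Sum>i\<in>I. F i x) a b"
proof -
  have "variationally_null (\<lambda>t u v. \<Sum>i\<in>I. norm (F i v - F i u - (v - u) *\<^sub>R f i t)) {a..b} a b"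
    using assms unfolding variational_primitive_def by (rule variationally_null_sum)
  then show ?thesis
    unfolding variational_primitive_def
    by (rule variationally_null_mono)
       (auto simp: sum_subtractf[symmetric] scaleR_sum_right intro!: order_trans[OF norm_sum])
qed

text \<open>
  The integrands \<open>s\<close> approximate \<open>h\<close> in the sense of Riemann sums of \<open>norm (h t - s t)\<close>. This makes
  their primitives a Cauchy sequence, and the majorants of the approximation also bound the
  difference between the increments of the limit and those of each approximating primitive.
\<close>

lemma variational_primitive_of_approximation:
  fixes h :: "real \<Rightarrow> 'a::banach"
  assumes "a \<le> b" and approx: "\<And>\<epsilon>. \<epsilon> > 0 \<Longrightarrow> \<exists>s B W. variational_primitive s B a b \<and> mono W \<and>
      (\<forall>x. 0 \<le> W x \<and> W x \<le> \<epsilon>) \<and>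
      (\<forall>t\<in>{a..b}. near_tag t a b (\<lambda>u v. (v - u) * norm (h t - s t) \<le> W v - W u))"
  obtains B where "variational_primitive h B a b"
proof -
  have "\<exists>s B W. variational_primitive s B a b \<and> mono W \<and> (\<forall>x. 0 \<le> W x \<and> W x \<le> (1/2)^n) \<and>
      (\<forall>t\<in>{a..b}. near_tag t a b (\<lambda>u v. (v - u) * norm (h t - s t) \<le> W v - W u))" for n
    by (rule approx) simp
  then obtain s B W where vp: "\<And>n. variational_primitive (s n) (B n) a b" and mono: "\<And>n. mono (W n)"
    and W0: "\<And>n x. 0 \<le> W n x" and W1: "\<And>n x. W n x \<le> (1/2)^n"
    and close: "\<And>n t. t \<in> {a..b} \<Longrightarrow> near_tag t a b (\<lambda>u v. (v - u) * norm (h t - s n t) \<le> W n v - W n u)"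
    by metis
  have dist: "norm ((B n v - B n u) - (B m v - B m u)) \<le> (W n v + W m v) - (W n u + W m u)"
    if h: "a \<le> u" "u \<le> v" "v \<le> b" for u v n m
  proof (rule subadditive_le_of_variationally_null[OF h(2), where Y = "\<lambda>x. W n x + W m x"])
    let ?D = "\<lambda>k t u v. increment_error (s k) (B k) t u v"
    show "variationally_null (\<lambda>t x y. ?D n t x y + ?D m t x y) {u..v} u v"
      using variational_primitive_subset[OF vp h(1,3)] unfolding variational_primitive_def
      by (intro variationally_null_add)
    show "norm ((B n z - B n x) - (B m z - B m x)) \<le> norm ((B n y - B n x) - (B m y - B m x)) + norm ((B n z - B n y) - (B m z - B m y))"
      for x y z
    proof -
      have "(B n z - B n x) - (B m z - B m x) = ((B n y - B n x) - (B m y - B m x)) + ((B n z - B n y) - (B m z - B m y))" by simp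
      then show ?thesis by (metis norm_triangle_ineq)
    qed
    fix t assume t: "u \<le> t" "t \<le> v"
    then have "t \<in> {a..b}" using h by auto
    from close[OF this, of n] close[OF this, of m]
    have "near_tag t a b (\<lambda>x y. norm ((B n y - B n x) - (B m y - B m x))
        \<le> ?D n t x y + ?D m t x y + ((W n y + W m y) - (W n x + W m x)))"
    proof (rule near_tag_mp)
      fix x y assume xy: "x \<le> t" "t \<le> y" and le: "(y - x) * norm (h t - s n t) \<le> W n y - W n x"
        "(y - x) * norm (h t - s m t) \<le> W m y - W m x"
      have "(B n y - B n x) - (B m y - B m x) = (B n y - B n x - (y - x) *\<^sub>R s n t) - (B m y - B m x - (y - x) *\<^sub>R s m t)
          + ((y - x) *\<^sub>R (h t - s m t) - (y - x) *\<^sub>R (h t - s n t))"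
        by (simp add: scaleR_diff_right)
      also have "norm \<dots> \<le> (?D n t x y + ?D m t x y) + (norm ((y - x) *\<^sub>R (h t - s m t)) + norm ((y - x) *\<^sub>R (h t - s n t)))"
        by (intro order_trans[OF norm_triangle_ineq] add_mono norm_triangle_ineq4)
      finally show "norm ((B n y - B n x) - (B m y - B m x))
          \<le> ?D n t x y + ?D m t x y + ((W n y + W m y) - (W n x + W m x))"
        using le xy by simp
    qed
    then obtain \<delta> where "\<delta> > 0" and \<delta>: "\<forall>x y. a \<le> x \<and> x \<le> t \<and> t \<le> y \<and> y \<le> b \<and> y - x < \<delta> \<longrightarrow>
        norm ((B n y - B n x) - (B m y - B m x))
          \<le> ?D n t x y + ?D m t x y + ((W n y + W m y) - (W n x + W m x))" by metis
    then show "near_tag t u v (\<lambda>x y. norm ((B n y - B n x) - (B m y - B m x))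
        \<le> ?D n t x y + ?D m t x y + ((W n y + W m y) - (W n x + W m x)))"
      using h by (intro exI[of _ \<delta>]) auto
  qed
  define C where "C n x = B n x - B n a" for n x
  have pow: "(\<lambda>n. (1/2) ^ n :: real) \<longlonglongrightarrow> 0" by (rule LIMSEQ_realpow_zero) auto
  have "Cauchy (\<lambda>n. C n x)" if x: "a \<le> x" "x \<le> b" for x
  proof (rule metric_CauchyI)
    fix e :: real assume "e > 0"
    then have "e/2 > 0" by simp
    then obtain N where N: "\<And>n. n \<ge> N \<Longrightarrow> (1/2) ^ n < e/2"
      using order_tendstoD(2)[OF pow] unfolding eventually_sequentially by blast
    have "dist (C m x) (C n x) < e" if "m \<ge> N" "n \<ge> N" for m n
    proof -
      have "dist (C m x) (C n x) \<le> (W m x + W n x) - (W m a + W n a)"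
        using dist[of a x m n] x unfolding C_def dist_norm by simp
      also have "\<dots> \<le> (1/2)^m + (1/2)^n" using W0[of m a] W0[of n a] W1[of m x] W1[of n x] by linarith
      also have "\<dots> < e" using N[OF that(1)] N[OF that(2)] by simp
      finally show ?thesis .
    qed
    then show "\<exists>M. \<forall>m\<ge>M. \<forall>n\<ge>M. dist (C m x) (C n x) < e" by blast
  qed
  then have lim: "(\<lambda>n. C n x) \<longlonglongrightarrow> lim (\<lambda>n. C n x)" if "a \<le> x" "x \<le> b" for x
    using that by (simp add: Cauchy_convergent_iff convergent_LIMSEQ_iff)
  define G where "G x = lim (\<lambda>n. C n x)" for x
  have GB: "norm ((B n v - B n u) - (G v - G u)) \<le> W n v - W n u" if h: "a \<le> u" "u \<le> v" "v \<le> b" for u v n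
  proof (rule LIMSEQ_le)
    have "(\<lambda>m. norm ((B n v - B n u) - (C m v - C m u))) \<longlonglongrightarrow> norm ((B n v - B n u) - (G v - G u))"
      unfolding G_def using h by (intro tendsto_intros lim) auto
    then show "(\<lambda>m. norm ((B n v - B n u) - (B m v - B m u))) \<longlonglongrightarrow> norm ((B n v - B n u) - (G v - G u))"
      by (simp add: C_def)
    show "(\<lambda>m. W n v - W n u + (1/2)^m) \<longlonglongrightarrow> W n v - W n u"
      using tendsto_add[OF tendsto_const[of "W n v - W n u"] pow] by simp
    have "norm ((B n v - B n u) - (B m v - B m u)) \<le> W n v - W n u + (1/2)^m" for m
      using dist[OF h, of n m] W0[of m u] W1[of m v] by linarith
    then show "\<exists>N. \<forall>m\<ge>N. norm ((B n v - B n u) - (B m v - B m u)) \<le> W n v - W n u + (1/2)^m" by blast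
  qed
  have "variational_primitive h G a b"
    unfolding variational_primitive_def
  proof (rule variationally_nullI)
    fix \<epsilon> :: real assume "\<epsilon> > 0"
    then have "\<epsilon>/3 > 0" by simp
    then obtain n where n: "(1/2) ^ n < \<epsilon>/3"
      using order_tendstoD(2)[OF pow] unfolding eventually_sequentially by blast
    from variationally_nullE[OF vp[of n, unfolded variational_primitive_def] \<open>\<epsilon>/3 > 0\<close>] obtain V
      where V: "mono V" "\<And>x. 0 \<le> V x" "\<And>x. V x \<le> \<epsilon>/3"
        and *: "\<And>t. t \<in> {a..b} \<Longrightarrow> near_tag t a b (\<lambda>u v. increment_error (s n) (B n) t u v \<le> V v - V u)" by blast
    define U where "U x = V x + 2 * W n x" for x
    have "mono U" using V(1) mono[of n] unfolding U_def mono_def by (auto intro!: add_mono)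
    moreover have "0 \<le> U x \<and> U x \<le> \<epsilon>" for x
      using V(2,3)[of x] W0[of n x] W1[of n x] n unfolding U_def by linarith
    moreover have "near_tag t a b (\<lambda>u v. increment_error h G t u v \<le> U v - U u)" if t: "t \<in> {a..b}" for t
      using close[OF t] *[OF t]
    proof (rule near_tag_mp)
      fix u v assume uv: "a \<le> u" "u \<le> t" "t \<le> v" "v \<le> b" and le: "(v - u) * norm (h t - s n t) \<le> W n v - W n u"
        "increment_error (s n) (B n) t u v \<le> V v - V u"
      have "G v - G u - (v - u) *\<^sub>R h t = (B n v - B n u - (v - u) *\<^sub>R s n t)
          - ((B n v - B n u) - (G v - G u)) - (v - u) *\<^sub>R (h t - s n t)"
        by (simp add: scaleR_diff_right)
      also have "norm \<dots> \<le> (increment_error (s n) (B n) t u v + norm ((B n v - B n u) - (G v - G u)))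
          + norm ((v - u) *\<^sub>R (h t - s n t))"
        by (intro order_trans[OF norm_triangle_ineq4] add_mono norm_triangle_ineq4 order_refl)
      finally show "increment_error h G t u v \<le> U v - U u"
        using le uv GB[of u v n] by (simp add: U_def)
    qed
    ultimately show "\<exists>W. mono W \<and> (\<forall>x. 0 \<le> W x \<and> W x \<le> \<epsilon>) \<and>
        (\<forall>t\<in>{a..b}. near_tag t a b (\<lambda>u v. increment_error h G t u v \<le> W v - W u))"
      by (intro exI[of _ U]) blast
  qed
  then show thesis by (rule that)
qed

lemma simple_function_variational_primitive:
  fixes s :: "real \<Rightarrow> 'a::real_normed_vector"
  assumes s: "simple_function (lebesgue_on {a..b}) s" and "a \<le> b"
  obtains B where "variational_primitive s B a b"
proof -
  define A where "A y = s -` {y} \<inter> {a..b}" for y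
  have fin: "finite (s ` {a..b})" and meas: "\<And>y. A y \<in> sets (lebesgue_on {a..b})"
    using s simple_functionD[OF s] unfolding A_def by auto
  define B where "B x = (\<Sum>y\<in>s ` {a..b}. integral {a..x} (indicator (A y) :: real \<Rightarrow> real) *\<^sub>R y)" for x
  have "variational_primitive (\<lambda>t. \<Sum>y\<in>s ` {a..b}. (indicator (A y) t :: real) *\<^sub>R y) B a b"
    unfolding B_def
  proof (intro variational_primitive_sum fin variational_primitive_scaleR
      integrable_imp_variational_primitive \<open>a \<le> b\<close>)
    show "(indicator (A y) :: real \<Rightarrow> real) integrable_on {a..b}" for y
    proof (rule measurable_bounded_by_integrable_imp_integrable_real)
      show "(indicator (A y) :: real \<Rightarrow> real) \<in> borel_measurable (lebesgue_on {a..b})"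
        using meas by (rule borel_measurable_indicator)
      show "(\<lambda>_. 1 :: real) integrable_on {a..b}" by (rule integrable_const_ivl)
    qed (auto simp: indicator_def)
  qed
  then have "variational_primitive s B a b"
  proof (rule variational_primitive_cong)
    show "s t = (\<Sum>y\<in>s ` {a..b}. (indicator (A y) t :: real) *\<^sub>R y)" if "a \<le> t" "t \<le> b" for t
  proof -
    have "(\<Sum>y\<in>s ` {a..b}. (indicator (A y) t :: real) *\<^sub>R y) = (\<Sum>y\<in>s ` {a..b}. if y = s t then s t else 0)"
      using that by (intro sum.cong) (auto simp: A_def)
    also have "\<dots> = s t" using that fin by (simp add: sum.delta)
    finally show ?thesis by (rule sym)
  qed
  qed auto
  then show thesis by (rule that)
qed

text \<open>
  After changing the function to zero on a null set, the approximating simple functions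
  converge everywhere on the interval. Measurability is stated for the norm because the value space need not be
  separable.
\<close>

lemma strongly_measurable_pointwise:
  fixes h :: "real \<Rightarrow> 'a::real_normed_vector"
  assumes meas: "strongly_measurable (lebesgue_on {a..b}) h"
  obtains N s g where "negligible N" "\<And>n. simple_function (lebesgue_on {a..b}) (s n)"
    and "\<And>x. x \<in> {a..b} \<Longrightarrow> (\<lambda>n. s n x) \<longlonglongrightarrow> g x"
    and "\<And>x. g x = (if x \<in> N then 0 else h x)"
    and "(\<lambda>x. norm (g x)) \<in> borel_measurable (lebesgue_on {a..b})"
proof -
  let ?M = "lebesgue_on {a..b}"
  from meas[unfolded strongly_measurable_def] obtain s
    where s: "(\<forall>n. simple_function ?M (s n)) \<and> (AE x in ?M. (\<lambda>n. s n x) \<longlonglongrightarrow> h x)" ..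
  from s have conv: "AE x in ?M. (\<lambda>n. s n x) \<longlonglongrightarrow> h x" by (rule conjunct2)
  from s have s: "simple_function ?M (s n)" for n by blast
  obtain N where N: "\<And>x. x \<in> space ?M - N \<Longrightarrow> (\<lambda>n. s n x) \<longlonglongrightarrow> h x" "N \<in> null_sets ?M"
    by (rule AE_E3[OF conv], rule that)
  have neg: "negligible N"
    using N(2) by (auto simp: null_sets_restrict_space negligible_iff_null_sets)
  define g where "g x = (if x \<in> N then 0 else h x)" for x
  define s' where "s' n x = (if x \<in> N then 0 else s n x)" for n x
  have s': "simple_function ?M (s' n)" for n
  proof -
    have "N \<in> sets ?M" using N(2) by (rule null_setsD2)
    then have "space ?M \<inter> N \<in> sets ?M" by (rule sets.Int[OF sets.top])
    then have "{x \<in> space ?M. x \<in> N} \<in> sets ?M" by (simp only: Int_def mem_Collect_eq)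
    then show ?thesis unfolding s'_def by (intro simple_function_If s) simp_all
  qed
  have lim: "(\<lambda>n. s' n x) \<longlonglongrightarrow> g x" if "x \<in> {a..b}" for x
    using N(1)[of x] that unfolding s'_def g_def by auto
  have g_meas[measurable]: "(\<lambda>x. norm (g x)) \<in> borel_measurable ?M"
  proof (rule borel_measurable_LIMSEQ_real)
    show "(\<lambda>n. norm (s' n x)) \<longlonglongrightarrow> norm (g x)" if "x \<in> space ?M" for x
      using lim that by (auto intro: tendsto_norm)
    show "(\<lambda>x. norm (s' n x)) \<in> borel_measurable ?M" for n
      by (rule borel_measurable_simple_function[OF simple_function_compose1[OF s', where g = norm]])
  qed
  show thesis
    by (rule that[OF neg s' lim _ g_meas]) (simp_all add: g_def)
qed

text \<open>
  The Bochner integral, in variational form: truncated simple functions converge to \<open>h\<close> in mean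
  by dominated convergence for the real functions \<open>norm (h t - r n t)\<close>, whose indefinite integrals serve as
  majorants for the approximation.
\<close>

lemma strongly_measurable_norm_integrable_imp_variational_primitive:
  fixes h :: "real \<Rightarrow> 'a::banach"
  assumes meas: "strongly_measurable (lebesgue_on {a..b}) h"
    and int: "(\<lambda>t. norm (h t)) integrable_on {a..b}" and "a \<le> b"
  obtains B where "variational_primitive h B a b"
proof -
  let ?M = "lebesgue_on {a..b}"
  obtain N s' g where neg: "negligible N" and s': "\<And>n. simple_function ?M (s' n)"
    and lim: "\<And>x. x \<in> {a..b} \<Longrightarrow> (\<lambda>n. s' n x) \<longlonglongrightarrow> g x"
    and g_def: "\<And>x. g x = (if x \<in> N then 0 else h x)"
    and g_meas[measurable]: "(\<lambda>x. norm (g x)) \<in> borel_measurable ?M"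
    by (rule strongly_measurable_pointwise[OF meas], rule that)
  have g_int: "(\<lambda>x. norm (g x)) integrable_on {a..b}"
    by (rule integrable_spike[OF int neg]) (auto simp: g_def)
  \<comment> \<open>Cutting off where \<open>s' n\<close> exceeds twice the limit gives a dominated sequence.\<close>
  define r where "r n x = (if norm (s' n x) \<le> 2 * norm (g x) then s' n x else 0)" for n x
  have r: "simple_function ?M (r n)" for n
  proof -
    have [measurable]: "(\<lambda>x. norm (s' n x)) \<in> borel_measurable ?M"
      by (rule borel_measurable_simple_function[OF simple_function_compose1[OF s', where g = norm]])
    have "{x \<in> space ?M. norm (s' n x) \<le> 2 * norm (g x)} \<in> sets ?M" by measurable
    then show ?thesis unfolding r_def by (intro simple_function_If s') simp_all
  qed
  define q where "q n x = norm (g x - r n x)" for n x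
  have q_meas: "q n \<in> borel_measurable ?M" for n
  proof (rule borel_measurable_LIMSEQ_real)
    show "(\<lambda>m. norm (s' m x - r n x)) \<longlonglongrightarrow> q n x" if "x \<in> space ?M" for x
      unfolding q_def using lim that by (auto intro!: tendsto_intros)
    show "(\<lambda>x. norm (s' m x - r n x)) \<in> borel_measurable ?M" for m
      by (rule borel_measurable_simple_function[OF simple_function_compose2[OF s' r, where h = "\<lambda>x y. norm (x - y)"]])
  qed
  have q_le: "norm (q n x) \<le> 3 * norm (g x)" for n x
  proof -
    have "norm (g x - r n x) \<le> norm (g x) + norm (r n x)" by (rule norm_triangle_ineq4)
    also have "norm (r n x) \<le> 2 * norm (g x)" by (simp add: r_def)
    finally show ?thesis by (simp add: q_def)
  qed
  have g3: "(\<lambda>x. 3 * norm (g x)) integrable_on {a..b}"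
    by (rule integrable_on_mult_right[OF g_int])
  have q_int: "q n integrable_on {a..b}" for n
    by (rule measurable_bounded_by_integrable_imp_integrable_real[OF q_meas g3])
       (use q_le in auto)
  have "(\<lambda>n. q n x) \<longlonglongrightarrow> 0" if x: "x \<in> {a..b}" for x
  proof -
    have "(\<lambda>n. r n x) \<longlonglongrightarrow> g x"
    proof (cases "g x = 0")
      case True
      then have "r n x = 0" for n by (simp add: r_def)
      then show ?thesis using True by simp
    next
      case False
      then have "norm (g x) < 2 * norm (g x)" by simp
      then have "\<forall>\<^sub>F n in sequentially. norm (s' n x) < 2 * norm (g x)"
        by (rule order_tendstoD(2)[OF tendsto_norm[OF lim[OF x]]])
      then have "\<forall>\<^sub>F n in sequentially. s' n x = r n x"
        by eventually_elim (simp add: r_def)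
      then show ?thesis by (rule Lim_transform_eventually[OF lim[OF x]])
    qed
    then have "(\<lambda>n. norm (g x - r n x)) \<longlonglongrightarrow> norm (g x - g x)" by (intro tendsto_intros)
    then show ?thesis by (simp add: q_def)
  qed
  from dominated_convergence(2)[OF q_int g3 q_le this]
  have lim0: "(\<lambda>n. integral {a..b} (q n)) \<longlonglongrightarrow> 0" by simp
  show thesis
  proof (rule variational_primitive_of_approximation[OF \<open>a \<le> b\<close> _ that])
    fix \<epsilon> :: real assume "\<epsilon> > 0"
    then have "\<epsilon>/2 > 0" by simp
    then obtain n where n: "integral {a..b} (q n) < \<epsilon>/2"
      using order_tendstoD(2)[OF lim0] unfolding eventually_sequentially by blast
    obtain B where B: "variational_primitive (r n) B a b"
      using simple_function_variational_primitive[OF r \<open>a \<le> b\<close>] .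
    define k where "k x = norm (h x - r n x)" for x
    have k: "k integrable_on {a..b}"
      by (rule integrable_spike[OF q_int neg]) (auto simp: k_def q_def g_def)
    have kq: "integral {a..b} k = integral {a..b} (q n)"
      by (rule integral_spike[OF neg]) (auto simp: k_def q_def g_def)
    define K where "K x = integral {a..x} k" for x
    have K_mono: "K x \<le> K y" if "a \<le> x" "x \<le> y" "y \<le> b" for x y
      unfolding K_def using that k
      by (intro integral_subset_le) (auto simp: k_def intro: integrable_on_subinterval)
    have K0: "K a = 0" unfolding K_def by simp
    have vpK: "variational_primitive k K a b"
      unfolding K_def by (rule integrable_imp_variational_primitive[OF k \<open>a \<le> b\<close>])
    from variationally_nullE[OF this[unfolded variational_primitive_def] \<open>\<epsilon>/2 > 0\<close>] obtain V
      where V: "mono V" "\<And>x. 0 \<le> V x" "\<And>x. V x \<le> \<epsilon>/2"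
        and *: "\<And>t. t \<in> {a..b} \<Longrightarrow> near_tag t a b (\<lambda>u v. increment_error k K t u v \<le> V v - V u)" by blast
    define U where "U x = V x + K (max a (min b x))" for x
    have "mono U"
    proof (rule monoI)
      fix x y :: real assume "x \<le> y"
      then have "K (max a (min b x)) \<le> K (max a (min b y))" using \<open>a \<le> b\<close> by (intro K_mono) auto
      then show "U x \<le> U y" using monoD[OF V(1) \<open>x \<le> y\<close>] by (simp add: U_def)
    qed
    moreover have "0 \<le> U x \<and> U x \<le> \<epsilon>" for x
    proof -
      have "K a \<le> K (max a (min b x))" "K (max a (min b x)) \<le> K b"
        using \<open>a \<le> b\<close> by (auto intro!: K_mono)
      moreover have "K b < \<epsilon>/2" using n kq by (simp add: K_def)
      ultimately show ?thesis using K0 V(2,3)[of x] unfolding U_def by linarith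
    qed
    moreover have "near_tag t a b (\<lambda>u v. (v - u) * norm (h t - r n t) \<le> U v - U u)" if t: "t \<in> {a..b}" for t
    proof -
      obtain d where "d > 0" and d: "\<And>u v. a \<le> u \<Longrightarrow> u \<le> t \<Longrightarrow> t \<le> v \<Longrightarrow> v \<le> b \<Longrightarrow> v - u < d \<Longrightarrow>
           increment_error k K t u v \<le> V v - V u" using *[OF t] by blast
      have "(v - u) * norm (h t - r n t) \<le> U v - U u"
        if h: "a \<le> u" "u \<le> t" "t \<le> v" "v \<le> b" "v - u < d" for u v
      proof -
        have "max a (min b u) = u" "max a (min b v) = v" using h by auto
        then show ?thesis using d[OF h] by (simp add: U_def k_def abs_if split: if_splits)
      qed
      then show ?thesis using \<open>d > 0\<close> by blast
    qed
    ultimately show "\<exists>s B W. variational_primitive s B a b \<and> mono W \<and>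
      (\<forall>x. 0 \<le> W x \<and> W x \<le> \<epsilon>) \<and>
      (\<forall>t\<in>{a..b}. near_tag t a b (\<lambda>u v. (v - u) * norm (h t - s t) \<le> W v - W u))"
      using B by (intro exI[of _ "r n"] exI[of _ B] exI[of _ U]) blast
  qed
qed

section \<open>Integrability on intervals\<close>

definition variationally_integrable :: "(real \<Rightarrow> 'a::real_normed_vector) \<Rightarrow> real \<Rightarrow> real \<Rightarrow> bool" where
  "variationally_integrable f a b \<longleftrightarrow> (\<exists>F. variational_primitive f F a b)"

lemma variationally_integrable_subset:
  "variationally_integrable f a b \<Longrightarrow> a \<le> a' \<Longrightarrow> b' \<le> b \<Longrightarrow> variationally_integrable f a' b'"
  unfolding variationally_integrable_def using variational_primitive_subset by blast

lemma variationally_integrable_join: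
  assumes "variationally_integrable f a b" "variationally_integrable f b c" "a \<le> b" "b \<le> c"
  shows "variationally_integrable f a c"
proof -
  obtain F G where "variational_primitive f F a b" "variational_primitive f G b c"
    using assms(1,2) unfolding variationally_integrable_def by blast
  from variational_primitive_join[OF this assms(3,4)] show ?thesis
    unfolding variationally_integrable_def by blast
qed

lemma variationally_integrable_of_local:
  assumes "a \<le> b"
    and local: "\<And>t. a \<le> t \<Longrightarrow> t \<le> b \<Longrightarrow> near_tag t a b (\<lambda>u v. variationally_integrable f u v)"
  shows "variationally_integrable f a b"
proof -
  have "a \<le> a \<and> a \<le> b \<and> b \<le> b \<longrightarrow> variationally_integrable f a b"
  proof (rule Bolzano[OF \<open>a \<le> b\<close>, where P = "\<lambda>u v. a \<le> u \<and> u \<le> v \<and> v \<le> b \<longrightarrow> variationally_integrable f u v"])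
    fix u v w assume "a \<le> u \<and> u \<le> v \<and> v \<le> b \<longrightarrow> variationally_integrable f u v"
      "a \<le> v \<and> v \<le> w \<and> w \<le> b \<longrightarrow> variationally_integrable f v w" "u \<le> v" "v \<le> w"
    then show "a \<le> u \<and> u \<le> w \<and> w \<le> b \<longrightarrow> variationally_integrable f u w"
      using variationally_integrable_join[of f u v w] by auto
  next
    fix t assume "a \<le> t" "t \<le> b"
    from local[OF this] show "\<exists>d>0. \<forall>u v. u \<le> t \<and> t \<le> v \<and> v - u < d \<longrightarrow>
        a \<le> u \<and> u \<le> v \<and> v \<le> b \<longrightarrow> variationally_integrable f u v"
      by blast
  qed
  then show ?thesis using \<open>a \<le> b\<close> by simp
qed

text \<open>
  Primitives are unique up to constants, so those on the compact subintervals fit together once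
  they are normalized at the midpoint.
\<close>

lemma common_primitive_on_open_interval:
  fixes f :: "real \<Rightarrow> 'a::real_normed_vector"
  assumes "\<alpha> < \<beta>" and int: "\<And>u v. \<alpha> < u \<Longrightarrow> u \<le> v \<Longrightarrow> v < \<beta> \<Longrightarrow> variationally_integrable f u v"
  obtains F where "\<And>u v. \<alpha> < u \<Longrightarrow> u \<le> v \<Longrightarrow> v < \<beta> \<Longrightarrow> variational_primitive f F u v"
proof -
  define P where "P u v = (SOME F. variational_primitive f F u v)" for u v
  have P: "variational_primitive f (P u v) u v" if "\<alpha> < u" "u \<le> v" "v < \<beta>" for u v
    using int[OF that] unfolding variationally_integrable_def P_def by (rule someI_ex)
  define m where "m = (\<alpha> + \<beta>) / 2"
  have m: "\<alpha> < m" "m < \<beta>" using \<open>\<alpha> < \<beta>\<close> by (auto simp: m_def)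
  define F where "F x = (if m \<le> x then P m x x - P m x m else P x m x - P x m m)" for x
  have "variational_primitive f F u v" if h: "\<alpha> < u" "u \<le> v" "v < \<beta>" for u v
  proof -
    define G where "G = P (min u m) (max v m)"
    have G: "variational_primitive f G (min u m) (max v m)"
      unfolding G_def using h m by (intro P) auto
    have "F x = G x - G m" if x: "u \<le> x" "x \<le> v" for x
    proof (cases "m \<le> x")
      case True
      have "P m x x - P m x m = G x - G m"
        using True x h m
        by (intro variational_primitive_unique[OF P variational_primitive_subset[OF G]]) auto
      then show ?thesis using True by (simp add: F_def)
    next
      case False
      have "P x m m - P x m x = G m - G x"
        using False x h m
        by (intro variational_primitive_unique[OF P variational_primitive_subset[OF G]]) auto
      then have "P x m x - P x m m = G x - G m" by (metis minus_diff_eq)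
      then show ?thesis using False by (simp add: F_def)
    qed
    then have "F y - F x = G y - G x" if "u \<le> x" "x \<le> y" "y \<le> v" for x y using that by simp
    moreover have "variational_primitive f G u v" by (rule variational_primitive_subset[OF G]) auto
    ultimately show ?thesis using variational_primitive_cong[of f G u v F f] by blast
  qed
  then show thesis by (rule that)
qed

lemma limit_of_cauchy_within:
  fixes F :: "real \<Rightarrow> 'a::banach"
  assumes cauchy: "\<And>\<epsilon>. \<epsilon> > 0 \<Longrightarrow> \<exists>\<delta>>0. \<forall>x\<in>A. \<forall>y\<in>A. dist x t < \<delta> \<and> dist y t < \<delta> \<longrightarrow> dist (F x) (F y) \<le> \<epsilon>"
    and "t \<in> closure A"
  obtains L where "\<And>\<epsilon>. \<epsilon> > 0 \<Longrightarrow> \<exists>\<delta>>0. \<forall>x\<in>A. dist x t < \<delta> \<longrightarrow> norm (F x - L) \<le> \<epsilon>"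
proof -
  obtain x where x: "\<And>n. x n \<in> A" "x \<longlonglongrightarrow> t"
    using \<open>t \<in> closure A\<close> unfolding closure_sequential by blast
  have ev: "\<exists>M. \<forall>n\<ge>M. dist (x n) t < d" if "d > 0" for d
    using x(2) that unfolding lim_sequentially by blast
  have "Cauchy (\<lambda>n. F (x n))"
  proof (rule metric_CauchyI)
    fix e :: real assume "e > 0"
    then have "e/2 > 0" by simp
    then obtain d where "d > 0" and d: "\<And>y z. y \<in> A \<Longrightarrow> z \<in> A \<Longrightarrow> dist y t < d \<Longrightarrow> dist z t < d \<Longrightarrow> dist (F y) (F z) \<le> e/2"
      using cauchy by blast
    obtain M where "\<And>n. n \<ge> M \<Longrightarrow> dist (x n) t < d" using ev[OF \<open>d > 0\<close>] by blast
    then have "dist (F (x m)) (F (x n)) < e" if "m \<ge> M" "n \<ge> M" for m n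
      using d[OF x(1) x(1), of m n] that \<open>e > 0\<close> by fastforce
    then show "\<exists>M. \<forall>m\<ge>M. \<forall>n\<ge>M. dist (F (x m)) (F (x n)) < e" by blast
  qed
  then obtain L where L: "(\<lambda>n. F (x n)) \<longlonglongrightarrow> L"
    using Cauchy_convergent_iff convergent_def by blast
  show thesis
  proof (rule that[of L])
    fix \<epsilon> :: real assume "\<epsilon> > 0"
    then obtain d where "d > 0" and d: "\<And>y z. y \<in> A \<Longrightarrow> z \<in> A \<Longrightarrow> dist y t < d \<Longrightarrow> dist z t < d \<Longrightarrow> dist (F y) (F z) \<le> \<epsilon>"
      using cauchy by blast
    obtain M where M: "\<And>n. n \<ge> M \<Longrightarrow> dist (x n) t < d" using ev[OF \<open>d > 0\<close>] by blast
    have "norm (F y - L) \<le> \<epsilon>" if "y \<in> A" "dist y t < d" for y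
    proof (rule LIMSEQ_le_const2)
      show "(\<lambda>n. norm (F y - F (x n))) \<longlonglongrightarrow> norm (F y - L)" by (intro tendsto_intros L)
      have "norm (F y - F (x n)) \<le> \<epsilon>" if "n \<ge> M" for n
        using d[OF \<open>y \<in> A\<close> x(1) \<open>dist y t < d\<close> M[OF that]] by (simp add: dist_norm)
      then show "\<exists>M. \<forall>n\<ge>M. norm (F y - F (x n)) \<le> \<epsilon>" by blast
    qed
    then show "\<exists>\<delta>>0. \<forall>x\<in>A. dist x t < \<delta> \<longrightarrow> norm (F x - L) \<le> \<epsilon>" using \<open>d > 0\<close> by blast
  qed
qed

section \<open>Functions whose primitives are controlled by an interval function\<close>

text \<open>
  The properties of \<open>f\<close> and \<open>N u v = Sup (norm ` \<Phi> {u..v})\<close> that the construction of a primitive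
  uses, for a multifunction with primitive \<open>\<Phi>\<close> and a selection \<open>f\<close>. The first three inequalities
  express that \<open>\<Phi>\<close> is additive for the Minkowski sum; there is no monotonicity of \<open>N\<close>, since the summands
  may cancel. The number \<open>C t\<close> bounds the values of the multifunction at \<open>t\<close>.
\<close>

locale controlled_function =
  fixes f :: "real \<Rightarrow> 'a::banach" and N :: "real \<Rightarrow> real \<Rightarrow> real" and C :: "real \<Rightarrow> real"
  assumes N_join: "\<And>u v w. 0 \<le> u \<Longrightarrow> u \<le> v \<Longrightarrow> v \<le> w \<Longrightarrow> w \<le> 1 \<Longrightarrow> N u w \<le> N u v + N v w"
    and N_left: "\<And>u v w. 0 \<le> u \<Longrightarrow> u \<le> v \<Longrightarrow> v \<le> w \<Longrightarrow> w \<le> 1 \<Longrightarrow> N u v \<le> N u w + N v w"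
    and N_right: "\<And>u v w. 0 \<le> u \<Longrightarrow> u \<le> v \<Longrightarrow> v \<le> w \<Longrightarrow> w \<le> 1 \<Longrightarrow> N v w \<le> N u w + N u v"
    and N_nonneg: "\<And>u v. 0 \<le> u \<Longrightarrow> u \<le> v \<Longrightarrow> v \<le> 1 \<Longrightarrow> 0 \<le> N u v"
    and C_nonneg: "\<And>t. 0 \<le> C t"
    and N_bound: "variationally_null (\<lambda>t u v. N u v - (v - u) * C t) {0..1} 0 1"
    and f_bound: "variationally_null (\<lambda>t u v. (v - u) * norm (f t) - N u v) {0..1} 0 1"
    and primitive_le: "\<And>F a b. 0 \<le> a \<Longrightarrow> a \<le> b \<Longrightarrow> b \<le> 1 \<Longrightarrow> variational_primitive f F a b \<Longrightarrow> norm (F b - F a) \<le> N a b"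
    and measurable: "strongly_measurable (lebesgue_on {0..1}) f"
begin

lemma N_continuous:
  assumes "0 \<le> t" "t \<le> 1" "\<epsilon> > 0"
  obtains \<delta> where "\<delta> > 0" "\<And>u v. 0 \<le> u \<Longrightarrow> u \<le> t \<Longrightarrow> t \<le> v \<Longrightarrow> v \<le> 1 \<Longrightarrow> v - u < \<delta> \<Longrightarrow> N u v \<le> \<epsilon>"
proof -
  have "\<epsilon>/2 > 0" using \<open>\<epsilon> > 0\<close> by simp
  from variationally_nullE[OF N_bound this] obtain W
    where W: "mono W" "\<And>x. 0 \<le> W x" "\<And>x. W x \<le> \<epsilon>/2"
      and *: "\<And>t. t \<in> {0..1} \<Longrightarrow> near_tag t 0 1 (\<lambda>u v. N u v - (v - u) * C t \<le> W v - W u)" by blast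
  have "t \<in> {0..1}" using assms by simp
  from *[OF this] near_tag_length[OF \<open>\<epsilon>/2 > 0\<close> C_nonneg[of t]] have "near_tag t 0 1 (\<lambda>u v. N u v \<le> \<epsilon>)"
  proof (rule near_tag_mp)
    fix u v assume "N u v - (v - u) * C t \<le> W v - W u" "(v - u) * C t \<le> \<epsilon>/2"
    then show "N u v \<le> \<epsilon>" using W(2)[of u] W(3)[of v] by linarith
  qed
  then show thesis using that by metis
qed

lemma N_refl:
  assumes "0 \<le> t" "t \<le> 1"
  shows "N t t = 0"
proof (rule antisym)
  show "N t t \<le> 0"
  proof (rule field_le_epsilon)
    fix e :: real assume "e > 0"
    from N_continuous[OF assms this] obtain d where "d > 0"
      and d: "\<And>u v. 0 \<le> u \<Longrightarrow> u \<le> t \<Longrightarrow> t \<le> v \<Longrightarrow> v \<le> 1 \<Longrightarrow> v - u < d \<Longrightarrow> N u v \<le> e"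
      by metis
    then show "N t t \<le> 0 + e" using d[of t t] assms by simp
  qed
  show "0 \<le> N t t" using assms by (intro N_nonneg) auto
qed

text \<open>
  The Cauchy extension: the primitives inside the open interval have oscillation at most
  \<open>N\<close>, which is continuous, so they have limits at both end points. Constant continuation gives
  a primitive on the line of the integrand cut off outside the interval.
\<close>

lemma gap_primitive:
  assumes "0 \<le> \<alpha>" "\<alpha> < \<beta>" "\<beta> \<le> 1"
    and int: "\<And>u v. \<alpha> < u \<Longrightarrow> u \<le> v \<Longrightarrow> v < \<beta> \<Longrightarrow> variationally_integrable f u v"
  obtains \<kappa> where "\<And>a b. variational_primitive (\<lambda>t. if \<alpha> < t \<and> t < \<beta> then f t else 0) \<kappa> a b"
    and "variational_primitive f \<kappa> \<alpha> \<beta>" and "\<And>x. x \<le> \<alpha> \<Longrightarrow> \<kappa> x = 0" and "\<And>x. \<beta> \<le> x \<Longrightarrow> \<kappa> x = \<kappa> \<beta>"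
proof -
  obtain F where F: "\<And>u v. \<alpha> < u \<Longrightarrow> u \<le> v \<Longrightarrow> v < \<beta> \<Longrightarrow> variational_primitive f F u v"
    using common_primitive_on_open_interval[OF \<open>\<alpha> < \<beta>\<close> int] by blast
  have FN: "norm (F y - F x) \<le> N x y" if "\<alpha> < x" "x \<le> y" "y < \<beta>" for x y
    using that assms by (intro primitive_le F) auto
  have limit: "\<exists>L. \<forall>\<epsilon>>0. \<exists>\<delta>>0. \<forall>x\<in>{\<alpha><..<\<beta>}. dist x e < \<delta> \<longrightarrow> norm (F x - L) \<le> \<epsilon>"
    if e: "e = \<alpha> \<or> e = \<beta>" for e
  proof -
    have cauchy: "\<exists>\<delta>>0. \<forall>x\<in>{\<alpha><..<\<beta>}. \<forall>y\<in>{\<alpha><..<\<beta>}. dist x e < \<delta> \<and> dist y e < \<delta> \<longrightarrow> dist (F x) (F y) \<le> \<epsilon>"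
      if "\<epsilon> > 0" for \<epsilon>
    proof -
      have *: "0 \<le> e" "e \<le> 1" "\<epsilon>/2 > 0" using e assms \<open>\<epsilon> > 0\<close> by auto
      obtain d where "d > 0" and d: "\<And>u v. 0 \<le> u \<Longrightarrow> u \<le> e \<Longrightarrow> e \<le> v \<Longrightarrow> v \<le> 1 \<Longrightarrow> v - u < d \<Longrightarrow> N u v \<le> \<epsilon>/2"
        using N_continuous[OF *] by metis
      have le: "norm (F y - F x) \<le> \<epsilon>"
        if h: "\<alpha> < x" "x \<le> y" "y < \<beta>" "dist x e < d" "dist y e < d" for x y
        using e
      proof
        assume e: "e = \<alpha>"
        have "norm (F y - F x) \<le> N \<alpha> y + N \<alpha> x"
          using FN[of x y] N_right[of \<alpha> x y] h assms by linarith
        then show ?thesis using d[of \<alpha> x] d[of \<alpha> y] h assms e by (auto simp: dist_real_def)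
      next
        assume e: "e = \<beta>"
        have "norm (F y - F x) \<le> N x \<beta> + N y \<beta>"
          using FN[of x y] N_left[of x y \<beta>] h assms by linarith
        then show ?thesis using d[of x \<beta>] d[of y \<beta>] h assms e by (auto simp: dist_real_def)
      qed
      have "dist (F x) (F y) \<le> \<epsilon>" if "x \<in> {\<alpha><..<\<beta>}" "y \<in> {\<alpha><..<\<beta>}" "dist x e < d" "dist y e < d" for x y
        using le[of x y] le[of y x] that by (cases "x \<le> y") (auto simp: dist_norm norm_minus_commute)
      then show ?thesis using \<open>d > 0\<close> by blast
    qed
    have "e \<in> closure {\<alpha><..<\<beta>}" using e \<open>\<alpha> < \<beta>\<close> by auto
    show ?thesis by (rule limit_of_cauchy_within[OF cauchy \<open>e \<in> closure _\<close>]) blast+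
  qed
  obtain L where L: "\<And>\<epsilon>. \<epsilon> > 0 \<Longrightarrow> \<exists>\<delta>>0. \<forall>x\<in>{\<alpha><..<\<beta>}. dist x \<alpha> < \<delta> \<longrightarrow> norm (F x - L) \<le> \<epsilon>"
    using limit[of \<alpha>] by blast
  obtain M where M: "\<And>\<epsilon>. \<epsilon> > 0 \<Longrightarrow> \<exists>\<delta>>0. \<forall>x\<in>{\<alpha><..<\<beta>}. dist x \<beta> < \<delta> \<longrightarrow> norm (F x - M) \<le> \<epsilon>"
    using limit[of \<beta>] by blast
  define \<kappa> where "\<kappa> x = (if x \<le> \<alpha> then 0 else if x < \<beta> then F x - L else M - L)" for x
  let ?g = "\<lambda>t. if \<alpha> < t \<and> t < \<beta> then f t else 0"
  let ?D = "\<lambda>t u v. increment_error ?g \<kappa> t u v"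
  have vp: "variational_primitive ?g \<kappa> a b" for a b
  proof -
    have outside: "variationally_null ?D (- {\<alpha>..\<beta>}) a b"
    proof (rule variationally_null_le[where D = "\<lambda>_ _ _. 0" and P = UNIV and a = a and b = b])
      show "variationally_null (\<lambda>_ _ _. 0) UNIV a b" by (rule variationally_null_zero) simp
      fix t assume "t \<in> - {\<alpha>..\<beta>}"
      then show "near_tag t a b (\<lambda>u v. a \<le> u \<and> v \<le> b \<and> ?D t u v \<le> 0)"
        using \<open>\<alpha> < \<beta>\<close> by (intro exI[of _ "if t < \<alpha> then \<alpha> - t else t - \<beta>"]) (auto simp: \<kappa>_def)
    qed simp
    have mid: "variationally_null ?D (\<Union>n. {\<alpha> + 1 / Suc n<..<\<beta> - 1 / Suc n}) a b"
    proof (rule variationally_null_UN)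
      fix n
      let ?c = "\<alpha> + 1 / Suc n" and ?d = "\<beta> - 1 / Suc n"
      show "variationally_null ?D {?c<..<?d} a b"
      proof (cases "?c \<le> ?d")
        case True
        have pos: "1 / real (Suc n) > 0" by simp
        have c: "\<alpha> < ?c" and d: "?d < \<beta>" using pos by linarith+
        have "variational_primitive f F ?c ?d" using c True d by (rule F)
        then show ?thesis
          unfolding variational_primitive_def
        proof (rule variationally_null_localize)
          fix t u v assume h: "t \<in> {?c<..<?d}" "?c \<le> u" "u \<le> t" "t \<le> v" "v \<le> ?d"
          have "\<alpha> < u" "u < \<beta>" "\<alpha> < v" "v < \<beta>" "\<alpha> < t" "t < \<beta>"
            using h c d unfolding greaterThanLessThan_iff by linarith+
          then show "?D t u v \<le> increment_error f F t u v" by (simp add: \<kappa>_def)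
        qed auto
      next
        case False
        then have "{?c<..<?d} = {}" by auto
        then show ?thesis by (auto intro: variationally_null_zero)
      qed
    qed
    have endl: "variationally_null ?D {\<alpha>} a b"
    proof (rule variationally_null_point_of_continuous)
      fix \<epsilon> :: real assume "\<epsilon> > 0"
      then obtain d where d: "d > 0" "\<And>x. x \<in> {\<alpha><..<\<beta>} \<Longrightarrow> dist x \<alpha> < d \<Longrightarrow> norm (F x - L) \<le> \<epsilon>"
        using L by blast
      show "near_tag \<alpha> a b (\<lambda>u v. norm (\<kappa> v - \<kappa> u) \<le> \<epsilon>)"
      proof (intro exI[of _ "min d (\<beta> - \<alpha>)"] conjI allI impI)
        show "min d (\<beta> - \<alpha>) > 0" using d \<open>\<alpha> < \<beta>\<close> by simp
        fix u v assume h: "a \<le> u \<and> u \<le> \<alpha> \<and> \<alpha> \<le> v \<and> v \<le> b \<and> v - u < min d (\<beta> - \<alpha>)"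
        then show "norm (\<kappa> v - \<kappa> u) \<le> \<epsilon>"
          using d(2)[of v] \<open>\<epsilon> > 0\<close> by (auto simp: \<kappa>_def dist_real_def)
      qed
    qed
    have endr: "variationally_null ?D {\<beta>} a b"
    proof (rule variationally_null_point_of_continuous)
      fix \<epsilon> :: real assume "\<epsilon> > 0"
      then obtain d where d: "d > 0" "\<And>x. x \<in> {\<alpha><..<\<beta>} \<Longrightarrow> dist x \<beta> < d \<Longrightarrow> norm (F x - M) \<le> \<epsilon>"
        using M by blast
      show "near_tag \<beta> a b (\<lambda>u v. norm (\<kappa> v - \<kappa> u) \<le> \<epsilon>)"
      proof (intro exI[of _ "min d (\<beta> - \<alpha>)"] conjI allI impI)
        show "min d (\<beta> - \<alpha>) > 0" using d \<open>\<alpha> < \<beta>\<close> by simp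
        fix u v assume h: "a \<le> u \<and> u \<le> \<beta> \<and> \<beta> \<le> v \<and> v \<le> b \<and> v - u < min d (\<beta> - \<alpha>)"
        then show "norm (\<kappa> v - \<kappa> u) \<le> \<epsilon>"
          using d(2)[of u] \<open>\<epsilon> > 0\<close> \<open>\<alpha> < \<beta>\<close> by (auto simp: \<kappa>_def dist_real_def norm_minus_commute)
      qed
    qed
    have cover: "{a..b} \<subseteq> - {\<alpha>..\<beta>} \<union> ((\<Union>n. {\<alpha> + 1 / Suc n<..<\<beta> - 1 / Suc n}) \<union> ({\<alpha>} \<union> {\<beta>}))"
    proof
      fix t assume "t \<in> {a..b}"
      have "\<exists>n. t \<in> {\<alpha> + 1 / Suc n<..<\<beta> - 1 / Suc n}" if "\<alpha> < t" "t < \<beta>"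
      proof -
        have "min (t - \<alpha>) (\<beta> - t) > 0" using that by simp
        then obtain n where "1 / real (Suc n) < min (t - \<alpha>) (\<beta> - t)" using nat_approx_posE by blast
        then show ?thesis by (intro exI[of _ n]) auto
      qed
      then show "t \<in> - {\<alpha>..\<beta>} \<union> ((\<Union>n. {\<alpha> + 1 / Suc n<..<\<beta> - 1 / Suc n}) \<union> ({\<alpha>} \<union> {\<beta>}))"
        by (cases "t < \<alpha> \<or> t > \<beta> \<or> t = \<alpha> \<or> t = \<beta>") auto
    qed
    show ?thesis
      unfolding variational_primitive_def
      by (rule variationally_null_mono[OF variationally_null_Un[OF outside
            variationally_null_Un[OF mid variationally_null_Un[OF endl endr]]] cover]) auto
  qed
  show thesis
  proof (rule that[of \<kappa>])
    show "variational_primitive ?g \<kappa> a b" for a b by (rule vp)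
    show "variational_primitive f \<kappa> \<alpha> \<beta>"
      by (rule variational_primitive_change[OF vp, of "{\<alpha>, \<beta>}"]) auto
  qed (use \<open>\<alpha> < \<beta>\<close> in \<open>auto simp: \<kappa>_def\<close>)
qed

end

section \<open>Portions on which the control is monotone\<close>

text \<open>
  Increments of \<open>W\<close> over slightly enlarged intervals tend to \<open>W (v+) - W (u-)\<close>. This is not an
  additive function of the interval, but it is dominated by the increments of the sum of the left and the
  right limit function, because \<open>W (u+) \<le> W (v-)\<close>.
\<close>

lemma one_sided_limits_majorant:
  fixes W :: "real \<Rightarrow> real"
  assumes "mono W" and W01: "\<And>x. 0 \<le> W x" "\<And>x. W x \<le> 1"
  obtains V where "mono V"
    and "\<And>u v \<eta>. u < v \<Longrightarrow> \<eta> > 0 \<Longrightarrow> \<exists>\<rho>>0. \<forall>x y. u - \<rho> < x \<and> y < v + \<rho> \<longrightarrow> W y - W x \<le> V v - V u + \<eta>"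
proof -
  define L where "L x = Sup (W ` {..<x})" for x
  define R where "R x = Inf (W ` {x<..})" for x
  have bdd: "bdd_above (W ` A)" "bdd_below (W ` A)" for A
    using W01 by (auto intro!: bdd_aboveI2 bdd_belowI2)
  have ne: "W ` {..<x} \<noteq> {}" "W ` {x<..} \<noteq> {}" for x :: real
    using lt_ex[of x] gt_ex[of x] by auto
  have "mono L" unfolding L_def mono_def using ne bdd by (auto intro!: cSup_subset_mono)
  moreover have "mono R" unfolding R_def mono_def using ne bdd by (auto intro!: cInf_superset_mono)
  ultimately have "mono (\<lambda>x. L x + R x)" by (auto simp: mono_def intro: add_mono)
  moreover have "\<exists>\<rho>>0. \<forall>x y. u - \<rho> < x \<and> y < v + \<rho> \<longrightarrow> W y - W x \<le> (L v + R v) - (L u + R u) + \<eta>"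
    if "u < v" "\<eta> > 0" for u v \<eta>
  proof -
    have "R u \<le> W ((u + v)/2)" unfolding R_def using \<open>u < v\<close> bdd by (intro cInf_lower) auto
    also have "\<dots> \<le> L v" unfolding L_def using \<open>u < v\<close> bdd by (intro cSup_upper) auto
    finally have RL: "R u \<le> L v" .
    have "L u - \<eta>/2 < Sup (W ` {..<u})" using \<open>\<eta> > 0\<close> by (simp add: L_def)
    then obtain p where p: "p < u" "L u - \<eta>/2 < W p"
      using less_cSup_iff[OF ne(1) bdd(1)] by auto
    have "Inf (W ` {v<..}) < R v + \<eta>/2" using \<open>\<eta> > 0\<close> by (simp add: R_def)
    then obtain q where q: "v < q" "W q < R v + \<eta>/2"
      using cInf_less_iff[OF ne(2) bdd(2)] by auto
    show ?thesis
    proof (intro exI[of _ "min (u - p) (q - v)"] conjI allI impI)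
      show "min (u - p) (q - v) > 0" using p q by simp
      fix x y assume "u - min (u - p) (q - v) < x \<and> y < v + min (u - p) (q - v)"
      then have "W p \<le> W x" "W y \<le> W q" by (auto intro!: monoD[OF \<open>mono W\<close>])
      then show "W y - W x \<le> (L v + R v) - (L u + R u) + \<eta>" using RL p q by linarith
    qed
  qed
  ultimately show thesis by (rule that)
qed

text \<open>
  Baire's theorem in the complete metric space \<open>P\<close>.
\<close>

lemma closed_set_baire_portion:
  fixes P :: "real set" and E :: "nat \<Rightarrow> real set"
  assumes "closed P" "P \<noteq> {}" "P \<subseteq> (\<Union>n. E n)"
  obtains n p r where "p \<in> P" "r > 0" "P \<inter> ball p r \<subseteq> closure (E n)"
proof -
  let ?X = "top_of_set P"
  have "\<exists>n. ?X interior_of (P \<inter> closure (E n)) \<noteq> {}"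
  proof (rule ccontr)
    assume "\<not> ?thesis"
    then have empty: "?X interior_of (P \<inter> closure (E n)) = {}" for n by blast
    have "?X interior_of \<Union>(range (\<lambda>n. P \<inter> closure (E n))) = {}"
    proof (rule Baire_category_alt)
      have "closedin euclidean P" using \<open>closed P\<close> by simp
      then show "completely_metrizable_space ?X \<or> locally_compact_space ?X \<and> regular_space ?X"
        using completely_metrizable_space_closedin[OF completely_metrizable_space_euclidean] by blast
      fix T assume "T \<in> range (\<lambda>n. P \<inter> closure (E n))"
      then obtain n where T: "T = P \<inter> closure (E n)" by (rule rangeE)
      have "closedin ?X (P \<inter> closure (E n))" by (rule closedin_closed_Int) (rule closed_closure)
      then show "closedin ?X T \<and> ?X interior_of T = {}" using empty[of n] T by simp
    qed simp
    moreover have "P = \<Union>(range (\<lambda>n. P \<inter> closure (E n)))"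
    proof
      show "P \<subseteq> \<Union>(range (\<lambda>n. P \<inter> closure (E n)))"
      proof
        fix x assume "x \<in> P"
        with assms(3) obtain n where "x \<in> E n" by blast
        then show "x \<in> \<Union>(range (\<lambda>n. P \<inter> closure (E n)))"
          using \<open>x \<in> P\<close> subsetD[OF closure_subset] by blast
      qed
    qed blast
    ultimately have "?X interior_of P = {}" by (simp only:)
    moreover have "?X interior_of P = P" using interior_of_topspace[of ?X] by simp
    ultimately show False using \<open>P \<noteq> {}\<close> by simp
  qed
  then obtain n where ne: "?X interior_of (P \<inter> closure (E n)) \<noteq> {}" ..
  then obtain p where p: "p \<in> ?X interior_of (P \<inter> closure (E n))" by blast
  have "openin ?X (?X interior_of (P \<inter> closure (E n)))" by simp
  then obtain U where U: "open U" "?X interior_of (P \<inter> closure (E n)) = P \<inter> U"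
    using openin_open by blast
  then obtain r where "r > 0" "ball p r \<subseteq> U" using p open_contains_ball by blast
  moreover have "P \<inter> U \<subseteq> closure (E n)" using U(2) interior_of_subset[of ?X "P \<inter> closure (E n)"] by blast
  ultimately show thesis using p U(2) by (intro that[of p r n]) auto
qed

context controlled_function
begin

text \<open>
  Let \<open>E n\<close> consist of the points \<open>t\<close> of \<open>P\<close> for which the bound
  \<open>N u v \<le> (n + 1) * (v - u) + (W v - W u)\<close> holds for all intervals around \<open>t\<close> shorter than
  \<open>1 / (n + 1)\<close>. These sets cover \<open>P\<close>, so one of them is dense in a portion of \<open>P\<close>. The bound
  passes to the closure if the tag is approximated by points of \<open>E n\<close>. This enlarges the interval when
  the tag is an end point, and for this reason \<open>W\<close> has to be replaced by the function of
  \<open>one_sided_limits_majorant\<close>.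
\<close>

lemma portion_with_monotone_bound:
  assumes "closed P" "P \<subseteq> {0..1}" "P \<noteq> {}"
  obtains c d p V where "p \<in> P" "c < p" "p < d" "mono V"
    and "\<And>t u v. t \<in> P \<Longrightarrow> 0 \<le> u \<Longrightarrow> c \<le> u \<Longrightarrow> u \<le> t \<Longrightarrow> t \<le> v \<Longrightarrow> v \<le> d \<Longrightarrow> v \<le> 1 \<Longrightarrow> N u v \<le> V v - V u"
proof -
  from variationally_nullE[OF N_bound zero_less_one] obtain W
    where W: "mono W" "\<And>x. 0 \<le> W x" "\<And>x. W x \<le> 1"
      and local: "\<And>t. t \<in> {0..1} \<Longrightarrow> near_tag t 0 1 (\<lambda>u v. N u v - (v - u) * C t \<le> W v - W u)" by metis
  define E where "E n = {t\<in>P. \<forall>u v. 0 \<le> u \<and> u \<le> t \<and> t \<le> v \<and> v \<le> 1 \<and> v - u < 1 / real (Suc n) \<longrightarrow>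
      N u v \<le> real (Suc n) * (v - u) + (W v - W u)}" for n
  have "P \<subseteq> (\<Union>n. E n)"
  proof
    fix t assume "t \<in> P"
    then have t: "t \<in> {0..1}" using assms by blast
    obtain d where "d > 0" and d: "\<And>u v. 0 \<le> u \<Longrightarrow> u \<le> t \<Longrightarrow> t \<le> v \<Longrightarrow> v \<le> 1 \<Longrightarrow> v - u < d \<Longrightarrow>
        N u v - (v - u) * C t \<le> W v - W u" using local[OF t] by blast
    obtain k where k: "1 / real (Suc k) < d" using nat_approx_posE[OF \<open>d > 0\<close>] by metis
    obtain l where l: "C t \<le> real l" using real_arch_simple by blast
    define n where "n = max k l"
    have "1 / real (Suc n) \<le> 1 / real (Suc k)" by (simp add: n_def frac_le)
    then have n1: "1 / real (Suc n) < d" using k by simp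
    have n2: "C t \<le> real (Suc n)" using l by (simp add: n_def)
    have "t \<in> E n"
      unfolding E_def
    proof (intro CollectI conjI allI impI \<open>t \<in> P\<close>)
      fix u v assume h: "0 \<le> u \<and> u \<le> t \<and> t \<le> v \<and> v \<le> 1 \<and> v - u < 1 / real (Suc n)"
      then have "N u v - (v - u) * C t \<le> W v - W u" using n1 by (intro d) auto
      moreover have "(v - u) * C t \<le> (v - u) * real (Suc n)" using n2 h by (intro mult_left_mono) auto
      ultimately show "N u v \<le> real (Suc n) * (v - u) + (W v - W u)" by (simp add: mult.commute)
    qed
    then show "t \<in> (\<Union>n. E n)" by blast
  qed
  with assms obtain n p r where p: "p \<in> P" "r > 0" "P \<inter> ball p r \<subseteq> closure (E n)"
    using closed_set_baire_portion by metis
  obtain U where "mono U"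
    and U: "\<And>u v \<eta>. u < v \<Longrightarrow> \<eta> > 0 \<Longrightarrow> \<exists>\<rho>>0. \<forall>x y. u - \<rho> < x \<and> y < v + \<rho> \<longrightarrow> W y - W x \<le> U v - U u + \<eta>"
    using one_sided_limits_majorant[OF W] by metis
  define k where "k = real (Suc n)"
  have "k > 0" by (simp add: k_def)
  define V where "V x = k * x + U x" for x
  define s where "s = min (r/2) (1 / (4 * k))"
  have s: "s > 0" "s < r" "2 * s < 1 / k" using \<open>r > 0\<close> \<open>k > 0\<close> by (auto simp: s_def field_simps min_def)
  show thesis
  proof (rule that[of p "p - s" "p + s" V])
    show "p \<in> P" "p - s < p" "p < p + s" using p s by auto
    show "mono V" unfolding V_def using monoD[OF \<open>mono U\<close>] \<open>k > 0\<close> by (auto intro!: monoI add_mono)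
    fix t u v assume h: "t \<in> P" "0 \<le> u" "p - s \<le> u" "u \<le> t" "t \<le> v" "v \<le> p + s" "v \<le> 1"
    show "N u v \<le> V v - V u"
    proof (cases "u = v")
      case True
      then show ?thesis using N_refl[of u] h by simp
    next
      case False
      then have "u < v" using h by simp
      show ?thesis
      proof (rule field_le_epsilon)
        fix \<eta> :: real assume "\<eta> > 0"
        define e where "e = \<eta> / 6"
        have "e > 0" using \<open>\<eta> > 0\<close> by (simp add: e_def)
        have "0 \<le> t" "t \<le> 1" using h by auto
        from N_continuous[OF this \<open>e > 0\<close>] obtain \<delta> where "\<delta> > 0"
          and \<delta>: "\<And>u v. 0 \<le> u \<Longrightarrow> u \<le> t \<Longrightarrow> t \<le> v \<Longrightarrow> v \<le> 1 \<Longrightarrow> v - u < \<delta> \<Longrightarrow> N u v \<le> e" by metis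
        obtain \<rho> where "\<rho> > 0" and \<rho>: "\<And>x y. u - \<rho> < x \<Longrightarrow> y < v + \<rho> \<Longrightarrow> W y - W x \<le> U v - U u + e"
          using U[OF \<open>u < v\<close> \<open>e > 0\<close>] by blast
        define \<tau> where "\<tau> = min (min \<delta> \<rho>) (min (1 / k - 2 * s) (e / k))"
        have "\<tau> > 0" using \<open>\<delta> > 0\<close> \<open>\<rho> > 0\<close> s \<open>e > 0\<close> \<open>k > 0\<close> by (simp add: \<tau>_def)
        have "t \<in> closure (E n)" using p(3) h s by (auto simp: dist_real_def)
        then obtain a where "a \<in> E n" and a: "\<bar>a - t\<bar> < \<tau>"
          using \<open>\<tau> > 0\<close> closure_approachable[of t "E n"] by (auto simp: dist_real_def)
        then have a01: "0 \<le> a" "a \<le> 1" using assms(2) by (auto simp: E_def)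
        \<comment> \<open>The tag \<open>t\<close> is replaced by a nearby \<open>a \<in> E n\<close>, for which the interval has to be
          enlarged by less than \<open>\<tau>\<close> on at most one side.\<close>
        define u' where "u' = min u a"
        define v' where "v' = max v a"
        have uv': "0 \<le> u'" "u' \<le> u" "v \<le> v'" "v' \<le> 1" "u' \<le> a" "a \<le> v'" using h a01 by (auto simp: u'_def v'_def)
        have len: "v' - u' < v - u + \<tau>" using a h \<open>\<tau> > 0\<close> \<open>u < v\<close> by (auto simp: u'_def v'_def min_def max_def)
        also have "\<dots> \<le> 1 / k" using h by (simp add: \<tau>_def)
        finally have "N u' v' \<le> k * (v' - u') + (W v' - W u')"
          using \<open>a \<in> E n\<close> uv' unfolding E_def k_def by blast
        also have "k * (v' - u') \<le> k * (v - u) + e"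
        proof -
          have "k * (v' - u') \<le> k * (v - u + \<tau>)" using len \<open>k > 0\<close> by simp
          moreover have "k * \<tau> \<le> k * (e / k)" using \<open>k > 0\<close> by (intro mult_left_mono) (auto simp: \<tau>_def)
          ultimately show ?thesis using \<open>k > 0\<close> by (simp add: distrib_left)
        qed
        also have "W v' - W u' \<le> U v - U u + e"
          using a h \<open>\<tau> > 0\<close> by (intro \<rho>) (auto simp: u'_def v'_def \<tau>_def)
        finally have main: "N u' v' \<le> k * (v - u) + (U v - U u) + 2 * e" by simp
        have left: "N u' u \<le> 2 * e"
        proof (cases "a < u")
          case True
          have "N a u \<le> N a t + N u t" using True h a01 by (intro N_left) auto
          also have "N a t \<le> e" using True h a a01 by (intro \<delta>) (auto simp: \<tau>_def)
          also have "N u t \<le> e" using True h a a01 by (intro \<delta>) (auto simp: \<tau>_def)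
          finally show ?thesis using True by (simp add: u'_def)
        next
          case False
          then show ?thesis using N_refl[of u] h \<open>e > 0\<close> by (simp add: u'_def)
        qed
        have right: "N v v' \<le> 2 * e"
        proof (cases "v < a")
          case True
          have "N v a \<le> N t a + N t v" using True h a01 by (intro N_right) auto
          also have "N t a \<le> e" using True h a a01 by (intro \<delta>) (auto simp: \<tau>_def)
          also have "N t v \<le> e" using True h a a01 by (intro \<delta>) (auto simp: \<tau>_def)
          finally show ?thesis using True by (simp add: v'_def)
        next
          case False
          then show ?thesis using N_refl[of v] h \<open>e > 0\<close> by (simp add: v'_def)
        qed
        have "N u v \<le> N u' v + N u' u" using uv' h by (intro N_right) auto
        also have "N u' v \<le> N u' v' + N v v'" using uv' h by (intro N_left) auto
        finally have "N u v \<le> k * (v - u) + (U v - U u) + 6 * e" using main left right by linarith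
        then show "N u v \<le> V v - V u + \<eta>" by (simp add: V_def e_def right_diff_distrib)
      qed
    qed
  qed
qed

end

section \<open>Series over the gaps of a closed set\<close>

lemma variationally_null_max0:
  assumes "variationally_null D P a b"
  shows "variationally_null (\<lambda>t u v. max 0 (D t u v)) P a b"
proof (rule variationally_nullI)
  fix \<epsilon> :: real assume "\<epsilon> > 0"
  from variationally_nullE[OF assms this] obtain W
    where W: "mono W" "\<And>x. 0 \<le> W x" "\<And>x. W x \<le> \<epsilon>"
      and *: "\<And>t. t \<in> P \<Longrightarrow> near_tag t a b (\<lambda>u v. D t u v \<le> W v - W u)" by metis
  have "near_tag t a b (\<lambda>u v. max 0 (D t u v) \<le> W v - W u)" if t: "t \<in> P" for t
    using *[OF t] *[OF t]
  proof (rule near_tag_mp)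
    fix u v assume "u \<le> t" "t \<le> v" "D t u v \<le> W v - W u"
    then show "max 0 (D t u v) \<le> W v - W u" using monoD[OF W(1), of u v] by simp
  qed
  then show "small_majorant (\<lambda>t u v. max 0 (D t u v)) P a b \<epsilon>"
    using W by (intro exI[of _ W]) simp
qed

text \<open>
  The form of the limit argument used for series: \<open>E\<close> is a finite part, and \<open>W\<close> bounds the tail.
\<close>

lemma variationally_null_of_approximation:
  assumes "\<And>\<epsilon>. \<epsilon> > 0 \<Longrightarrow> \<exists>E W. variationally_null E P a b \<and> mono W \<and> (\<forall>x. 0 \<le> W x \<and> W x \<le> \<epsilon>) \<and>
      (\<forall>t\<in>P. \<forall>u v. a \<le> u \<and> u \<le> t \<and> t \<le> v \<and> v \<le> b \<longrightarrow> D t u v \<le> E t u v + (W v - W u))"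
  shows "variationally_null D P a b"
proof (rule variationally_nullI)
  fix \<epsilon> :: real assume "\<epsilon> > 0"
  then have "\<epsilon>/2 > 0" by simp
  from assms[OF this] obtain E V where E: "variationally_null E P a b"
    and V: "mono V" "\<And>x. 0 \<le> V x" "\<And>x. V x \<le> \<epsilon>/2"
    and D: "\<And>t u v. t \<in> P \<Longrightarrow> a \<le> u \<Longrightarrow> u \<le> t \<Longrightarrow> t \<le> v \<Longrightarrow> v \<le> b \<Longrightarrow> D t u v \<le> E t u v + (V v - V u)"
    by metis
  from variationally_nullE[OF E \<open>\<epsilon>/2 > 0\<close>] obtain W
    where W: "mono W" "\<And>x. 0 \<le> W x" "\<And>x. W x \<le> \<epsilon>/2"
      and *: "\<And>t. t \<in> P \<Longrightarrow> near_tag t a b (\<lambda>u v. E t u v \<le> W v - W u)" by metis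
  have "near_tag t a b (\<lambda>u v. D t u v \<le> (V v + W v) - (V u + W u))" if t: "t \<in> P" for t
    using *[OF t] *[OF t]
  proof (rule near_tag_mp)
    fix u v assume "a \<le> u" "u \<le> t" "t \<le> v" "v \<le> b" "E t u v \<le> W v - W u"
    then show "D t u v \<le> (V v + W v) - (V u + W u)" using D[OF t, of u v] by linarith
  qed
  moreover have "mono (\<lambda>x. V x + W x)" using V(1) W(1) by (auto simp: mono_def intro: add_mono)
  moreover have "0 \<le> V x + W x \<and> V x + W x \<le> \<epsilon>" for x
    using V(2,3)[of x] W(2,3)[of x] by linarith
  ultimately show "small_majorant D P a b \<epsilon>"
    by (intro exI[of _ "\<lambda>x. V x + W x"]) simp
qed

text \<open>
  Induction on the intervals in the order of their right end points: all other intervals lie to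
  the left of the last one.
\<close>

lemma sum_increments_disjoint_le:
  fixes V :: "real \<Rightarrow> real"
  assumes "mono V" "finite S" "c \<le> d"
    and "\<And>\<gamma>. \<gamma> \<in> S \<Longrightarrow> c \<le> fst \<gamma> \<and> fst \<gamma> < snd \<gamma> \<and> snd \<gamma> \<le> d"
    and "\<And>\<gamma> \<gamma>'. \<gamma> \<in> S \<Longrightarrow> \<gamma>' \<in> S \<Longrightarrow> \<gamma> \<noteq> \<gamma>' \<Longrightarrow> snd \<gamma> \<le> fst \<gamma>' \<or> snd \<gamma>' \<le> fst \<gamma>"
  shows "(\<Sum>\<gamma>\<in>S. V (snd \<gamma>) - V (fst \<gamma>)) \<le> V d - V c"
proof -
  have "\<forall>d. c \<le> d \<longrightarrow> (\<forall>\<gamma>\<in>S. c \<le> fst \<gamma> \<and> fst \<gamma> < snd \<gamma> \<and> snd \<gamma> \<le> d) \<longrightarrow>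
      (\<forall>\<gamma>\<in>S. \<forall>\<gamma>'\<in>S. \<gamma> \<noteq> \<gamma>' \<longrightarrow> snd \<gamma> \<le> fst \<gamma>' \<or> snd \<gamma>' \<le> fst \<gamma>) \<longrightarrow>
      (\<Sum>\<gamma>\<in>S. V (snd \<gamma>) - V (fst \<gamma>)) \<le> V d - V c"
    using \<open>finite S\<close>
  proof (induction S rule: finite_ranking_induct[where f = snd])
    case empty
    then show ?case using monoD[OF \<open>mono V\<close>] by simp
  next
    case (insert x S)
    show ?case
    proof (intro allI impI)
      fix d assume "c \<le> d" and bounds: "\<forall>\<gamma>\<in>insert x S. c \<le> fst \<gamma> \<and> fst \<gamma> < snd \<gamma> \<and> snd \<gamma> \<le> d"
        and disj: "\<forall>\<gamma>\<in>insert x S. \<forall>\<gamma>'\<in>insert x S. \<gamma> \<noteq> \<gamma>' \<longrightarrow> snd \<gamma> \<le> fst \<gamma>' \<or> snd \<gamma>' \<le> fst \<gamma>"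
      show "(\<Sum>\<gamma>\<in>insert x S. V (snd \<gamma>) - V (fst \<gamma>)) \<le> V d - V c"
      proof (cases "x \<in> S")
        case True
        then show ?thesis using insert.IH \<open>c \<le> d\<close> bounds disj by (simp add: insert_absorb)
      next
        case False
        have "snd y \<le> fst x" if "y \<in> S" for y
        proof -
          have "fst y < snd y" "fst x < snd x" "snd y \<le> snd x" "y \<noteq> x"
            using bounds that insert.hyps False by auto
          then show ?thesis using disj that by force
        qed
        then have "(\<Sum>\<gamma>\<in>S. V (snd \<gamma>) - V (fst \<gamma>)) \<le> V (fst x) - V c"
          using insert.IH bounds disj by simp
        moreover have "V (snd x) \<le> V d" using bounds by (intro monoD[OF \<open>mono V\<close>]) simp
        ultimately show ?thesis using False insert.hyps by simp
      qed
    qed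
  qed
  then show ?thesis using assms by blast
qed

lemma infsum_minus:
  fixes f g :: "'i \<Rightarrow> 'a::real_normed_vector"
  assumes "f summable_on A" "g summable_on A"
  shows "infsum (\<lambda>x. f x - g x) A = infsum f A - infsum g A"
proof -
  have "((\<lambda>x. f x + - g x) has_sum (infsum f A + - infsum g A)) A"
    using assms by (intro has_sum_add has_sum_infsum) (auto simp: has_sum_uminus has_sum_infsum)
  then show ?thesis by (simp add: infsumI)
qed

text \<open>
  An interval tagged in \<open>P\<close> that meets a gap must contain an end point of the gap, so a gap
  contributes at most twice its oscillation \<open>\<omega>\<close>. For finitely many gaps
  this is improved by the hypothesis on the single gaps, and the remaining ones have a small total
  oscillation.
\<close>

lemma gap_series_variationally_null:
  fixes \<kappa> :: "'i \<Rightarrow> real \<Rightarrow> 'a::banach" and lo hi \<omega> :: "'i \<Rightarrow> real"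
  assumes less: "\<And>\<gamma>. \<gamma> \<in> G \<Longrightarrow> lo \<gamma> < hi \<gamma>"
    and gap: "\<And>\<gamma>. \<gamma> \<in> G \<Longrightarrow> P \<inter> {lo \<gamma><..<hi \<gamma>} = {}"
    and left: "\<And>\<gamma> x. \<gamma> \<in> G \<Longrightarrow> x \<le> lo \<gamma> \<Longrightarrow> \<kappa> \<gamma> x = 0"
    and right: "\<And>\<gamma> x. \<gamma> \<in> G \<Longrightarrow> hi \<gamma> \<le> x \<Longrightarrow> \<kappa> \<gamma> x = \<kappa> \<gamma> (hi \<gamma>)"
    and bound: "\<And>\<gamma> u v. \<gamma> \<in> G \<Longrightarrow> u \<le> v \<Longrightarrow> norm (\<kappa> \<gamma> v - \<kappa> \<gamma> u) \<le> \<omega> \<gamma>"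
    and sum: "\<omega> summable_on G"
    and null: "\<And>\<gamma>. \<gamma> \<in> G \<Longrightarrow> variationally_null (\<lambda>t u v. norm (\<kappa> \<gamma> v - \<kappa> \<gamma> u)) P a b"
  shows "variationally_null (\<lambda>t u v. norm (infsum (\<lambda>\<gamma>. \<kappa> \<gamma> v) G - infsum (\<lambda>\<gamma>. \<kappa> \<gamma> u) G)) P a b"
proof (rule variationally_null_of_approximation)
  fix \<epsilon> :: real assume "\<epsilon> > 0"
  have \<omega>0: "0 \<le> \<omega> \<gamma>" if "\<gamma> \<in> G" for \<gamma>
    using bound[OF that, of 0 0] by simp
  have \<kappa>_sum: "(\<lambda>\<gamma>. \<kappa> \<gamma> x) summable_on A" if "A \<subseteq> G" for x A
  proof -
    have "norm (\<kappa> \<gamma> x) \<le> \<omega> \<gamma>" if "\<gamma> \<in> G" for \<gamma>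
      using bound[OF that, of "min x (lo \<gamma>)" x] left[OF that, of "min x (lo \<gamma>)"] by simp
    then have "(\<lambda>\<gamma>. \<kappa> \<gamma> x) abs_summable_on G"
      by (rule Infinite_Sum.abs_summable_on_comparison_test'[OF sum])
    from abs_summable_summable[OF this] show ?thesis
      by (rule summable_on_subset_banach) (rule that)
  qed
  have "\<epsilon>/2 > 0" using \<open>\<epsilon> > 0\<close> by simp
  from infsum_finite_approximation[OF sum this] obtain F
    where "finite F \<and> F \<subseteq> G \<and> dist (sum \<omega> F) (infsum \<omega> G) \<le> \<epsilon>/2" ..
  then have F: "finite F" "F \<subseteq> G" "dist (sum \<omega> F) (infsum \<omega> G) \<le> \<epsilon>/2" by auto
  define T where "T = G - F"
  have T: "T \<subseteq> G" by (auto simp: T_def)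
  have \<omega>T: "\<omega> summable_on T" using summable_on_subset_banach[OF sum T] .
  have "infsum \<omega> T = infsum \<omega> G - infsum \<omega> F"
    unfolding T_def using sum F by (intro infsum_Diff) auto
  then have tail: "infsum \<omega> T \<le> \<epsilon>/2" using F abs_ge_minus_self[of "sum \<omega> F - infsum \<omega> G"] by (simp add: dist_real_def)
  \<comment> \<open>Outside the finitely many gaps in \<open>F\<close>, the jumps of \<open>\<tau>\<close> at both ends of a gap pay
    for the variation over that gap of every interval tagged in \<open>P\<close>.\<close>
  define \<tau> :: "'i \<Rightarrow> real \<Rightarrow> real" where "\<tau> \<gamma> x = (if x \<le> lo \<gamma> then 0 else if x < hi \<gamma> then 1 else 2)" for \<gamma> x
  have \<tau>_mono: "\<tau> \<gamma> x \<le> \<tau> \<gamma> y" if "\<gamma> \<in> G" "x \<le> y" for \<gamma> x y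
    using less[OF that(1)] that(2) by (auto simp: \<tau>_def)
  have \<tau>_sum: "(\<lambda>\<gamma>. \<omega> \<gamma> * \<tau> \<gamma> x) summable_on T" for x
  proof -
    have "(\<lambda>\<gamma>. norm (\<omega> \<gamma> * \<tau> \<gamma> x)) summable_on T"
    proof (rule Infinite_Sum.abs_summable_on_comparison_test')
      show "(\<lambda>\<gamma>. \<omega> \<gamma> * 2) summable_on T" by (rule summable_on_cmult_left[OF \<omega>T])
      show "norm (\<omega> \<gamma> * \<tau> \<gamma> x) \<le> \<omega> \<gamma> * 2" if "\<gamma> \<in> T" for \<gamma>
        using \<omega>0[of \<gamma>] that T by (auto simp: \<tau>_def abs_mult)
    qed
    then show ?thesis by (rule abs_summable_summable)
  qed
  define W where "W x = infsum (\<lambda>\<gamma>. \<omega> \<gamma> * \<tau> \<gamma> x) T" for x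
  have "mono W"
    unfolding W_def
  proof (intro monoI infsum_mono \<tau>_sum)
    fix x y :: real and \<gamma> assume "x \<le> y" "\<gamma> \<in> T"
    then show "\<omega> \<gamma> * \<tau> \<gamma> x \<le> \<omega> \<gamma> * \<tau> \<gamma> y"
      using \<tau>_mono[of \<gamma> x y] \<omega>0[of \<gamma>] T by (intro mult_left_mono) auto
  qed
  moreover have "0 \<le> W x \<and> W x \<le> \<epsilon>" for x
  proof
    show "0 \<le> W x" unfolding W_def using \<omega>0 T by (intro infsum_nonneg) (auto simp: \<tau>_def)
    have "W x \<le> infsum (\<lambda>\<gamma>. \<omega> \<gamma> * 2) T"
      unfolding W_def
    proof (rule infsum_mono[OF \<tau>_sum summable_on_cmult_left[OF \<omega>T]])
      show "\<omega> \<gamma> * \<tau> \<gamma> x \<le> \<omega> \<gamma> * 2" if "\<gamma> \<in> T" for \<gamma>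
        using \<omega>0[of \<gamma>] that T by (intro mult_left_mono) (auto simp: \<tau>_def)
    qed
    also have "\<dots> = infsum \<omega> T * 2" by (rule infsum_cmult_left) (use \<omega>T in simp)
    finally show "W x \<le> \<epsilon>" using tail by simp
  qed
  moreover have "variationally_null (\<lambda>t u v. \<Sum>\<gamma>\<in>F. norm (\<kappa> \<gamma> v - \<kappa> \<gamma> u)) P a b"
    using F null by (intro variationally_null_sum) auto
  moreover have "norm (infsum (\<lambda>\<gamma>. \<kappa> \<gamma> v) G - infsum (\<lambda>\<gamma>. \<kappa> \<gamma> u) G)
      \<le> (\<Sum>\<gamma>\<in>F. norm (\<kappa> \<gamma> v - \<kappa> \<gamma> u)) + (W v - W u)"
    if t: "t \<in> P" and uv: "u \<le> t" "t \<le> v" for t u v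
  proof -
    have split: "infsum (\<lambda>\<gamma>. \<kappa> \<gamma> x) G = (\<Sum>\<gamma>\<in>F. \<kappa> \<gamma> x) + infsum (\<lambda>\<gamma>. \<kappa> \<gamma> x) T" for x
    proof -
      have "infsum (\<lambda>\<gamma>. \<kappa> \<gamma> x) T = infsum (\<lambda>\<gamma>. \<kappa> \<gamma> x) G - infsum (\<lambda>\<gamma>. \<kappa> \<gamma> x) F"
        unfolding T_def using F by (intro infsum_Diff \<kappa>_sum) auto
      then show ?thesis using F by simp
    qed
    have termwise: "norm (\<kappa> \<gamma> v - \<kappa> \<gamma> u) \<le> \<omega> \<gamma> * \<tau> \<gamma> v - \<omega> \<gamma> * \<tau> \<gamma> u" if \<gamma>: "\<gamma> \<in> T" for \<gamma>
    proof -
      have \<gamma>: "\<gamma> \<in> G" using \<gamma> T by blast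
      then have "t \<le> lo \<gamma> \<or> hi \<gamma> \<le> t" using gap[OF \<gamma>] t by (auto simp: not_less)
      then show ?thesis
      proof
        assume "t \<le> lo \<gamma>"
        then have "\<tau> \<gamma> u = 0" "\<kappa> \<gamma> u = 0" using uv left[OF \<gamma>] by (auto simp: \<tau>_def)
        moreover have "\<kappa> \<gamma> v = 0 \<and> \<tau> \<gamma> v = 0 \<or> \<tau> \<gamma> v \<ge> 1" using left[OF \<gamma>, of v] by (auto simp: \<tau>_def)
        moreover have "norm (\<kappa> \<gamma> v - \<kappa> \<gamma> u) \<le> \<omega> \<gamma> * 1" using bound[OF \<gamma>, of u v] uv by simp
        moreover have "\<omega> \<gamma> * 1 \<le> \<omega> \<gamma> * \<tau> \<gamma> v" if "\<tau> \<gamma> v \<ge> 1"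
          using that \<omega>0[OF \<gamma>] by (intro mult_left_mono)
        ultimately show ?thesis by auto
      next
        assume "hi \<gamma> \<le> t"
        then have v: "\<tau> \<gamma> v = 2" "\<kappa> \<gamma> v = \<kappa> \<gamma> (hi \<gamma>)"
          using uv right[OF \<gamma>, of v] less[OF \<gamma>] by (auto simp: \<tau>_def)
        have "\<kappa> \<gamma> u = \<kappa> \<gamma> (hi \<gamma>) \<and> \<tau> \<gamma> u = 2 \<or> \<tau> \<gamma> u \<le> 1"
          using right[OF \<gamma>, of u] less[OF \<gamma>] by (auto simp: \<tau>_def)
        moreover have "norm (\<kappa> \<gamma> v - \<kappa> \<gamma> u) \<le> \<omega> \<gamma> * 1" using bound[OF \<gamma>, of u v] uv by simp
        moreover have "\<omega> \<gamma> * \<tau> \<gamma> u \<le> \<omega> \<gamma> * 1" if "\<tau> \<gamma> u \<le> 1"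
          using that \<omega>0[OF \<gamma>] by (intro mult_left_mono)
        ultimately show ?thesis using v by auto
      qed
    qed
    have abs: "(\<lambda>\<gamma>. \<kappa> \<gamma> v - \<kappa> \<gamma> u) abs_summable_on T"
      using uv T bound by (intro Infinite_Sum.abs_summable_on_comparison_test'[OF \<omega>T]) auto
    have "infsum (\<lambda>\<gamma>. \<kappa> \<gamma> v) G - infsum (\<lambda>\<gamma>. \<kappa> \<gamma> u) G
        = (\<Sum>\<gamma>\<in>F. \<kappa> \<gamma> v - \<kappa> \<gamma> u) + infsum (\<lambda>\<gamma>. \<kappa> \<gamma> v - \<kappa> \<gamma> u) T"
      unfolding split using \<kappa>_sum[OF T] by (simp add: infsum_minus sum_subtractf)
    also have "norm \<dots> \<le> (\<Sum>\<gamma>\<in>F. norm (\<kappa> \<gamma> v - \<kappa> \<gamma> u)) + infsum (\<lambda>\<gamma>. norm (\<kappa> \<gamma> v - \<kappa> \<gamma> u)) T"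
      by (intro order_trans[OF norm_triangle_ineq] add_mono norm_sum norm_infsum_bound abs)
    also have "infsum (\<lambda>\<gamma>. norm (\<kappa> \<gamma> v - \<kappa> \<gamma> u)) T \<le> infsum (\<lambda>\<gamma>. \<omega> \<gamma> * \<tau> \<gamma> v - \<omega> \<gamma> * \<tau> \<gamma> u) T"
    proof (rule infsum_mono[OF abs _ termwise])
      have "(\<lambda>\<gamma>. \<omega> \<gamma> * \<tau> \<gamma> v + - (\<omega> \<gamma> * \<tau> \<gamma> u)) summable_on T"
        by (intro summable_on_add \<tau>_sum) (simp add: summable_on_uminus \<tau>_sum)
      then show "(\<lambda>\<gamma>. \<omega> \<gamma> * \<tau> \<gamma> v - \<omega> \<gamma> * \<tau> \<gamma> u) summable_on T" by simp
    qed
    also have "\<dots> = W v - W u" unfolding W_def by (intro infsum_minus \<tau>_sum)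
    finally show ?thesis by simp
  qed
  ultimately show "\<exists>E W. variationally_null E P a b \<and> mono W \<and> (\<forall>x. 0 \<le> W x \<and> W x \<le> \<epsilon>) \<and>
      (\<forall>t\<in>P. \<forall>u v. a \<le> u \<and> u \<le> t \<and> t \<le> v \<and> v \<le> b \<longrightarrow>
        norm (infsum (\<lambda>\<gamma>. \<kappa> \<gamma> v) G - infsum (\<lambda>\<gamma>. \<kappa> \<gamma> u) G) \<le> E t u v + (W v - W u))"
    by (intro exI[of _ "\<lambda>t u v. \<Sum>\<gamma>\<in>F. norm (\<kappa> \<gamma> v - \<kappa> \<gamma> u)"] exI[of _ W]) simp
qed

lemma strongly_measurable_restrict:
  fixes f :: "real \<Rightarrow> 'a::real_normed_vector"
  assumes f: "strongly_measurable (lebesgue_on {a..b}) f" and "a \<le> c" "d \<le> b" and P: "P \<in> sets lebesgue"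
  shows "strongly_measurable (lebesgue_on {c..d}) (\<lambda>t. if t \<in> P then f t else 0)"
proof -
  from f[unfolded strongly_measurable_def] obtain s
    where s: "(\<forall>n. simple_function (lebesgue_on {a..b}) (s n)) \<and> (AE x in lebesgue_on {a..b}. (\<lambda>n. s n x) \<longlonglongrightarrow> f x)" ..
  have iff: "A \<in> sets (lebesgue_on {p..q}) \<longleftrightarrow> A \<subseteq> {p..q} \<and> A \<in> sets lebesgue" for A and p q :: real
    by (rule sets_restrict_space_iff) simp
  define s' where "s' n x = (if x \<in> P then s n x else 0)" for n x
  have "simple_function (lebesgue_on {c..d}) (s' n)" for n
  proof -
    have simp: "simple_function (lebesgue_on {a..b}) (s n)" using s by blast
    have "simple_function (lebesgue_on {c..d}) (s n)"
      unfolding simple_function_def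
    proof
      have "s n ` {c..d} \<subseteq> s n ` {a..b}" using \<open>a \<le> c\<close> \<open>d \<le> b\<close> by auto
      then show "finite (s n ` space (lebesgue_on {c..d}))"
        using simple_functionD(1)[OF simp] by (simp add: finite_subset)
      show "\<forall>x\<in>s n ` space (lebesgue_on {c..d}). s n -` {x} \<inter> space (lebesgue_on {c..d}) \<in> sets (lebesgue_on {c..d})"
      proof
        fix x
        have "s n -` {x} \<inter> {a..b} \<in> sets (lebesgue_on {a..b})" using simple_functionD(2)[OF simp, of "{x}"] by simp
        then have "s n -` {x} \<inter> {a..b} \<in> sets lebesgue"
          unfolding iff by (rule conjunct2)
        then have "(s n -` {x} \<inter> {a..b}) \<inter> {c..d} \<in> sets lebesgue" by (rule sets.Int) simp
        moreover have "(s n -` {x} \<inter> {a..b}) \<inter> {c..d} = s n -` {x} \<inter> {c..d}"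
          using \<open>a \<le> c\<close> \<open>d \<le> b\<close> by auto
        ultimately have "s n -` {x} \<inter> {c..d} \<in> sets lebesgue" by (simp only:)
        then have "s n -` {x} \<inter> {c..d} \<in> sets (lebesgue_on {c..d})"
          unfolding iff by blast
        then show "s n -` {x} \<inter> space (lebesgue_on {c..d}) \<in> sets (lebesgue_on {c..d})" by simp
      qed
    qed
    moreover have "{x \<in> space (lebesgue_on {c..d}). x \<in> P} \<in> sets (lebesgue_on {c..d})"
    proof -
      have "{c..d} \<inter> P \<in> sets lebesgue" using P by (intro sets.Int) auto
      then have "{c..d} \<inter> P \<in> sets (lebesgue_on {c..d})"
        unfolding iff by blast
      moreover have "{x \<in> space (lebesgue_on {c..d}). x \<in> P} = {c..d} \<inter> P" by auto
      ultimately show ?thesis by (simp only:)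
    qed
    ultimately show ?thesis unfolding s'_def by (intro simple_function_If) simp_all
  qed
  moreover have "AE x in lebesgue_on {c..d}. (\<lambda>n. s' n x) \<longlonglongrightarrow> (if x \<in> P then f x else 0)"
  proof -
    have "AE x in lebesgue. x \<in> {a..b} \<longrightarrow> (\<lambda>n. s n x) \<longlonglongrightarrow> f x"
      using s by (simp add: AE_restrict_space_iff)
    then have "AE x in lebesgue. x \<in> {c..d} \<longrightarrow> (\<lambda>n. s' n x) \<longlonglongrightarrow> (if x \<in> P then f x else 0)"
      by eventually_elim (use \<open>a \<le> c\<close> \<open>d \<le> b\<close> in \<open>auto simp: s'_def\<close>)
    then show ?thesis by (simp add: AE_restrict_space_iff)
  qed
  ultimately show ?thesis unfolding strongly_measurable_def by (intro exI[of _ s']) simp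
qed

section \<open>Integrability of controlled functions\<close>

lemma closed_set_gap:
  fixes P :: "real set"
  assumes "closed P" "c \<in> P" "d \<in> P" "c \<le> t" "t \<le> d" "t \<notin> P"
  obtains \<alpha> \<beta> where "\<alpha> \<in> P" "\<beta> \<in> P" "c \<le> \<alpha>" "\<alpha> < t" "t < \<beta>" "\<beta> \<le> d" "P \<inter> {\<alpha><..<\<beta>} = {}"
proof -
  define \<alpha> where "\<alpha> = Sup (P \<inter> {c..t})"
  define \<beta> where "\<beta> = Inf (P \<inter> {t..d})"
  have ne: "P \<inter> {c..t} \<noteq> {}" "P \<inter> {t..d} \<noteq> {}" using assms by auto
  have bdd: "bdd_above (P \<inter> {c..t})" "bdd_below (P \<inter> {t..d})" by (auto intro: bdd_above_Int2 bdd_below_Int2)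
  have \<alpha>: "\<alpha> \<in> P \<inter> {c..t}" unfolding \<alpha>_def
    by (rule closed_contains_Sup[OF ne(1) bdd(1)]) (intro closed_Int \<open>closed P\<close> closed_atLeastAtMost)
  have \<beta>: "\<beta> \<in> P \<inter> {t..d}" unfolding \<beta>_def
    by (rule closed_contains_Inf[OF ne(2) bdd(2)]) (intro closed_Int \<open>closed P\<close> closed_atLeastAtMost)
  have "x \<le> \<alpha>" if "x \<in> P" "c \<le> x" "x \<le> t" for x
    unfolding \<alpha>_def using that by (intro cSup_upper bdd) auto
  moreover have "\<beta> \<le> x" if "x \<in> P" "t \<le> x" "x \<le> d" for x
    unfolding \<beta>_def using that by (intro cInf_lower bdd) auto
  ultimately have "P \<inter> {\<alpha><..<\<beta>} = {}" using \<alpha> \<beta> by fastforce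
  moreover have "\<alpha> < t" "t < \<beta>" using \<alpha> \<beta> \<open>t \<notin> P\<close> by (auto simp: less_le)
  ultimately show thesis using \<alpha> \<beta> by (intro that[of \<alpha> \<beta>]) auto
qed

context controlled_function
begin

text \<open>
  For the truncations \<open>q m\<close> of the norm, \<open>(v - u) * q m t\<close> is bounded by the increments of \<open>V\<close> up to
  negligible errors if \<open>t \<in> P\<close>, and it vanishes otherwise. By Cousin's lemma the integrals of all
  truncations are bounded by the total increase of \<open>V\<close>, and monotone convergence applies.
\<close>

lemma norm_integrable_on_portion:
  assumes "closed P" "0 \<le> c" "c \<le> d" "d \<le> 1" "mono V"
    and V: "\<And>t u v. t \<in> P \<Longrightarrow> c \<le> u \<Longrightarrow> u \<le> t \<Longrightarrow> t \<le> v \<Longrightarrow> v \<le> d \<Longrightarrow> N u v \<le> V v - V u"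
  shows "(\<lambda>t. norm (if t \<in> P then f t else 0)) integrable_on {c..d}"
proof -
  let ?h = "\<lambda>t. if t \<in> P then f t else 0"
  have "P \<in> sets lebesgue" using \<open>closed P\<close> by (simp add: borel_closed)
  then have sm: "strongly_measurable (lebesgue_on {c..d}) ?h"
    using measurable assms by (intro strongly_measurable_restrict)
  obtain A g where A: "negligible A" and g: "\<And>x. g x = (if x \<in> A then 0 else ?h x)"
    and g_meas[measurable]: "(\<lambda>x. norm (g x)) \<in> borel_measurable (lebesgue_on {c..d})"
    by (rule strongly_measurable_pointwise[OF sm], rule that)
  have g_le: "norm (g t) \<le> (if t \<in> P then norm (f t) else 0)" for t by (simp add: g)
  define q where "q m t = min (norm (g t)) (real m)" for m t
  have q_int: "q m integrable_on {c..d}" for m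
  proof (rule measurable_bounded_by_integrable_imp_integrable_real)
    show "q m \<in> borel_measurable (lebesgue_on {c..d})" unfolding q_def by measurable
    show "(\<lambda>_. real m) integrable_on {c..d}" by (rule integrable_const_ivl)
    show "\<bar>q m x\<bar> \<le> real m" for x by (simp add: q_def)
  qed simp
  have q_bound: "integral {c..d} (q m) \<le> V d - V c" for m
  proof -
    define Q where "Q x = integral {c..x} (q m)" for x
    have Q: "variational_primitive (q m) Q c d"
      unfolding Q_def by (rule integrable_imp_variational_primitive[OF q_int \<open>c \<le> d\<close>])
    have "variationally_null (\<lambda>t u v. (v - u) * norm (f t) - N u v) {c..d} c d"
      by (rule variationally_null_mono[OF f_bound]) (use assms in auto)
    then have "variationally_null (\<lambda>t u v. max 0 ((v - u) * norm (f t) - N u v)) {c..d} c d"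
      by (rule variationally_null_max0)
    with Q[unfolded variational_primitive_def]
    have null: "variationally_null (\<lambda>t u v. norm (Q v - Q u - (v - u) *\<^sub>R q m t)
        + max 0 ((v - u) * norm (f t) - N u v)) {c..d} c d"
      by (rule variationally_null_add)
    have "Q d - Q c \<le> V d - V c"
    proof (rule subadditive_le_of_variationally_null[OF \<open>c \<le> d\<close> null])
      fix t assume t: "c \<le> t" "t \<le> d"
      have "Q v - Q u \<le> norm (Q v - Q u - (v - u) *\<^sub>R q m t) + max 0 ((v - u) * norm (f t) - N u v) + (V v - V u)"
        if uv: "c \<le> u" "u \<le> t" "t \<le> v" "v \<le> d" for u v
      proof -
        have "Q v - Q u \<le> norm (Q v - Q u - (v - u) *\<^sub>R q m t) + (v - u) * q m t" by (simp add: abs_if)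
        moreover have "(v - u) * q m t \<le> max 0 ((v - u) * norm (f t) - N u v) + (V v - V u)"
        proof (cases "t \<in> P")
          case True
          have "q m t \<le> norm (f t)" using g_le[of t] True by (simp add: q_def)
          then have "(v - u) * q m t \<le> (v - u) * norm (f t)" using uv by (intro mult_left_mono) auto
          then show ?thesis using V[OF True uv] by linarith
        next
          case False
          then have "q m t = 0" using g_le[of t] by (simp add: q_def)
          moreover have "V u \<le> V v" using uv by (intro monoD[OF \<open>mono V\<close>]) auto
          ultimately show ?thesis by simp
        qed
        ultimately show ?thesis by linarith
      qed
      then show "near_tag t c d (\<lambda>u v. Q v - Q u \<le> norm (Q v - Q u - (v - u) *\<^sub>R q m t) + max 0 ((v - u) * norm (f t) - N u v) + (V v - V u))"
        by (intro exI[of _ 1]) simp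
    qed simp
    then show ?thesis by (simp add: Q_def)
  qed
  have "(\<lambda>t. norm (g t)) integrable_on {c..d} \<and> (\<lambda>m. integral {c..d} (q m)) \<longlonglongrightarrow> integral {c..d} (\<lambda>t. norm (g t))"
  proof (rule monotone_convergence_increasing[OF q_int])
    show "q m t \<le> q (Suc m) t" for m t by (simp add: q_def)
    show "(\<lambda>m. q m t) \<longlonglongrightarrow> norm (g t)" for t
    proof (rule tendsto_eventually)
      obtain M where M: "norm (g t) \<le> real M" using real_arch_simple by blast
      show "\<forall>\<^sub>F m in sequentially. q m t = norm (g t)"
        by (rule eventually_sequentiallyI[of M]) (use M in \<open>simp add: q_def\<close>)
    qed
    have "0 \<le> integral {c..d} (q m)" for m
      by (intro Henstock_Kurzweil_Integration.integral_nonneg q_int) (simp add: q_def)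
    then show "bounded (range (\<lambda>m. integral {c..d} (q m)))"
      using q_bound by (intro boundedI[of _ "V d - V c"]) auto
  qed
  then have "(\<lambda>t. norm (g t)) integrable_on {c..d}" ..
  then show ?thesis
    by (rule integrable_spike[OF _ A]) (simp add: g)
qed

text \<open>
  The Harnack extension. The primitive is the Bochner integral \<open>B\<close> over \<open>P\<close> plus the sum \<open>K\<close> of
  the primitives \<open>\<kappa>\<close> over the gaps. Tags in \<open>P\<close> do not see \<open>K\<close> by
  \<open>gap_series_variationally_null\<close>; inside a gap only the \<open>\<kappa>\<close> of this gap varies, and
  \<open>B\<close> is a primitive of zero. The gaps are countably many.
\<close>

lemma variationally_integrable_on_portion:
  assumes "closed P" "c \<in> P" "d \<in> P" "0 \<le> c" "c \<le> d" "d \<le> 1" "mono V"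
    and V: "\<And>t u v. t \<in> P \<Longrightarrow> c \<le> u \<Longrightarrow> u \<le> t \<Longrightarrow> t \<le> v \<Longrightarrow> v \<le> d \<Longrightarrow> N u v \<le> V v - V u"
    and off: "\<And>u v. c \<le> u \<Longrightarrow> u \<le> v \<Longrightarrow> v \<le> d \<Longrightarrow> P \<inter> {u..v} = {} \<Longrightarrow> variationally_integrable f u v"
  shows "variationally_integrable f c d"
proof -
  let ?h = "\<lambda>t. if t \<in> P then f t else 0"
  have "P \<in> sets lebesgue" using \<open>closed P\<close> by (simp add: borel_closed)
  then have "strongly_measurable (lebesgue_on {c..d}) ?h"
    using measurable assms by (intro strongly_measurable_restrict)
  moreover have "(\<lambda>t. norm (?h t)) integrable_on {c..d}"
    using assms by (intro norm_integrable_on_portion) auto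
  ultimately obtain B where B: "variational_primitive ?h B c d"
    using strongly_measurable_norm_integrable_imp_variational_primitive \<open>c \<le> d\<close> by metis
  define G where "G = {\<gamma>. fst \<gamma> \<in> P \<and> snd \<gamma> \<in> P \<and> c \<le> fst \<gamma> \<and> fst \<gamma> < snd \<gamma> \<and> snd \<gamma> \<le> d \<and>
      P \<inter> {fst \<gamma><..<snd \<gamma>} = {}}"
  have G: "fst \<gamma> \<in> P" "snd \<gamma> \<in> P" "c \<le> fst \<gamma>" "fst \<gamma> < snd \<gamma>" "snd \<gamma> \<le> d" "P \<inter> {fst \<gamma><..<snd \<gamma>} = {}"
    if "\<gamma> \<in> G" for \<gamma> using that by (auto simp: G_def)
  have disj: "snd \<gamma> \<le> fst \<gamma>' \<or> snd \<gamma>' \<le> fst \<gamma>" if "\<gamma> \<in> G" "\<gamma>' \<in> G" "\<gamma> \<noteq> \<gamma>'" for \<gamma> \<gamma>'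
  proof (rule ccontr)
    assume *: "\<not> ?thesis"
    have "fst \<gamma> \<notin> {fst \<gamma>'<..<snd \<gamma>'}" "fst \<gamma>' \<notin> {fst \<gamma><..<snd \<gamma>}"
      "snd \<gamma> \<notin> {fst \<gamma>'<..<snd \<gamma>'}" "snd \<gamma>' \<notin> {fst \<gamma><..<snd \<gamma>}"
      using G[OF that(1)] G[OF that(2)] by blast+
    then have "fst \<gamma> = fst \<gamma>'" "snd \<gamma> = snd \<gamma>'"
      using * G(4)[OF that(1)] G(4)[OF that(2)] by auto
    then show False using \<open>\<gamma> \<noteq> \<gamma>'\<close> by (simp add: prod_eq_iff)
  qed
  define gap where "gap \<gamma> k \<longleftrightarrow>
      (\<forall>a b. variational_primitive (\<lambda>t. if fst \<gamma> < t \<and> t < snd \<gamma> then f t else 0) k a b) \<and>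
      variational_primitive f k (fst \<gamma>) (snd \<gamma>) \<and> (\<forall>x\<le>fst \<gamma>. k x = 0) \<and>
      (\<forall>x\<ge>snd \<gamma>. k x = k (snd \<gamma>))" for \<gamma> and k :: "real \<Rightarrow> 'a"
  have gap_ex: "\<exists>k. gap \<gamma> k" if \<gamma>: "\<gamma> \<in> G" for \<gamma>
  proof -
    have bounds: "0 \<le> fst \<gamma>" "snd \<gamma> \<le> 1" using G[OF \<gamma>] assms by auto
    have int: "variationally_integrable f u v" if "fst \<gamma> < u" "u \<le> v" "v < snd \<gamma>" for u v
    proof (rule off)
      have "{u..v} \<subseteq> {fst \<gamma><..<snd \<gamma>}" using that by auto
      then show "P \<inter> {u..v} = {}" using G(6)[OF \<gamma>] by blast
    qed (use that G[OF \<gamma>] in auto)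
    show ?thesis
    proof (rule gap_primitive[OF bounds(1) G(4)[OF \<gamma>] bounds(2)])
      show "variationally_integrable f u v" if "fst \<gamma> < u" "u \<le> v" "v < snd \<gamma>" for u v
        by (rule int[OF that])
      fix k assume k: "\<And>a b. variational_primitive (\<lambda>t. if fst \<gamma> < t \<and> t < snd \<gamma> then f t else 0) k a b"
        "variational_primitive f k (fst \<gamma>) (snd \<gamma>)" "\<And>x. x \<le> fst \<gamma> \<Longrightarrow> k x = 0"
        "\<And>x. snd \<gamma> \<le> x \<Longrightarrow> k x = k (snd \<gamma>)"
      have "gap \<gamma> k" unfolding gap_def by (intro conjI allI impI k; assumption)
      then show ?thesis by (rule exI[of _ k])
    qed
  qed
  define \<kappa> where "\<kappa> \<gamma> = (SOME k. gap \<gamma> k)" for \<gamma>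
  have "gap \<gamma> (\<kappa> \<gamma>)" if "\<gamma> \<in> G" for \<gamma>
    unfolding \<kappa>_def using gap_ex[OF that] by (rule someI_ex)
  then have
        \<kappa>: "\<And>\<gamma> a b. \<gamma> \<in> G \<Longrightarrow> variational_primitive (\<lambda>t. if fst \<gamma> < t \<and> t < snd \<gamma> then f t else 0) (\<kappa> \<gamma>) a b"
    and \<kappa>f: "\<And>\<gamma>. \<gamma> \<in> G \<Longrightarrow> variational_primitive f (\<kappa> \<gamma>) (fst \<gamma>) (snd \<gamma>)"
    and \<kappa>l: "\<And>\<gamma> x. \<gamma> \<in> G \<Longrightarrow> x \<le> fst \<gamma> \<Longrightarrow> \<kappa> \<gamma> x = 0"
    and \<kappa>r: "\<And>\<gamma> x. \<gamma> \<in> G \<Longrightarrow> snd \<gamma> \<le> x \<Longrightarrow> \<kappa> \<gamma> x = \<kappa> \<gamma> (snd \<gamma>)"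
    unfolding gap_def by blast+
  define \<omega> where "\<omega> \<gamma> = 2 * (V (snd \<gamma>) - V (fst \<gamma>))" for \<gamma>
  have \<kappa>_bound: "norm (\<kappa> \<gamma> v - \<kappa> \<gamma> u) \<le> \<omega> \<gamma>" if \<gamma>: "\<gamma> \<in> G" and "u \<le> v" for \<gamma> u v
  proof -
    define cl where "cl x = max (fst \<gamma>) (min (snd \<gamma>) x)" for x
    have \<kappa>_cl: "\<kappa> \<gamma> (cl x) = \<kappa> \<gamma> x" for x
      using \<kappa>l[OF \<gamma>, of x] \<kappa>l[OF \<gamma>, of "fst \<gamma>"] \<kappa>r[OF \<gamma>, of x] G(4)[OF \<gamma>] by (auto simp: cl_def max_def min_def)
    have cl: "fst \<gamma> \<le> cl u" "cl u \<le> cl v" "cl v \<le> snd \<gamma>"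
      using \<open>u \<le> v\<close> G(4)[OF \<gamma>] by (auto simp: cl_def)
    have "norm (\<kappa> \<gamma> (cl v) - \<kappa> \<gamma> (cl u)) \<le> N (cl u) (cl v)"
      using cl G[OF \<gamma>] assms by (intro primitive_le variational_primitive_subset[OF \<kappa>f[OF \<gamma>]]) auto
    also have "\<dots> \<le> N (fst \<gamma>) (cl v) + N (fst \<gamma>) (cl u)"
      using cl G[OF \<gamma>] assms by (intro N_right) auto
    also have "\<dots> \<le> (V (cl v) - V (fst \<gamma>)) + (V (cl u) - V (fst \<gamma>))"
      using cl G[OF \<gamma>] by (intro add_mono V[OF G(1)[OF \<gamma>]]) auto
    also have "\<dots> \<le> \<omega> \<gamma>"
      using monoD[OF \<open>mono V\<close>, of "cl v" "snd \<gamma>"] monoD[OF \<open>mono V\<close>, of "cl u" "snd \<gamma>"] cl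
      by (simp add: \<omega>_def)
    finally show ?thesis by (simp add: \<kappa>_cl)
  qed
  have \<omega>_sum: "\<omega> summable_on G"
  proof (rule nonneg_bdd_above_summable_on)
    show "0 \<le> \<omega> \<gamma>" if "\<gamma> \<in> G" for \<gamma>
      using monoD[OF \<open>mono V\<close>, of "fst \<gamma>" "snd \<gamma>"] G(4)[OF that] by (simp add: \<omega>_def)
    have "sum \<omega> F \<le> 2 * (V d - V c)" if "F \<subseteq> G" "finite F" for F
    proof -
      have "(\<Sum>\<gamma>\<in>F. V (snd \<gamma>) - V (fst \<gamma>)) \<le> V d - V c"
      proof (rule sum_increments_disjoint_le[OF \<open>mono V\<close> \<open>finite F\<close> \<open>c \<le> d\<close>])
        show "c \<le> fst \<gamma> \<and> fst \<gamma> < snd \<gamma> \<and> snd \<gamma> \<le> d" if "\<gamma> \<in> F" for \<gamma>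
          using G[of \<gamma>] that \<open>F \<subseteq> G\<close> by blast
        show "snd \<gamma> \<le> fst \<gamma>' \<or> snd \<gamma>' \<le> fst \<gamma>" if "\<gamma> \<in> F" "\<gamma>' \<in> F" "\<gamma> \<noteq> \<gamma>'" for \<gamma> \<gamma>'
          using disj that \<open>F \<subseteq> G\<close> by blast
      qed
      then have "2 * (\<Sum>\<gamma>\<in>F. V (snd \<gamma>) - V (fst \<gamma>)) \<le> 2 * (V d - V c)" by simp
      then show ?thesis unfolding \<omega>_def sum_distrib_left .
    qed
    then show "bdd_above (sum \<omega> ` {F. F \<subseteq> G \<and> finite F})" by (intro bdd_aboveI2) auto
  qed
  have \<kappa>_sum: "(\<lambda>\<gamma>. \<kappa> \<gamma> x) summable_on G" for x
  proof (rule abs_summable_summable[OF Infinite_Sum.abs_summable_on_comparison_test'[OF \<omega>_sum]])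
    show "norm (\<kappa> \<gamma> x) \<le> \<omega> \<gamma>" if "\<gamma> \<in> G" for \<gamma>
      using \<kappa>_bound[OF that, of "min x (fst \<gamma>)" x] \<kappa>l[OF that, of "min x (fst \<gamma>)"] by simp
  qed
  define K where "K x = infsum (\<lambda>\<gamma>. \<kappa> \<gamma> x) G" for x
  define F where "F x = B x + K x" for x
  let ?D = "\<lambda>t u v. increment_error f F t u v"
  have on_P: "variationally_null ?D (P \<inter> {c..d}) c d"
  proof (rule variationally_null_mono)
    have "variationally_null (\<lambda>t u v. norm (K v - K u)) (P \<inter> {c..d}) c d"
      unfolding K_def
    proof (rule gap_series_variationally_null[where lo = fst and hi = snd and \<omega> = \<omega>])
      fix \<gamma> assume \<gamma>: "\<gamma> \<in> G"
      show "variationally_null (\<lambda>t u v. norm (\<kappa> \<gamma> v - \<kappa> \<gamma> u)) (P \<inter> {c..d}) c d"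
      proof (rule variationally_null_mono[OF \<kappa>[OF \<gamma>, unfolded variational_primitive_def, of c d]])
        fix t u v assume "t \<in> P \<inter> {c..d}"
        then have "\<not> (fst \<gamma> < t \<and> t < snd \<gamma>)" using G(6)[OF \<gamma>] by auto
        then have "(if fst \<gamma> < t \<and> t < snd \<gamma> then f t else 0) = 0" by (rule if_not_P)
        then show "norm (\<kappa> \<gamma> v - \<kappa> \<gamma> u)
            \<le> norm (\<kappa> \<gamma> v - \<kappa> \<gamma> u - (v - u) *\<^sub>R (if fst \<gamma> < t \<and> t < snd \<gamma> then f t else 0))"
          by (simp only: scaleR_zero_right diff_zero order_refl)
      qed auto
      show "P \<inter> {c..d} \<inter> {fst \<gamma><..<snd \<gamma>} = {}" using G(6)[OF \<gamma>] by blast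
      show "fst \<gamma> < snd \<gamma>" by (rule G(4)[OF \<gamma>])
      show "\<kappa> \<gamma> x = 0" if "x \<le> fst \<gamma>" for x by (rule \<kappa>l[OF \<gamma> that])
      show "\<kappa> \<gamma> x = \<kappa> \<gamma> (snd \<gamma>)" if "snd \<gamma> \<le> x" for x by (rule \<kappa>r[OF \<gamma> that])
      show "norm (\<kappa> \<gamma> v - \<kappa> \<gamma> u) \<le> \<omega> \<gamma>" if "u \<le> v" for u v by (rule \<kappa>_bound[OF \<gamma> that])
    qed (rule \<omega>_sum)
    moreover have "variationally_null (increment_error ?h B) (P \<inter> {c..d}) c d"
      by (rule variationally_null_mono[OF B[unfolded variational_primitive_def]]) auto
    ultimately show "variationally_null (\<lambda>t u v. increment_error ?h B t u v + norm (K v - K u)) (P \<inter> {c..d}) c d"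
      by (intro variationally_null_add)
    fix t u v assume "t \<in> P \<inter> {c..d}"
    then have "F v - F u - (v - u) *\<^sub>R f t = (B v - B u - (v - u) *\<^sub>R ?h t) + (K v - K u)"
      by (simp add: F_def)
    then show "?D t u v \<le> increment_error ?h B t u v + norm (K v - K u)"
      by (metis norm_triangle_ineq)
  qed auto
  have on_gap: "variationally_null ?D {fst \<gamma><..<snd \<gamma>} c d" if \<gamma>: "\<gamma> \<in> G" for \<gamma>
  proof -
    have "variationally_null (\<lambda>t u v. increment_error ?h B t u v + increment_error f (\<kappa> \<gamma>) t u v)
        {fst \<gamma>..snd \<gamma>} (fst \<gamma>) (snd \<gamma>)"
      using variational_primitive_subset[OF B G(3,5)[OF \<gamma>]] \<kappa>f[OF \<gamma>]
      unfolding variational_primitive_def by (rule variationally_null_add)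
    then show ?thesis
    proof (rule variationally_null_localize)
      fix t u v assume h: "t \<in> {fst \<gamma><..<snd \<gamma>}" "fst \<gamma> \<le> u" "u \<le> t" "t \<le> v" "v \<le> snd \<gamma>"
      have others: "\<kappa> \<gamma>' v - \<kappa> \<gamma>' u = 0" if "\<gamma>' \<in> G - {\<gamma>}" for \<gamma>'
      proof -
        have "\<gamma>' \<in> G" "\<gamma>' \<noteq> \<gamma>" using that by auto
        from disj[OF this(1) \<gamma> this(2)] show ?thesis
        proof
          assume "snd \<gamma>' \<le> fst \<gamma>"
          then show ?thesis using \<kappa>r[OF \<open>\<gamma>' \<in> G\<close>, of u] \<kappa>r[OF \<open>\<gamma>' \<in> G\<close>, of v] h by simp
        next
          assume "snd \<gamma> \<le> fst \<gamma>'"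
          then show ?thesis using \<kappa>l[OF \<open>\<gamma>' \<in> G\<close>, of u] \<kappa>l[OF \<open>\<gamma>' \<in> G\<close>, of v] h by simp
        qed
      qed
      have "K v - K u = infsum (\<lambda>\<gamma>. \<kappa> \<gamma> v - \<kappa> \<gamma> u) G"
        unfolding K_def by (intro infsum_minus[symmetric] \<kappa>_sum)
      also have "\<dots> = infsum (\<lambda>\<gamma>. \<kappa> \<gamma> v - \<kappa> \<gamma> u) {\<gamma>}"
        using others \<gamma> by (intro infsum_cong_neutral) auto
      finally have K: "K v - K u = \<kappa> \<gamma> v - \<kappa> \<gamma> u" by simp
      have "t \<notin> P" using h(1) G(6)[OF \<gamma>] by blast
      then have "F v - F u - (v - u) *\<^sub>R f t = (B v - B u - (v - u) *\<^sub>R ?h t) + (\<kappa> \<gamma> v - \<kappa> \<gamma> u - (v - u) *\<^sub>R f t)"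
        using K by (simp add: F_def algebra_simps)
      then show "?D t u v \<le> increment_error ?h B t u v + increment_error f (\<kappa> \<gamma>) t u v"
        by (metis norm_triangle_ineq)
    qed auto
  qed
  have "countable G"
  proof -
    define \<I> where "\<I> \<gamma> = {fst \<gamma><..<snd \<gamma>}" for \<gamma> :: "real \<times> real"
    have dj: "\<I> \<gamma> \<inter> \<I> \<gamma>' = {}" if "\<gamma> \<in> G" "\<gamma>' \<in> G" "\<gamma> \<noteq> \<gamma>'" for \<gamma> \<gamma>'
      using disj[OF that] by (auto simp: \<I>_def)
    have ne: "\<I> \<gamma> \<noteq> {}" if "\<gamma> \<in> G" for \<gamma>
      using G(4)[OF that] by (simp add: \<I>_def)
    have "countable (\<I> ` G)"
    proof (rule countable_disjoint_open_subsets)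
      show "open S" if "S \<in> \<I> ` G" for S using that by (auto simp: \<I>_def)
      show "disjoint (\<I> ` G)" using dj unfolding disjoint_def by blast
    qed
    moreover have "inj_on \<I> G" using dj ne by (intro inj_onI) (metis Int_absorb)
    ultimately show ?thesis by (rule countable_image_inj_on)
  qed
  then have "variationally_null ?D (\<Union>\<gamma>\<in>G. {fst \<gamma><..<snd \<gamma>}) c d"
    using on_gap by (rule variationally_null_countable_UN)
  with on_P have "variationally_null ?D ((P \<inter> {c..d}) \<union> (\<Union>\<gamma>\<in>G. {fst \<gamma><..<snd \<gamma>})) c d"
    by (rule variationally_null_Un)
  then have "variational_primitive f F c d"
    unfolding variational_primitive_def
  proof (rule variationally_null_mono)
    show "{c..d} \<subseteq> (P \<inter> {c..d}) \<union> (\<Union>\<gamma>\<in>G. {fst \<gamma><..<snd \<gamma>})"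
    proof
      fix t assume t: "t \<in> {c..d}"
      show "t \<in> (P \<inter> {c..d}) \<union> (\<Union>\<gamma>\<in>G. {fst \<gamma><..<snd \<gamma>})"
      proof (cases "t \<in> P")
        case False
        obtain \<alpha> \<beta> where "\<alpha> \<in> P" "\<beta> \<in> P" "c \<le> \<alpha>" "\<alpha> < t" "t < \<beta>" "\<beta> \<le> d" "P \<inter> {\<alpha><..<\<beta>} = {}"
          using closed_set_gap[OF \<open>closed P\<close> \<open>c \<in> P\<close> \<open>d \<in> P\<close>] t False by (metis atLeastAtMost_iff)
        then have "(\<alpha>, \<beta>) \<in> G" "t \<in> {fst (\<alpha>, \<beta>)<..<snd (\<alpha>, \<beta>)}" by (auto simp: G_def)
        then show ?thesis by blast
      qed (use t in blast)
    qed
  qed auto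
  then show ?thesis unfolding variationally_integrable_def by blast
qed

lemma variationally_integrable_of_open_interval:
  assumes "0 \<le> \<alpha>" "\<alpha> \<le> \<beta>" "\<beta> \<le> 1"
    and int: "\<And>u v. \<alpha> < u \<Longrightarrow> u \<le> v \<Longrightarrow> v < \<beta> \<Longrightarrow> variationally_integrable f u v"
  shows "variationally_integrable f \<alpha> \<beta>"
proof (cases "\<alpha> = \<beta>")
  case True
  have "variational_primitive f (\<lambda>_. 0) \<beta> \<beta>"
    unfolding variational_primitive_def
  proof (rule variationally_null_zero)
    fix t u v :: real assume "\<beta> \<le> u" "u \<le> t" "t \<le> v" "v \<le> \<beta>"
    then have "v = u" by simp
    then show "norm (0 - 0 - (v - u) *\<^sub>R f t) \<le> 0" by simp
  qed
  then show ?thesis using True unfolding variationally_integrable_def by blast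
next
  case False
  then have "\<alpha> < \<beta>" using \<open>\<alpha> \<le> \<beta>\<close> by simp
  show ?thesis
  proof (rule gap_primitive[OF assms(1) \<open>\<alpha> < \<beta>\<close> assms(3)])
    show "variationally_integrable f u v" if "\<alpha> < u" "u \<le> v" "v < \<beta>" for u v
      by (rule int[OF that])
    fix \<kappa> assume "variational_primitive f \<kappa> \<alpha> \<beta>"
    then show ?thesis unfolding variationally_integrable_def by blast
  qed
qed

text \<open>
  The set \<open>R\<close> collects the points near which \<open>f\<close> is integrable, and \<open>P\<close> the others. If \<open>P\<close> were not empty,
  the interval \<open>{c1..d1}\<close> around a point of \<open>P\<close> given by \<open>portion_with_monotone_bound\<close> would decompose
  into the convex hull \<open>{c2..d2}\<close> of the part of \<open>P\<close> in it and two outer intervals that meet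
  \<open>P\<close> at most at one end point, and \<open>f\<close> would be integrable on all three.
\<close>

lemma variationally_integrable_unit_interval: "variationally_integrable f 0 1"
proof -
  define R where "R = {t. \<exists>\<delta>>0. \<forall>u v. 0 \<le> u \<and> u \<le> v \<and> v \<le> 1 \<and> t - \<delta> < u \<and> v < t + \<delta> \<longrightarrow>
      variationally_integrable f u v}"
  have "open R"
    unfolding open_dist
  proof
    fix t assume "t \<in> R"
    then obtain \<delta> where "\<delta> > 0" and \<delta>: "\<And>u v. 0 \<le> u \<Longrightarrow> u \<le> v \<Longrightarrow> v \<le> 1 \<Longrightarrow> t - \<delta> < u \<Longrightarrow> v < t + \<delta> \<Longrightarrow>
        variationally_integrable f u v" unfolding R_def by blast
    have "y \<in> R" if "dist y t < \<delta>/2" for y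
      unfolding R_def
    proof (intro CollectI exI[of _ "\<delta>/2"] conjI allI impI)
      show "\<delta>/2 > 0" using \<open>\<delta> > 0\<close> by simp
      fix u v assume "0 \<le> u \<and> u \<le> v \<and> v \<le> 1 \<and> y - \<delta>/2 < u \<and> v < y + \<delta>/2"
      then show "variationally_integrable f u v"
        using that by (intro \<delta>) (auto simp: dist_real_def abs_if split: if_splits)
    qed
    then show "\<exists>e>0. \<forall>y. dist y t < e \<longrightarrow> y \<in> R" using \<open>\<delta> > 0\<close> by (intro exI[of _ "\<delta>/2"]) auto
  qed
  have on_R: "variationally_integrable f a b" if h: "0 \<le> a" "a \<le> b" "b \<le> 1" "{a..b} \<subseteq> R" for a b
  proof (rule variationally_integrable_of_local[OF h(2)])
    fix t assume "a \<le> t" "t \<le> b"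
    then have "t \<in> R" using h by auto
    then obtain \<delta> where "\<delta> > 0" and \<delta>: "\<And>u v. 0 \<le> u \<Longrightarrow> u \<le> v \<Longrightarrow> v \<le> 1 \<Longrightarrow> t - \<delta> < u \<Longrightarrow> v < t + \<delta> \<Longrightarrow>
        variationally_integrable f u v" unfolding R_def by blast
    have "variationally_integrable f u v" if "a \<le> u" "u \<le> t" "t \<le> v" "v \<le> b" "v - u < \<delta>" for u v
      using that h by (intro \<delta>) auto
    then show "near_tag t a b (\<lambda>u v. variationally_integrable f u v)"
      using \<open>\<delta> > 0\<close> by blast
  qed
  define P where "P = {0..1} - R"
  have "P = {}"
  proof (rule ccontr)
    assume "P \<noteq> {}"
    moreover have "closed P" unfolding P_def using \<open>open R\<close> by (intro closed_Diff) auto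
    moreover have "P \<subseteq> {0..1}" by (auto simp: P_def)
    ultimately obtain c d p V where p: "p \<in> P" "c < p" "p < d" and "mono V"
      and V: "\<And>t u v. t \<in> P \<Longrightarrow> 0 \<le> u \<Longrightarrow> c \<le> u \<Longrightarrow> u \<le> t \<Longrightarrow> t \<le> v \<Longrightarrow> v \<le> d \<Longrightarrow> v \<le> 1 \<Longrightarrow> N u v \<le> V v - V u"
      using portion_with_monotone_bound by metis
    define c1 where "c1 = max 0 c"
    define d1 where "d1 = min 1 d"
    define Q where "Q = P \<inter> {c1..d1}"
    have cd1: "0 \<le> c1" "c \<le> c1" "c1 \<le> p" "p \<le> d1" "d1 \<le> d" "d1 \<le> 1"
      using p \<open>P \<subseteq> {0..1}\<close> by (auto simp: c1_def d1_def)
    have "closed Q" unfolding Q_def using \<open>closed P\<close> by (intro closed_Int) auto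
    have "p \<in> Q" using p cd1 by (auto simp: Q_def)
    then have ne: "Q \<noteq> {}" by blast
    have bdd: "bdd_above Q" "bdd_below Q" by (auto simp: Q_def intro: bdd_above_Int2 bdd_below_Int2)
    define c2 where "c2 = Inf Q"
    define d2 where "d2 = Sup Q"
    have c2: "c2 \<in> Q" unfolding c2_def by (rule closed_contains_Inf[OF ne bdd(2) \<open>closed Q\<close>])
    have d2: "d2 \<in> Q" unfolding d2_def by (rule closed_contains_Sup[OF ne bdd(1) \<open>closed Q\<close>])
    have Q_le: "c2 \<le> x" "x \<le> d2" if "x \<in> Q" for x
      using that cInf_lower[OF _ bdd(2)] cSup_upper[OF _ bdd(1)] by (auto simp: c2_def d2_def)
    have cd2: "c1 \<le> c2" "c2 \<le> d2" "d2 \<le> d1" using c2 d2 Q_le[OF c2] by (auto simp: Q_def)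
    have off_Q: "variationally_integrable f u v" if h: "c1 \<le> u" "u \<le> v" "v \<le> d1" "Q \<inter> {u..v} = {}" for u v
    proof (rule on_R)
      show "{u..v} \<subseteq> R"
      proof
        fix x assume "x \<in> {u..v}"
        then have "x \<notin> Q" "x \<in> {c1..d1}" "x \<in> {0..1}" using h cd1 by auto
        then show "x \<in> R" by (auto simp: Q_def P_def)
      qed
    qed (use h cd1 in auto)
    have left: "variationally_integrable f c1 c2"
    proof (rule variationally_integrable_of_open_interval)
      fix u v assume h: "c1 < u" "u \<le> v" "v < c2"
      have "Q \<inter> {u..v} = {}" using Q_le(1) h by fastforce
      then show "variationally_integrable f u v" using h cd1 cd2 by (intro off_Q) auto
    qed (use cd1 cd2 in auto)
    have right: "variationally_integrable f d2 d1"
    proof (rule variationally_integrable_of_open_interval)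
      fix u v assume h: "d2 < u" "u \<le> v" "v < d1"
      have "Q \<inter> {u..v} = {}" using Q_le(2) h by fastforce
      then show "variationally_integrable f u v" using h cd1 cd2 by (intro off_Q) auto
    qed (use cd1 cd2 in auto)
    have "variationally_integrable f c2 d2"
    proof (rule variationally_integrable_on_portion[OF \<open>closed Q\<close> c2 d2 _ _ _ \<open>mono V\<close>])
      show "N u v \<le> V v - V u" if "t \<in> Q" "c2 \<le> u" "u \<le> t" "t \<le> v" "v \<le> d2" for t u v
        using that cd1 cd2 by (intro V[of t]) (auto simp: Q_def)
      show "variationally_integrable f u v" if "c2 \<le> u" "u \<le> v" "v \<le> d2" "Q \<inter> {u..v} = {}" for u v
        using that cd1 cd2 by (intro off_Q) auto
    qed (use cd1 cd2 in auto)
    with left have "variationally_integrable f c1 d2"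
      using cd2 by (intro variationally_integrable_join[of f c1 c2 d2])
    from this right have int: "variationally_integrable f c1 d1"
      using cd2 by (intro variationally_integrable_join[of f c1 d2 d1]) auto
    have "p \<in> R"
      unfolding R_def
    proof (intro CollectI exI[of _ "min (p - c) (d - p)"] conjI allI impI)
      show "min (p - c) (d - p) > 0" using p by simp
      fix u v assume "0 \<le> u \<and> u \<le> v \<and> v \<le> 1 \<and> p - min (p - c) (d - p) < u \<and> v < p + min (p - c) (d - p)"
      then show "variationally_integrable f u v"
        by (intro variationally_integrable_subset[OF int]) (auto simp: c1_def d1_def)
    qed
    then show False using p by (simp add: P_def)
  qed
  then show ?thesis by (intro on_R) (auto simp: P_def)
qed

end

section \<open>Selections of variationally Henstock integrable multifunctions\<close>

lemma topspace_weak_topology: "topspace (weak_topology :: 'a::real_normed_vector topology) = UNIV"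
proof -
  have "(\<lambda>_ :: 'a. 0 :: real) -` UNIV \<in> {g -` U | (g :: 'a \<Rightarrow> real) U. bounded_linear g \<and> open U}"
    using bounded_linear_zero open_UNIV by blast
  then have "openin weak_topology ((\<lambda>_ :: 'a. 0 :: real) -` UNIV)"
    unfolding weak_topology_def by (rule topology_generated_by_Basis)
  then show ?thesis using openin_subset by fastforce
qed

lemma cwk_bounded: "K \<in> cwk \<Longrightarrow> bounded K"
  unfolding cwk_def using compactin_weak_topology_imp_bounded by blast

lemma cwk_nonempty: "K \<in> cwk \<Longrightarrow> K \<noteq> {}"
  unfolding cwk_def by blast

lemma singleton_in_cwk: "{x} \<in> cwk"
  by (simp add: cwk_def topspace_weak_topology compactin_sing)

lemma bdd_above_infdist_image:
  fixes A B :: "'a::metric_space set"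
  assumes "bounded A" "B \<noteq> {}"
  shows "bdd_above ((\<lambda>x. infdist x B) ` A)"
proof -
  obtain b where "b \<in> B" using \<open>B \<noteq> {}\<close> by blast
  obtain e where "\<And>x. x \<in> A \<Longrightarrow> dist b x \<le> e" using bounded_any_center[of A b] \<open>bounded A\<close> by blast
  then have "infdist x B \<le> e" if "x \<in> A" for x
    using infdist_le[OF \<open>b \<in> B\<close>, of x] that by (metis dist_commute order_trans)
  then show ?thesis by (rule bdd_aboveI2)
qed

lemma infdist_le_hausdorff_dist:
  assumes "bounded A" "bounded B" "A \<noteq> {}" "B \<noteq> {}"
  shows "x \<in> A \<Longrightarrow> infdist x B \<le> hausdorff_dist A B" "y \<in> B \<Longrightarrow> infdist y A \<le> hausdorff_dist A B"
proof -
  assume "x \<in> A"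
  from cSUP_upper[OF this bdd_above_infdist_image] show "infdist x B \<le> hausdorff_dist A B"
    using assms unfolding hausdorff_dist_def by (simp add: le_max_iff_disj)
next
  assume "y \<in> B"
  from cSUP_upper[OF this bdd_above_infdist_image] show "infdist y A \<le> hausdorff_dist A B"
    using assms unfolding hausdorff_dist_def by (simp add: le_max_iff_disj)
qed

lemma hausdorff_dist_singletons: "hausdorff_dist {x} {y} = dist x y"
  by (simp add: hausdorff_dist_def infdist_singleton dist_commute)

lemma norm_le_infdist_plus:
  fixes x :: "'a::real_normed_vector"
  assumes "S \<noteq> {}" "\<And>s. s \<in> S \<Longrightarrow> norm s \<le> M"
  shows "norm x \<le> infdist x S + M"
proof -
  have "norm x - M \<le> (INF s\<in>S. dist x s)"
  proof (rule cINF_greatest[OF \<open>S \<noteq> {}\<close>])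
    fix s assume "s \<in> S"
    then show "norm x - M \<le> dist x s"
      using norm_triangle_ineq2[of x s] assms(2)[of s] by (simp add: dist_norm)
  qed
  then show ?thesis using \<open>S \<noteq> {}\<close> by (simp add: infdist_notempty)
qed

lemma infdist_set_plus_le:
  fixes A B :: "'a::real_normed_vector set"
  assumes "A \<noteq> {}" "B \<noteq> {}"
  shows "infdist (x + y) (A + B) \<le> infdist x A + infdist y B"
proof -
  have *: "infdist (x + y) (A + B) - dist y b \<le> infdist x A" if "b \<in> B" for b
    unfolding infdist_notempty[OF \<open>A \<noteq> {}\<close>]
  proof (rule cINF_greatest[OF \<open>A \<noteq> {}\<close>])
    fix a assume "a \<in> A"
    then have "infdist (x + y) (A + B) \<le> dist (x + y) (a + b)"
      using \<open>b \<in> B\<close> by (intro infdist_le set_plus_intro)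
    also have "\<dots> \<le> dist x a + dist y b" by (rule dist_triangle_add)
    finally show "infdist (x + y) (A + B) - dist y b \<le> dist x a" by simp
  qed
  have "infdist (x + y) (A + B) - infdist x A \<le> (INF b\<in>B. dist y b)"
    by (rule cINF_greatest[OF \<open>B \<noteq> {}\<close>]) (use * in force)
  then show ?thesis using \<open>B \<noteq> {}\<close> by (simp add: infdist_notempty)
qed

lemma additive_interval_fun_adjacent:
  assumes "additive_interval_fun \<Phi>" "0 \<le> u" "u \<le> v" "v \<le> w" "w \<le> 1"
  shows "\<Phi> {u..w} = \<Phi> {u..v} + \<Phi> {v..w}"
proof -
  have sub: "{u..v} \<in> subintervals" "{v..w} \<in> subintervals" "{u..w} \<in> subintervals"
    unfolding subintervals_def using assms(2-) by auto
  moreover have un: "{u..v} \<union> {v..w} = {u..w}" using assms(3,4) by (rule ivl_disj_un_two_touch)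
  moreover have "interior {u..v} \<inter> interior {v..w} = {}" by auto
  ultimately show ?thesis using assms(1) unfolding additive_interval_fun_def by metis
qed

text \<open>
  Degenerate intervals need care: additivity makes \<open>\<Phi> {t}\<close> the sum of two copies of itself, hence \<open>{0}\<close>.
\<close>

lemma vH_primitive_variationally_null:
  fixes \<Gamma> :: "real \<Rightarrow> 'a::real_normed_vector set"
  assumes \<Phi>: "vH_primitive \<Gamma> \<Phi>" and \<Gamma>: "\<And>t. t \<in> {0..1} \<Longrightarrow> \<Gamma> t \<in> cwk"
  shows "variationally_null (\<lambda>t u v. hausdorff_dist (\<Phi> {u..v}) ((\<lambda>x. measure lborel {u..v} *\<^sub>R x) ` \<Gamma> t)) {0..1} 0 1"
proof -
  define D where "D t I = hausdorff_dist (\<Phi> I) ((\<lambda>x. measure lborel I *\<^sub>R x) ` \<Gamma> t)" for t I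
  have \<Phi>_cwk: "\<Phi> {u..v} \<in> cwk" if "0 \<le> u" "u \<le> v" "v \<le> 1" for u v
    using \<Phi> that unfolding vH_primitive_def subintervals_def by blast
  have add: "additive_interval_fun \<Phi>" using \<Phi> unfolding vH_primitive_def by blast
  have "variationally_null (\<lambda>t u v. D t {u..v}) {0..1} 0 1"
  proof (rule variationally_null_of_gauge)
    show "(0::real) \<le> 1" by simp
    fix t u v :: real assume h: "0 \<le> u" "u \<le> t" "t \<le> v" "v \<le> 1"
    let ?B = "(\<lambda>x. measure lborel {u..v} *\<^sub>R x) ` \<Gamma> t"
    have "\<Phi> {u..v} \<in> cwk" "\<Gamma> t \<in> cwk" using h by (auto intro!: \<Phi>_cwk \<Gamma>)
    then have "bounded (\<Phi> {u..v})" "\<Phi> {u..v} \<noteq> {}" "bounded ?B" "?B \<noteq> {}"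
      by (simp_all only: cwk_bounded cwk_nonempty bounded_scaling image_is_empty not_False_eq_True)
    moreover obtain x where "x \<in> \<Phi> {u..v}" using calculation by blast
    ultimately have "infdist x ?B \<le> D t {u..v}"
      unfolding D_def by (intro infdist_le_hausdorff_dist(1))
    then show "0 \<le> D t {u..v}" using infdist_nonneg order_trans by blast
  next
    fix t :: real assume t: "0 \<le> t" "t \<le> 1"
    have cwk: "\<Phi> {t} \<in> cwk" "\<Gamma> t \<in> cwk" using t \<Phi>_cwk[of t t] \<Gamma>[of t] by auto
    have double: "\<Phi> {t} = \<Phi> {t} + \<Phi> {t}"
      using additive_interval_fun_adjacent[OF add, of t t t] t by simp
    \<comment> \<open>A bounded set closed under doubling consists of the origin only.\<close>
    have "\<Phi> {t} = {0}"
    proof -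
      obtain M where M: "\<And>x. x \<in> \<Phi> {t} \<Longrightarrow> norm x \<le> M" using cwk_bounded[OF cwk(1)] by (auto simp: bounded_iff)
      have "x = 0" if x: "x \<in> \<Phi> {t}" for x
      proof (rule ccontr)
        assume "x \<noteq> 0"
        have pow: "2 ^ n *\<^sub>R x \<in> \<Phi> {t}" for n :: nat
        proof (induction n)
          case (Suc n)
          have "2 ^ n *\<^sub>R x + 2 ^ n *\<^sub>R x \<in> \<Phi> {t} + \<Phi> {t}" using Suc by (intro set_plus_intro)
          moreover have "2 ^ Suc n *\<^sub>R x = 2 ^ n *\<^sub>R x + 2 ^ n *\<^sub>R x" by (simp add: scaleR_2[symmetric])
          ultimately show ?case using double by simp
        qed (use x in simp)
        obtain n where "M / norm x < 2 ^ n" using real_arch_pow[of 2] by auto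
        then have "M < norm (2 ^ n *\<^sub>R x)" using \<open>x \<noteq> 0\<close> by (simp add: field_simps)
        then show False using M[OF pow[of n]] by simp
      qed
      then show ?thesis using cwk_nonempty[OF cwk(1)] by blast
    qed
    moreover have "(\<lambda>x. measure lborel {t} *\<^sub>R x) ` \<Gamma> t = {0}"
      using cwk_nonempty[OF cwk(2)] by auto
    ultimately show "D t {t} \<le> 0" by (simp add: D_def hausdorff_dist_singletons)
  next
    fix \<epsilon> :: real assume "\<epsilon> > 0"
    then have "\<exists>d :: real \<Rightarrow> real. (\<forall>t\<in>{0..1}. d t > 0) \<and>
        (\<forall>p. p tagged_division_of {0..1} \<and> (\<lambda>t. ball t (d t)) fine p \<longrightarrow> (\<Sum>(t, I)\<in>p. D t I) < \<epsilon>)"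
      using \<Phi> unfolding vH_primitive_def D_def by simp
    then obtain d where d: "(\<forall>t\<in>{0..1}. d t > (0::real)) \<and>
        (\<forall>p. p tagged_division_of {0..1} \<and> (\<lambda>t. ball t (d t)) fine p \<longrightarrow> (\<Sum>(t, I)\<in>p. D t I) < \<epsilon>)" ..
    define \<gamma> where "\<gamma> t = ball t (if t \<in> {0..1} then d t else 1)" for t
    have "gauge \<gamma>" unfolding \<gamma>_def using d by (auto intro!: gaugeI)
    moreover have "(\<Sum>(t, I)\<in>p. D t I) \<le> \<epsilon>" if p: "p tagged_division_of {0..1}" "\<gamma> fine p" for p
    proof -
      have "(\<lambda>t. ball t (d t)) fine p"
        unfolding fine_def
      proof clarify
        fix t I y assume "(t, I) \<in> p" "y \<in> I"
        moreover from this have "t \<in> {0..1}" using tagged_division_ofD(2,3)[OF p(1)] by blast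
        moreover have "I \<subseteq> \<gamma> t" using p(2) \<open>(t, I) \<in> p\<close> by (auto simp: fine_def)
        ultimately show "y \<in> ball t (d t)" unfolding \<gamma>_def by auto
      qed
      then show ?thesis using d p(1) by (intro less_imp_le) blast
    qed
    ultimately show "\<exists>\<gamma>. gauge \<gamma> \<and>
        (\<forall>p. p tagged_division_of {0..1} \<and> \<gamma> fine p \<longrightarrow> (\<Sum>(t, I)\<in>p. D t I) \<le> \<epsilon>)"
      by (intro exI[of _ \<gamma>]) simp
  qed
  then show ?thesis by (simp add: D_def)
qed

text \<open>
  The bounds on \<open>N\<close> and \<open>f\<close> follow from both halves of the Hausdorff distance. For the last
  property, the distance of \<open>F v - F u\<close> from \<open>\<Phi> {u..v}\<close> is subadditive by
  \<open>infdist_set_plus_le\<close> and locally dominated by the errors of \<open>F\<close> and \<open>\<Phi>\<close>, so it vanishes.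
\<close>

lemma vH_selection_controlled_function:
  fixes \<Gamma> :: "real \<Rightarrow> 'a::banach set" and f :: "real \<Rightarrow> 'a"
  assumes \<Phi>: "vH_primitive \<Gamma> \<Phi>" and \<Gamma>: "\<And>t. t \<in> {0..1} \<Longrightarrow> \<Gamma> t \<in> cwk"
    and f: "\<And>t. t \<in> {0..1} \<Longrightarrow> f t \<in> \<Gamma> t" and meas: "strongly_measurable (lebesgue_on {0..1}) f"
  defines "N \<equiv> \<lambda>u v. Sup (norm ` \<Phi> {u..v})"
    and "C \<equiv> \<lambda>t. if t \<in> {0..1} then Sup (norm ` \<Gamma> t) else 0"
  shows "controlled_function f N C"
proof -
  define H where "H t u v = hausdorff_dist (\<Phi> {u..v}) ((\<lambda>x. measure lborel {u..v} *\<^sub>R x) ` \<Gamma> t)" for t u v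
  have H_null: "variationally_null H {0..1} 0 1"
    unfolding H_def using \<Phi> \<Gamma> by (rule vH_primitive_variationally_null)
  have \<Phi>_cwk: "\<Phi> {u..v} \<in> cwk" if "0 \<le> u" "u \<le> v" "v \<le> 1" for u v
    using \<Phi> that unfolding vH_primitive_def subintervals_def by blast
  have add: "additive_interval_fun \<Phi>" using \<Phi> unfolding vH_primitive_def by blast
  have split: "\<Phi> {u..w} = \<Phi> {u..v} + \<Phi> {v..w}" if "0 \<le> u" "u \<le> v" "v \<le> w" "w \<le> 1" for u v w
    by (rule additive_interval_fun_adjacent[OF add that])
  have bdd: "bdd_above (norm ` K)" if K: "K \<in> cwk" for K :: "'a set"
  proof -
    obtain M where "\<And>x. x \<in> K \<Longrightarrow> norm x \<le> M" using cwk_bounded[OF K] unfolding bounded_iff by blast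
    then show ?thesis by (rule bdd_aboveI2)
  qed
  have N_upper: "norm x \<le> N u v" if "x \<in> \<Phi> {u..v}" "0 \<le> u" "u \<le> v" "v \<le> 1" for x u v
    unfolding N_def using that bdd[OF \<Phi>_cwk] by (intro cSup_upper) auto
  have N_least: "N u v \<le> M" if "\<And>x. x \<in> \<Phi> {u..v} \<Longrightarrow> norm x \<le> M" "0 \<le> u" "u \<le> v" "v \<le> 1" for u v M
    unfolding N_def using that cwk_nonempty[OF \<Phi>_cwk[of u v]] by (intro cSup_least) auto
  have C_upper: "norm x \<le> C t" if "x \<in> \<Gamma> t" "t \<in> {0..1}" for x t
    unfolding C_def using that bdd[OF \<Gamma>] by (auto intro!: cSup_upper)
  have H_sets: "bounded (\<Phi> {u..v})" "bounded ((\<lambda>x. measure lborel {u..v} *\<^sub>R x) ` \<Gamma> t)" "\<Phi> {u..v} \<noteq> {}"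
      "(\<lambda>x. measure lborel {u..v} *\<^sub>R x) ` \<Gamma> t \<noteq> {}"
    if "0 \<le> u" "u \<le> t" "t \<le> v" "v \<le> 1" for t u v
    using cwk_bounded[OF \<Phi>_cwk[of u v]] cwk_nonempty[OF \<Phi>_cwk[of u v]]
      bounded_scaling[OF cwk_bounded[OF \<Gamma>[of t]]] cwk_nonempty[OF \<Gamma>[of t]] that
    by (simp_all only: image_is_empty atLeastAtMost_iff order_trans[of 0 u t] order_trans[of t v 1] order_trans[of u t v])
      blast+
  have f_H: "infdist ((v - u) *\<^sub>R f t) (\<Phi> {u..v}) \<le> H t u v" if "0 \<le> u" "u \<le> t" "t \<le> v" "v \<le> 1" for t u v
    unfolding H_def using that f[of t] by (intro infdist_le_hausdorff_dist(2) H_sets[OF that]) auto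
  show ?thesis
  proof
    fix u v w :: real assume uvw: "0 \<le> u" "u \<le> v" "v \<le> w" "w \<le> 1"
    then have uv: "0 \<le> u" "u \<le> v" "v \<le> 1" and vw: "0 \<le> v" "v \<le> w" "w \<le> 1" and uw: "0 \<le> u" "u \<le> w" "w \<le> 1"
      by auto
    show "N u w \<le> N u v + N v w"
    proof (rule N_least[OF _ uw])
      fix x assume "x \<in> \<Phi> {u..w}"
      then obtain y z where "x = y + z" "y \<in> \<Phi> {u..v}" "z \<in> \<Phi> {v..w}"
        unfolding split[OF uvw] by (rule set_plus_elim)
      then show "norm x \<le> N u v + N v w"
        using norm_triangle_ineq[of y z] N_upper[OF _ uv, of y] N_upper[OF _ vw, of z] by simp
    qed
    show "N u v \<le> N u w + N v w"
    proof (rule N_least[OF _ uv])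
      fix x assume x: "x \<in> \<Phi> {u..v}"
      obtain y where y: "y \<in> \<Phi> {v..w}" using cwk_nonempty[OF \<Phi>_cwk[OF vw]] by blast
      have "x + y \<in> \<Phi> {u..w}" unfolding split[OF uvw] using x y by (rule set_plus_intro)
      from N_upper[OF this uw] N_upper[OF y vw] show "norm x \<le> N u w + N v w"
        using norm_triangle_ineq4[of "x + y" y] by simp
    qed
    show "N v w \<le> N u w + N u v"
    proof (rule N_least[OF _ vw])
      fix x assume x: "x \<in> \<Phi> {v..w}"
      obtain y where y: "y \<in> \<Phi> {u..v}" using cwk_nonempty[OF \<Phi>_cwk[OF uv]] by blast
      have "y + x \<in> \<Phi> {u..w}" unfolding split[OF uvw] using y x by (rule set_plus_intro)
      from N_upper[OF this uw] N_upper[OF y uv] show "norm x \<le> N u w + N u v"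
        using norm_triangle_ineq4[of "y + x" y] by simp
    qed
  next
    fix u v :: real assume uv: "0 \<le> u" "u \<le> v" "v \<le> 1"
    obtain x where "x \<in> \<Phi> {u..v}" using cwk_nonempty[OF \<Phi>_cwk[OF uv]] by blast
    from N_upper[OF this uv] show "0 \<le> N u v" using norm_ge_zero order_trans by blast
  next
    fix t :: real
    show "0 \<le> C t"
    proof (cases "t \<in> {0..1}")
      case True
      then show ?thesis using C_upper[OF f[OF True] True] norm_ge_zero order_trans by blast
    next
      case False
      then show ?thesis unfolding C_def by (simp only: if_False order_refl)
    qed
  next
    show "variationally_null (\<lambda>t u v. N u v - (v - u) * C t) {0..1} 0 1"
    proof (rule variationally_null_mono[OF H_null])
      fix t u v :: real assume h: "t \<in> {0..1}" "0 \<le> u" "u \<le> t" "t \<le> v" "v \<le> 1"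
      have "N u v \<le> H t u v + (v - u) * C t"
      proof (rule N_least)
        fix x assume x: "x \<in> \<Phi> {u..v}"
        have "norm x \<le> infdist x ((\<lambda>x. measure lborel {u..v} *\<^sub>R x) ` \<Gamma> t) + (v - u) * C t"
          using H_sets(4)[OF h(2-)] C_upper[OF _ h(1)] h
          by (intro norm_le_infdist_plus) (auto intro!: mult_left_mono)
        also have "infdist x ((\<lambda>x. measure lborel {u..v} *\<^sub>R x) ` \<Gamma> t) \<le> H t u v"
          unfolding H_def using x by (intro infdist_le_hausdorff_dist(1) H_sets[OF h(2-)])
        finally show "norm x \<le> H t u v + (v - u) * C t" by simp
      qed (use h in auto)
      then show "N u v - (v - u) * C t \<le> H t u v" by simp
    qed auto
  next
    show "variationally_null (\<lambda>t u v. (v - u) * norm (f t) - N u v) {0..1} 0 1"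
    proof (rule variationally_null_mono[OF H_null])
      fix t u v :: real assume h: "t \<in> {0..1}" "0 \<le> u" "u \<le> t" "t \<le> v" "v \<le> 1"
      have "norm ((v - u) *\<^sub>R f t) \<le> infdist ((v - u) *\<^sub>R f t) (\<Phi> {u..v}) + N u v"
        using H_sets(3)[OF h(2-)] h by (intro norm_le_infdist_plus N_upper) auto
      then show "(v - u) * norm (f t) - N u v \<le> H t u v"
        using f_H[OF h(2-)] h by simp
    qed auto
  next
    fix F and a b :: real assume ab: "0 \<le> a" "a \<le> b" "b \<le> 1" and F: "variational_primitive f F a b"
    have "infdist (F b - F a) (\<Phi> {a..b}) \<le> 0 - 0"
    proof (rule subadditive_le_of_variationally_null[OF \<open>a \<le> b\<close>, where Y = "\<lambda>_. 0"])
      have "variationally_null H {a..b} a b"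
        using ab by (intro variationally_null_mono[OF H_null]) auto
      with F show "variationally_null (\<lambda>t u v. increment_error f F t u v + H t u v) {a..b} a b"
        unfolding variational_primitive_def by (rule variationally_null_add)
      fix u v w assume h: "a \<le> u" "u \<le> v" "v \<le> w" "w \<le> b"
      have "infdist ((F v - F u) + (F w - F v)) (\<Phi> {u..v} + \<Phi> {v..w})
          \<le> infdist (F v - F u) (\<Phi> {u..v}) + infdist (F w - F v) (\<Phi> {v..w})"
        using h ab by (intro infdist_set_plus_le cwk_nonempty \<Phi>_cwk) auto
      then show "infdist (F w - F u) (\<Phi> {u..w}) \<le> infdist (F v - F u) (\<Phi> {u..v}) + infdist (F w - F v) (\<Phi> {v..w})"
        using split[of u v w] h ab by simp
    next
      fix t assume "a \<le> t" "t \<le> b"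
      have "infdist (F v - F u) (\<Phi> {u..v}) \<le> increment_error f F t u v + H t u v + (0 - 0)"
        if "a \<le> u" "u \<le> t" "t \<le> v" "v \<le> b" for u v
        using infdist_triangle[of "F v - F u" "\<Phi> {u..v}" "(v - u) *\<^sub>R f t"] f_H[of u t v] that ab
        by (simp add: dist_norm)
      then show "near_tag t a b (\<lambda>u v. infdist (F v - F u) (\<Phi> {u..v}) \<le> increment_error f F t u v + H t u v + (0 - 0))"
        by (intro exI[of _ 1]) simp
    qed
    moreover have "norm (F b - F a) \<le> infdist (F b - F a) (\<Phi> {a..b}) + N a b"
      using ab by (intro norm_le_infdist_plus cwk_nonempty \<Phi>_cwk N_upper) auto
    ultimately show "norm (F b - F a) \<le> N a b" by simp
  qed (rule meas)
qed

lemma vH_integrable_fun_of_variational_primitive: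
  fixes f :: "real \<Rightarrow> 'a::real_normed_vector"
  assumes F: "variational_primitive f F 0 1"
  shows "vH_integrable_fun f"
proof -
  define \<phi> where "\<phi> I = F (Sup I) - F (Inf I)" for I
  have \<phi>: "\<phi> {a..b} = F b - F a" if "a \<le> b" for a b using that by (simp add: \<phi>_def)
  have additive: "\<phi> ({a..b} \<union> {c..d}) = \<phi> {a..b} + \<phi> {c..d}"
    if h: "a \<le> b" "c \<le> d" "interior {a..b} \<inter> interior {c..d} = {}" "{a..b} \<union> {c..d} = {p..q}" for a b c d p q
  proof -
    have adjacent: "\<phi> ({a..b} \<union> {c..d}) = \<phi> {a..b} + \<phi> {c..d}"
      if h: "a \<le> b" "c \<le> d" "b \<le> c" "{a..b} \<union> {c..d} = {p..q}" for a b c d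
    proof -
      have "b \<in> {p..q}" "c \<in> {p..q}" unfolding h(4)[symmetric] using h(1,2) by auto
      then have "(b + c) / 2 \<in> {a..b} \<union> {c..d}" unfolding h(4) by auto
      then have "b = c" using h(3) by auto
      then have "{a..b} \<union> {c..d} = {a..d}" using h(1,2) by (simp add: ivl_disj_un_two_touch)
      then show ?thesis using h(1,2) \<open>b = c\<close> \<phi>[of a d] \<phi>[of a b] \<phi>[of c d] by simp
    qed
    consider "b \<le> c" | "d \<le> a" | "a = b" "{a..b} \<subseteq> {c..d}" | "c = d" "{c..d} \<subseteq> {a..b}"
    proof -
      have "{max a c<..<min b d} = {}" using h(3) by auto
      then have "min b d \<le> max a c" using dense[of "max a c" "min b d"] by force
      then show thesis using that h(1,2) by fastforce
    qed
    then show ?thesis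
    proof cases
      case 1
      then show ?thesis using adjacent[OF h(1,2) _ h(4)] by simp
    next
      case 2
      then show ?thesis using adjacent[OF h(2,1)] h(4) by (simp add: Un_commute add.commute)
    next
      case 3
      then have "{a..b} \<union> {c..d} = {c..d}" by blast
      then show ?thesis using 3(1) \<phi>[of a b] by simp
    next
      case 4
      then have "{a..b} \<union> {c..d} = {a..b}" by blast
      then show ?thesis using 4(1) \<phi>[of c d] by simp
    qed
  qed
  have "vH_primitive (\<lambda>t. {f t}) (\<lambda>I. {\<phi> I})"
    unfolding vH_primitive_def
  proof (intro conjI allI impI ballI)
    show "{\<phi> I} \<in> cwk" for I by (rule singleton_in_cwk)
    show "additive_interval_fun (\<lambda>I. {\<phi> I})"
      unfolding additive_interval_fun_def
    proof (intro ballI impI)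
      fix I J assume I: "I \<in> subintervals" and J: "J \<in> subintervals"
        and IJ: "interior I \<inter> interior J = {} \<and> I \<union> J \<in> subintervals"
      obtain a b where "I = {a..b}" "a \<le> b" using I unfolding subintervals_def by blast
      moreover obtain c d where "J = {c..d}" "c \<le> d" using J unfolding subintervals_def by blast
      moreover obtain p q where "I \<union> J = {p..q}" using IJ unfolding subintervals_def by blast
      ultimately have "\<phi> (I \<union> J) = \<phi> I + \<phi> J" using additive[of a b c d p q] IJ by blast
      then show "{\<phi> (I \<union> J)} = {\<phi> I} + {\<phi> J}" by (simp add: set_plus_def)
    qed
    fix \<epsilon> :: real assume "\<epsilon> > 0"
    define D where "D t I = hausdorff_dist {\<phi> I} ((\<lambda>x. measure lborel I *\<^sub>R x) ` {f t})" for t I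
    have "variationally_null (\<lambda>t u v. D t {u..v}) {0..1} 0 1"
      by (rule variationally_null_mono[OF F[unfolded variational_primitive_def]])
         (auto simp: D_def hausdorff_dist_singletons dist_norm \<phi>)
    from gauge_of_variationally_null[OF zero_le_one this \<open>\<epsilon> > 0\<close>] obtain d
      where d: "(\<forall>t. d t > (0::real)) \<and> (\<forall>p. p tagged_division_of {0..1} \<and> (\<lambda>t. ball t (d t)) fine p \<longrightarrow>
           (\<Sum>(t, I)\<in>p. D t I) < \<epsilon>)" ..
    then show "\<exists>d. (\<forall>t\<in>{0..1}. 0 < d t) \<and> (\<forall>p. p tagged_division_of {0..1} \<and> (\<lambda>t. ball t (d t)) fine p \<longrightarrow>
        (\<Sum>(t, I)\<in>p. hausdorff_dist {\<phi> I} ((\<lambda>x. measure lborel I *\<^sub>R x) ` {f t})) < \<epsilon>)"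
      unfolding D_def by (intro exI[of _ d]) simp
  qed
  then show ?thesis unfolding vH_integrable_fun_def by (rule exI[of _ \<phi>])
qed

theorem theorem3p12:
  fixes \<Gamma> :: "real \<Rightarrow> 'a::banach set"
  assumes "radon_nikodym_property TYPE('a)"
    and "\<forall>t\<in>{0..1}. \<Gamma> t \<in> cwk"
    and "vH_integrable_multi \<Gamma>"
  shows "\<forall>f :: real \<Rightarrow> 'a.
           (\<forall>t\<in>{0..1}. f t \<in> \<Gamma> t) \<and> strongly_measurable (lebesgue_on {0..1}) f
             \<longrightarrow> vH_integrable_fun f"
proof (intro allI impI)
  fix f :: "real \<Rightarrow> 'a"
  assume f: "(\<forall>t\<in>{0..1}. f t \<in> \<Gamma> t) \<and> strongly_measurable (lebesgue_on {0..1}) f"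
  obtain \<Phi> where \<Phi>: "vH_primitive \<Gamma> \<Phi>" using assms(3) unfolding vH_integrable_multi_def by blast
  have "controlled_function f (\<lambda>u v. Sup (norm ` \<Phi> {u..v})) (\<lambda>t. if t \<in> {0..1} then Sup (norm ` \<Gamma> t) else 0)"
    using \<Phi> assms(2) f by (intro vH_selection_controlled_function) auto
  then have "variationally_integrable f 0 1"
    by (rule controlled_function.variationally_integrable_unit_interval)
  then show "vH_integrable_fun f"
    unfolding variationally_integrable_def using vH_integrable_fun_of_variational_primitive by blast
qed

end
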